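(* Consider the linear structural error-in-variables model $y_i=\beta\xi_i+\alpha+\delta_i$, $x_i=\xi_i+\varepsilon_i$, $i\ge1$, with real-valued slope $\beta$ and intercept $\alpha$ to be estimated. Assume (A), (B) and (C) of the context. Then, for $j=1$ and $2$, as $n\to\infty$, (a) $\displaystyle \sqrt{n}\,(\widehat{\alpha}_{jn}-\alpha)\Big(\sum_{i=1}^{n}\big(v_i(j,n)-\overline{v(j,n)}\big)^2/(n-1)\Big)^{-1/2}\xrightarrow{\mathcal{D}}N(0,1)$, (b) $\displaystyle \sqrt{n}\,(\widehat{\alpha}_{jn}-\alpha)\Big(\sum_{i=1}^{n}\big(\widetilde v_i(j,n)-\overline{\widetilde v(j,n)}\big)^2/(n-1)\Big)^{-1/2}\xrightarrow{\mathcal{D}}N(0,1)$.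
   Context: Assumptions. (A) $\{(\delta,\varepsilon),(\delta_i,\varepsilon_i),i\ge1\}$ is a sequence of i.i.d. random vectors with mean zero, $E\delta^4<\infty$, $E\varepsilon^4<\infty$, and positive definite covariance matrix $\Gamma=\begin{pmatrix}\lambda\theta&\mu\\ \mu&\theta\end{pmatrix}$, i.e. $\mathrm{Var}\,\delta=\lambda\theta$, $\mathrm{Var}\,\varepsilon=\theta$, $\mathrm{cov}(\delta,\varepsilon)=\mu$. (B) $\{\xi,\xi_i,i\ge1\}$ are i.i.d. random variables in the domain of attraction of the normal law (DAN), i.e. there are constants $a_n$ and $b_n$, $b_n>0$, for which $(\sum_{i=1}^n\xi_i-a_n)b_n^{-1}\xrightarrow{\mathcal D}N(0,1)$ as $n\to\infty$. (C) $(\delta,\varepsilon)$ and $\xi$ are independent; in the structural model the explanatory variables $\xi_i$ are independent of the error terms $(\delta_i,\varepsilon_i)$. Notation. For real-valued variables $u_i,v_i$, $1\le i\le n$: $\overline u=\frac1n\sum_{i=1}^nu_i$, $s_{i,uv}=(u_i-c\,\overline u)(v_i-c\,\overline v)$, $S_{uv}=\frac1n\sum_{i=1}^ns_{i,uv}$, where $c=0$ if $\alpha$ is known to be zero and $c=1$ if $\alpha$ is unknown. The case $j=1$ is used when $\lambda\theta$ and $\mu$ are known and $\theta$ is unknown: $\widehat\beta_{1n}=\dfrac{S_{yy}-\lambda\theta}{S_{xy}-\mu}$ and $\widehat\alpha_{1n}=\overline y-\overline x\,\widehat\beta_{1n}$, if $S_{xy}-\mu\ne0$ and $S_{yy}-\lambda\theta>0$.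 The case $j=2$ is used when $\theta$ and $\mu$ are known and $\lambda\theta$ is unknown: $\widehat\beta_{2n}=\dfrac{S_{xy}-\mu}{S_{xx}-\theta}$ and $\widehat\alpha_{2n}=\overline y-\overline x\,\widehat\beta_{2n}$, if $S_{xx}-\theta>0$. Furthermore $$U(1,n)=S_{xy}-\mu,\quad U(2,n)=S_{xx}-\theta,$$ $$u_i(1,n)=(s_{i,yy}-\lambda\theta)-\beta(s_{i,xy}-\mu),\quad u_i(2,n)=(s_{i,xy}-\mu)-\beta(s_{i,xx}-\theta),$$ $$\widetilde u_i(1,n)=(s_{i,yy}-\lambda\theta)-\widehat\beta_{1n}(s_{i,xy}-\mu),\quad \widetilde u_i(2,n)=(s_{i,xy}-\mu)-\widehat\beta_{2n}(s_{i,xx}-\theta),$$ $$v_i(j,n)=(y_i-\alpha)-\beta x_i-\frac{\overline x}{U(j,n)}u_i(j,n),\quad \widetilde v_i(j,n)=(y_i-\alpha)-\widehat\beta_{jn}x_i-\frac{\overline x}{U(j,n)}\widetilde u_i(j,n),$$ and $\overline{v(j,n)}$, $\overline{\widetilde v(j,n)}$ are the averages of $v_i(j,n)$, $\widetilde v_i(j,n)$ over $1\le i\le n$.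
   Formalization: For j=1 the slope β is assumed to be nonzero; when β=0 the condition S_yy−λθ>0 defining the j=1 estimator fails with non-vanishing probability, so the claim has no meaning there. *)

theory Defs
  imports "HOL-Probability.Probability"
begin

section \<open>Probabilistic notions\<close>

definition iid_on :: "'a measure \<Rightarrow> 'b measure \<Rightarrow> 'i set \<Rightarrow> ('i \<Rightarrow> 'a \<Rightarrow> 'b) \<Rightarrow> bool" where
  "iid_on M N I X \<longleftrightarrow>
     prob_space.indep_vars M (\<lambda>_. N) X I \<and>
     (\<forall>i\<in>I. \<forall>k\<in>I. distr M N (X i) = distr M N (X k))"

text \<open>The library's \<open>indep_var\<close> requires both random elements to have values in the same type.\<close>

definition independent_elements ::
  "'a measure \<Rightarrow> 'b measure \<Rightarrow> ('a \<Rightarrow> 'b) \<Rightarrow> 'c measure \<Rightarrow> ('a \<Rightarrow> 'c) \<Rightarrow> bool" where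
  "independent_elements M N1 X1 N2 X2 \<longleftrightarrow>
     X1 \<in> measurable M N1 \<and> X2 \<in> measurable M N2 \<and>
     prob_space.indep_set M {X1 -` A \<inter> space M | A. A \<in> sets N1}
                            {X2 -` A \<inter> space M | A. A \<in> sets N2}"

text \<open>For an i.i.d. sequence \<open>X 1, X 2, \<dots>\<close>, this says that the common law lies in the
  domain of attraction of the normal law.  Finiteness of the variance is not required.\<close>

definition DAN :: "'a measure \<Rightarrow> (nat \<Rightarrow> 'a \<Rightarrow> real) \<Rightarrow> bool" where
  "DAN M X \<longleftrightarrow> (\<exists>a b :: nat \<Rightarrow> real. (\<forall>n. b n > 0) \<and>
     weak_conv_m (\<lambda>n. distr M borel (\<lambda>\<omega>. ((\<Sum>i=1..n. X i \<omega>) - a n) / b n))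
       std_normal_distribution)"

definition covariance :: "'a measure \<Rightarrow> ('a \<Rightarrow> real) \<Rightarrow> ('a \<Rightarrow> real) \<Rightarrow> real" where
  "covariance M X Y =
     (LINT \<omega>|M. (X \<omega> - (LINT \<omega>'|M. X \<omega>')) * (Y \<omega> - (LINT \<omega>'|M. Y \<omega>')))"

definition covariance_matrix :: "'a measure \<Rightarrow> ('a \<Rightarrow> real) \<Rightarrow> ('a \<Rightarrow> real) \<Rightarrow> real^2^2" where
  "covariance_matrix M X Y =
     vector [vector [covariance M X X, covariance M X Y],
             vector [covariance M Y X, covariance M Y Y]]"

definition positive_definite :: "real^'n^'n \<Rightarrow> bool" where
  "positive_definite A \<longleftrightarrow> transpose A = A \<and> (\<forall>z. z \<noteq> 0 \<longrightarrow> z \<bullet> (A *v z) > 0)"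

section \<open>Sample quantities\<close>

text \<open>Samples are real sequences of which only the entries with index \<open>1, \<dots>, n\<close> are used.
  The numbers \<open>lam * th\<close>, \<open>th\<close> and \<open>mu\<close> are the error variances of \<open>y\<close> and \<open>x\<close> and the
  error covariance.  The switch \<open>c\<close> is \<open>0\<close> if the intercept is known to be zero and \<open>1\<close> if it
  is unknown.\<close>

definition avg :: "nat \<Rightarrow> (nat \<Rightarrow> real) \<Rightarrow> real" where
  "avg n u = (\<Sum>i=1..n. u i) / real n"

definition cross :: "real \<Rightarrow> nat \<Rightarrow> (nat \<Rightarrow> real) \<Rightarrow> (nat \<Rightarrow> real) \<Rightarrow> nat \<Rightarrow> real" where
  "cross c n u v i = (u i - c * avg n u) * (v i - c * avg n v)"

definition S :: "real \<Rightarrow> nat \<Rightarrow> (nat \<Rightarrow> real) \<Rightarrow> (nat \<Rightarrow> real) \<Rightarrow> real" where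
  "S c n u v = avg n (cross c n u v)"

definition sample_variance :: "nat \<Rightarrow> (nat \<Rightarrow> real) \<Rightarrow> real" where
  "sample_variance n w = (\<Sum>i=1..n. (w i - avg n w)\<^sup>2) / (real n - 1)"

text \<open>The index \<open>j\<close> ranges over \<open>{1, 2}\<close>; every value other than \<open>1\<close> is treated as \<open>2\<close>.
  The slope estimators are defined only under the stated sign conditions; elsewhere they
  are given the dummy value \<open>0\<close>.\<close>

definition beta_hat ::
  "nat \<Rightarrow> real \<Rightarrow> real \<Rightarrow> real \<Rightarrow> real \<Rightarrow> nat \<Rightarrow> (nat \<Rightarrow> real) \<Rightarrow> (nat \<Rightarrow> real) \<Rightarrow> real" where
  "beta_hat j c lam th mu n x y =
     (if j = 1
      then (if S c n x y - mu \<noteq> 0 \<and> S c n y y - lam * th > 0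
            then (S c n y y - lam * th) / (S c n x y - mu) else 0)
      else (if S c n x x - th > 0
            then (S c n x y - mu) / (S c n x x - th) else 0))"

definition alpha_hat ::
  "nat \<Rightarrow> real \<Rightarrow> real \<Rightarrow> real \<Rightarrow> real \<Rightarrow> nat \<Rightarrow> (nat \<Rightarrow> real) \<Rightarrow> (nat \<Rightarrow> real) \<Rightarrow> real" where
  "alpha_hat j c lam th mu n x y = avg n y - avg n x * beta_hat j c lam th mu n x y"

definition U ::
  "nat \<Rightarrow> real \<Rightarrow> real \<Rightarrow> real \<Rightarrow> nat \<Rightarrow> (nat \<Rightarrow> real) \<Rightarrow> (nat \<Rightarrow> real) \<Rightarrow> real" where
  "U j c th mu n x y = (if j = 1 then S c n x y - mu else S c n x x - th)"

text \<open>In the next two definitions the argument \<open>b\<close> is a slope: the true slope gives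
  \<open>u\<^sub>i(j,n)\<close> and \<open>v\<^sub>i(j,n)\<close>, the estimated slope gives their versions with a tilde.  The
  argument \<open>alpha\<close> is the true intercept in both cases.\<close>

definition u_term ::
  "nat \<Rightarrow> real \<Rightarrow> real \<Rightarrow> real \<Rightarrow> real \<Rightarrow> real \<Rightarrow> nat \<Rightarrow> (nat \<Rightarrow> real) \<Rightarrow> (nat \<Rightarrow> real) \<Rightarrow>
     nat \<Rightarrow> real" where
  "u_term j c lam th mu b n x y i =
     (if j = 1
      then (cross c n y y i - lam * th) - b * (cross c n x y i - mu)
      else (cross c n x y i - mu) - b * (cross c n x x i - th))"

definition v_term ::
  "nat \<Rightarrow> real \<Rightarrow> real \<Rightarrow> real \<Rightarrow> real \<Rightarrow> real \<Rightarrow> real \<Rightarrow> nat \<Rightarrow> (nat \<Rightarrow> real) \<Rightarrow>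
     (nat \<Rightarrow> real) \<Rightarrow> nat \<Rightarrow> real" where
  "v_term j c lam th mu alpha b n x y i =
     (y i - alpha) - b * x i
       - avg n x / U j c th mu n x y * u_term j c lam th mu b n x y i"

definition v_tilde ::
  "nat \<Rightarrow> real \<Rightarrow> real \<Rightarrow> real \<Rightarrow> real \<Rightarrow> real \<Rightarrow> nat \<Rightarrow> (nat \<Rightarrow> real) \<Rightarrow>
     (nat \<Rightarrow> real) \<Rightarrow> nat \<Rightarrow> real" where
  "v_tilde j c lam th mu alpha n x y =
     v_term j c lam th mu alpha (beta_hat j c lam th mu n x y) n x y"

end

theory Submission
  imports Defs
begin

text \<open>
  Let \<open>\<eta>\<^sub>i = \<delta>\<^sub>i - \<beta> \<epsilon>\<^sub>i\<close>, and let \<open>z\<^sub>i\<close> be \<open>y\<^sub>i - \<alpha>\<close> for \<open>j = 1\<close> and \<open>x\<^sub>i\<close> for \<open>j = 2\<close>; a prime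
  stands for subtraction of \<open>c\<close> times the sample mean.  Both slope estimators solve
  \<open>U (\<beta>hat - \<beta>) = mean of u\<^sub>i\<close>, where \<open>u\<^sub>i = z\<^sub>i' \<eta>\<^sub>i' - E (z\<^sub>i-error * \<eta>\<^sub>i)\<close>.  Hence \<open>\<alpha>hat - \<alpha>\<close> is
  the mean of \<open>v\<^sub>i = \<eta>\<^sub>i - (xbar / U) u\<^sub>i\<close> whenever the sign conditions in the definition of the
  estimators hold, which they do with probability tending to one.  The theorem says that this mean, divided by
  its own estimated standard deviation, is asymptotically normal.

  The difficulty is that \<open>\<xi>\<close> may have infinite variance.  Everything is therefore measured against
  \<open>Q\<close>, the mean of the \<open>\<xi>\<^sub>i\<^sup>2\<close>.  Its inverse always has a limit \<open>p\<close>, namely \<open>1 / E \<xi>\<^sup>2\<close>, which is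
  \<open>0\<close> if the variance is infinite (\<open>inverse_mean_sq_limit\<close>).  With \<open>m = E \<xi>\<close> one finds
  \<open>U / Q \<longlonglongrightarrow> \<kappa> (1 - c m\<^sup>2 p)\<close>, with \<open>\<kappa> = \<beta>\<close> or \<open>1\<close>, by \<open>cross_moment_limit\<close>; so \<open>xbar / U\<close> tends to a constant \<open>k\<close>,
  and \<open>k = 0\<close> if the variance is infinite.  Given the regressors, the sum of the \<open>\<xi>\<^sub>i \<eta>\<^sub>i\<close> has
  variance \<open>n Q E \<eta>\<^sup>2\<close>; after division by \<open>sqrt (n Q)\<close> it is bounded in probability whatever the
  tails of \<open>\<xi>\<close> are (\<open>bdd_in_prob_weighted_avg\<close>).

  Replacing \<open>xbar / U\<close> by \<open>k\<close> and all sample means by expectations turns \<open>v\<^sub>i\<close> into i.i.d. centred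
  variables \<open>w\<^sub>i\<close> with positive finite variance (\<open>w_second_moment\<close>).  The mean of \<open>v\<^sub>i - w\<^sub>i\<close> is
  \<open>o(1 / sqrt n)\<close> in probability (\<open>numerator_lim\<close>) and their mean square tends to zero (\<open>V_close\<close>); together
  with the central limit theorem and the law of large numbers for the \<open>w\<^sub>i\<close> this suffices, by
  \<open>studentized_mean_weak_conv\<close>.  The variables with a tilde differ from the \<open>v\<^sub>i\<close> by the error of
  the slope estimator, which is of order \<open>1 / sqrt (n Q)\<close>, times quadratic expressions in the sample,
  so their distance to the \<open>w\<^sub>i\<close> in mean square tends to zero as well (\<open>W_close\<close>).

  The domain of attraction enters through two consequences: \<open>\<xi>\<close> is not constant, and \<open>E \<bar>\<xi>\<bar>\<close> is
  finite.  For the second, the norming constants grow at most by the factor \<open>3/2\<close> when the sample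
  size doubles, whereas \<open>1 - \<bar>\<phi>(t / b\<^sub>n)\<bar>\<^sup>2\<close> is \<open>O(1 / n)\<close> for the characteristic function \<open>\<phi>\<close> of \<open>\<xi>\<close>;
  summed over geometric scales this bounds the expected absolute difference of two independent copies
  (\<open>DAN_integrable\<close>).
\<close>

section \<open>Convergence in probability as a filter\<close>

text \<open>A property of \<open>(n, \<omega>)\<close> holds eventually in this sense if, for each \<open>r > 0\<close>, it fails only on events
  whose measure is at most \<open>r\<close> for large \<open>n\<close>.  Convergence of \<open>f\<close> to \<open>l\<close> in probability is then
  convergence along a filter, and the calculus of limits (sums, products, quotients, continuous
  functions, comparison) applies to it without change.  The exceptional events may depend on \<open>r\<close>,
  so that truncation levels can be chosen after \<open>r\<close>.\<close>

definition in_prob :: "'a measure \<Rightarrow> (nat \<times> 'a) filter" where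
  "in_prob M = Abs_filter (\<lambda>P. \<forall>r>0. \<exists>N. (\<forall>n. N n \<in> sets M) \<and>
      (\<forall>\<^sub>F n in sequentially. measure M (N n) \<le> r) \<and> (\<forall>n. \<forall>\<omega>\<in>space M - N n. P (n, \<omega>)))"

lemma eventually_in_prob:
  "eventually P (in_prob M) \<longleftrightarrow> (\<forall>r>0. \<exists>N. (\<forall>n. N n \<in> sets M) \<and>
      (\<forall>\<^sub>F n in sequentially. measure M (N n) \<le> r) \<and> (\<forall>n. \<forall>\<omega>\<in>space M - N n. P (n, \<omega>)))"
  unfolding in_prob_def
proof (rule eventually_Abs_filter, rule is_filter.intro)
  show "\<forall>r>0. \<exists>N. (\<forall>n. N n \<in> sets M) \<and>
      (\<forall>\<^sub>F n in sequentially. measure M (N n) \<le> r) \<and> (\<forall>n. \<forall>\<omega>\<in>space M - N n. True)"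
    by (intro allI impI exI[of _ "\<lambda>_. {}"]) auto
next
  fix P Q :: "nat \<times> 'a \<Rightarrow> bool"
  assume P: "\<forall>r>0. \<exists>N. (\<forall>n. N n \<in> sets M) \<and>
      (\<forall>\<^sub>F n in sequentially. measure M (N n) \<le> r) \<and> (\<forall>n. \<forall>\<omega>\<in>space M - N n. P (n, \<omega>))"
    and Q: "\<forall>r>0. \<exists>N. (\<forall>n. N n \<in> sets M) \<and>
      (\<forall>\<^sub>F n in sequentially. measure M (N n) \<le> r) \<and> (\<forall>n. \<forall>\<omega>\<in>space M - N n. Q (n, \<omega>))"
  show "\<forall>r>0. \<exists>N. (\<forall>n. N n \<in> sets M) \<and>
      (\<forall>\<^sub>F n in sequentially. measure M (N n) \<le> r) \<and>
      (\<forall>n. \<forall>\<omega>\<in>space M - N n. P (n, \<omega>) \<and> Q (n, \<omega>))"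
  proof (intro allI impI)
    fix r :: real assume "r > 0"
    then have "r / 2 > 0" by simp
    with P Q obtain A B where
      A: "\<forall>n. A n \<in> sets M" "\<forall>\<^sub>F n in sequentially. measure M (A n) \<le> r / 2"
         "\<forall>n. \<forall>\<omega>\<in>space M - A n. P (n, \<omega>)" and
      B: "\<forall>n. B n \<in> sets M" "\<forall>\<^sub>F n in sequentially. measure M (B n) \<le> r / 2"
         "\<forall>n. \<forall>\<omega>\<in>space M - B n. Q (n, \<omega>)" by meson
    have "\<forall>\<^sub>F n in sequentially. measure M (A n \<union> B n) \<le> r"
      using A(2) B(2)
    proof eventually_elim
      case (elim n)
      then show ?case using measure_Un_le[of "A n" M "B n"] A(1) B(1) by simp
    qed
    with A B show "\<exists>N. (\<forall>n. N n \<in> sets M) \<and> (\<forall>\<^sub>F n in sequentially. measure M (N n) \<le> r) \<and>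
        (\<forall>n. \<forall>\<omega>\<in>space M - N n. P (n, \<omega>) \<and> Q (n, \<omega>))"
      by (intro exI[of _ "\<lambda>n. A n \<union> B n"]) auto
  qed
next
  fix P Q :: "nat \<times> 'a \<Rightarrow> bool"
  assume "\<forall>x. P x \<longrightarrow> Q x"
    and "\<forall>r>0. \<exists>N. (\<forall>n. N n \<in> sets M) \<and>
      (\<forall>\<^sub>F n in sequentially. measure M (N n) \<le> r) \<and> (\<forall>n. \<forall>\<omega>\<in>space M - N n. P (n, \<omega>))"
  then show "\<forall>r>0. \<exists>N. (\<forall>n. N n \<in> sets M) \<and>
      (\<forall>\<^sub>F n in sequentially. measure M (N n) \<le> r) \<and> (\<forall>n. \<forall>\<omega>\<in>space M - N n. Q (n, \<omega>))"
    by meson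
qed

lemma filterlim_fst_in_prob: "filterlim fst sequentially (in_prob M)"
  unfolding filterlim_iff
proof (intro allI impI)
  fix P :: "nat \<Rightarrow> bool" assume P: "eventually P sequentially"
  show "\<forall>\<^sub>F p in in_prob M. P (fst p)"
    unfolding eventually_in_prob
  proof (intro allI impI exI[of _ "\<lambda>n. if P n then {} else space M"] conjI)
    fix r :: real assume "r > 0"
    show "\<forall>\<^sub>F n in sequentially. measure M (if P n then {} else space M) \<le> r"
      using P by eventually_elim (use \<open>r > 0\<close> in auto)
  qed auto
qed

lemma eventually_space_in_prob: "\<forall>\<^sub>F p in in_prob M. snd p \<in> space M"
  unfolding eventually_in_prob by (intro allI impI exI[of _ "\<lambda>_. {}"]) auto

lemma tendsto_in_prob_lift:
  assumes "(f \<longlongrightarrow> c) sequentially"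
  shows "((\<lambda>p. f (fst p)) \<longlongrightarrow> c) (in_prob M)"
  using filterlim_compose[OF assms filterlim_fst_in_prob] .

lemma eventually_fst_ge_in_prob: "\<forall>\<^sub>F p in in_prob M. k \<le> fst p"
  using filterlim_fst_in_prob eventually_ge_at_top[of k] unfolding filterlim_iff by blast

lemma inverse_sqrt_tendsto_in_prob: "((\<lambda>p. 1 / sqrt (real (fst p))) \<longlongrightarrow> 0) (in_prob M)"
proof (rule tendsto_in_prob_lift)
  show "(\<lambda>n. 1 / sqrt (real n)) \<longlonglongrightarrow> 0" by real_asymp
qed

lemma (in prob_space) in_prob_tendstoD:
  fixes f :: "nat \<times> 'a \<Rightarrow> real"
  assumes "(f \<longlongrightarrow> c) (in_prob M)" "e > 0"
    and [measurable]: "\<And>n. (\<lambda>\<omega>. f (n, \<omega>)) \<in> borel_measurable M"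
  shows "(\<lambda>n. prob {\<omega> \<in> space M. e \<le> \<bar>f (n, \<omega>) - c\<bar>}) \<longlonglongrightarrow> 0"
proof (rule LIMSEQ_I)
  fix r :: real assume "r > 0"
  have "\<forall>\<^sub>F p in in_prob M. dist (f p) c < e"
    using assms by (simp add: tendsto_iff)
  then obtain N where N: "\<forall>n. N n \<in> sets M" "\<forall>\<^sub>F n in sequentially. prob (N n) \<le> r / 2"
      "\<forall>n. \<forall>\<omega>\<in>space M - N n. dist (f (n, \<omega>)) c < e"
    unfolding eventually_in_prob using \<open>r > 0\<close> half_gt_zero by blast
  have "prob {\<omega> \<in> space M. e \<le> \<bar>f (n, \<omega>) - c\<bar>} \<le> prob (N n)" for n
  proof (rule finite_measure_mono)
    show "{\<omega> \<in> space M. e \<le> \<bar>f (n, \<omega>) - c\<bar>} \<subseteq> N n"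
      using N(3) by (force simp: dist_real_def)
  qed (use N(1) in auto)
  moreover obtain n0 where "\<forall>n\<ge>n0. prob (N n) \<le> r / 2"
    using N(2) by (auto simp: eventually_sequentially)
  ultimately have "\<forall>n\<ge>n0. norm (prob {\<omega> \<in> space M. e \<le> \<bar>f (n, \<omega>) - c\<bar>} - 0) < r"
    using \<open>r > 0\<close> by (smt (verit) real_norm_def measure_nonneg field_sum_of_halves)
  then show "\<exists>n0. \<forall>n\<ge>n0. norm (prob {\<omega> \<in> space M. e \<le> \<bar>f (n, \<omega>) - c\<bar>} - 0) < r" ..
qed

section \<open>Boundedness in probability\<close>

text \<open>Boundedness in probability, expressed by the way it is used: products with null sequences are
  null sequences.  Closure under sums and products is then immediate.\<close>

definition bdd_in_prob :: "'a measure \<Rightarrow> (nat \<times> 'a \<Rightarrow> real) \<Rightarrow> bool" where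
  "bdd_in_prob M f \<longleftrightarrow>
     (\<forall>g. (g \<longlongrightarrow> 0) (in_prob M) \<longrightarrow> ((\<lambda>p. f p * g p) \<longlongrightarrow> 0) (in_prob M))"

lemma bdd_in_prob_times_null:
  assumes "bdd_in_prob M f" "(g \<longlongrightarrow> 0) (in_prob M)"
  shows "((\<lambda>p. f p * g p) \<longlongrightarrow> 0) (in_prob M)" "((\<lambda>p. g p * f p) \<longlongrightarrow> 0) (in_prob M)"
  using assms by (auto simp: bdd_in_prob_def mult.commute)

lemma bdd_in_prob_tendsto:
  assumes "(f \<longlongrightarrow> (c::real)) (in_prob M)"
  shows "bdd_in_prob M f"
  unfolding bdd_in_prob_def by (auto intro!: tendsto_eq_intros assms)

lemma bdd_in_prob_const: "bdd_in_prob M (\<lambda>_. c)"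
  by (rule bdd_in_prob_tendsto[OF tendsto_const])

lemma bdd_in_prob_add:
  assumes "bdd_in_prob M f" "bdd_in_prob M g"
  shows "bdd_in_prob M (\<lambda>p. f p + g p)"
  using assms tendsto_add[of _ 0 "in_prob M" _ 0] unfolding bdd_in_prob_def
  by (fastforce simp: distrib_right)

lemma bdd_in_prob_mult:
  assumes "bdd_in_prob M f" "bdd_in_prob M g"
  shows "bdd_in_prob M (\<lambda>p. f p * g p)"
  using assms unfolding bdd_in_prob_def by (simp add: mult.assoc)

lemma bdd_in_prob_diff:
  assumes "bdd_in_prob M f" "bdd_in_prob M g"
  shows "bdd_in_prob M (\<lambda>p. f p - g p)"
  using bdd_in_prob_add[OF assms(1) bdd_in_prob_mult[OF bdd_in_prob_const[of _ "-1"] assms(2)]] by simp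

lemma bdd_in_prob_dominated:
  fixes M :: "'a measure"
  assumes "bdd_in_prob M h" "\<forall>\<^sub>F p in in_prob M. \<bar>f p\<bar> \<le> \<bar>h p\<bar>"
  shows "bdd_in_prob M f"
  unfolding bdd_in_prob_def
proof (intro allI impI)
  fix g :: "nat \<times> 'a \<Rightarrow> real" assume "(g \<longlongrightarrow> 0) (in_prob M)"
  then have "((\<lambda>p. h p * g p) \<longlongrightarrow> 0) (in_prob M)" using assms(1) by (simp add: bdd_in_prob_def)
  then have "((\<lambda>p. \<bar>h p * g p\<bar>) \<longlongrightarrow> 0) (in_prob M)" by (rule tendsto_rabs_zero)
  then show "((\<lambda>p. f p * g p) \<longlongrightarrow> 0) (in_prob M)"
    by (rule Lim_null_comparison[rotated])
       (use assms(2) in \<open>eventually_elim, auto simp: abs_mult intro!: mult_right_mono\<close>)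
qed

text \<open>Markov's inequality: \<open>\<bar>f\<bar>\<close> exceeds \<open>K\<close> with probability at most \<open>C / K\<close>, and \<open>K\<close> is chosen so large
  that this is at most half of the allowed exceptional probability.\<close>

lemma (in prob_space) bdd_in_prob_L1:
  fixes f :: "nat \<times> 'a \<Rightarrow> real"
  assumes int: "\<And>n. integrable M (\<lambda>\<omega>. f (n, \<omega>))"
    and bound: "\<And>n. expectation (\<lambda>\<omega>. \<bar>f (n, \<omega>)\<bar>) \<le> C"
  shows "bdd_in_prob M f"
  unfolding bdd_in_prob_def tendsto_iff[of "\<lambda>p. f p * _ p"] eventually_in_prob
proof (intro allI impI)
  fix g :: "nat \<times> 'a \<Rightarrow> real" and e r :: real
  assume g: "(g \<longlongrightarrow> 0) (in_prob M)" and "e > 0" "r > 0"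
  have [measurable]: "(\<lambda>\<omega>. f (n, \<omega>)) \<in> borel_measurable M" for n
    using int by (rule borel_measurable_integrable)
  define K where "K = 2 * (\<bar>C\<bar> + 1) / r"
  have "K > 0" using \<open>r > 0\<close> by (simp add: K_def)
  then have "\<forall>\<^sub>F p in in_prob M. dist (g p) 0 < e / K"
    using g \<open>e > 0\<close> unfolding tendsto_iff by simp
  then obtain N where N: "\<forall>n. N n \<in> events" "\<forall>\<^sub>F n in sequentially. prob (N n) \<le> r / 2"
      "\<forall>n. \<forall>\<omega>\<in>space M - N n. dist (g (n, \<omega>)) 0 < e / K"
    unfolding eventually_in_prob using \<open>r > 0\<close> half_gt_zero by blast
  let ?F = "\<lambda>n. {\<omega>\<in>space M. K \<le> \<bar>f (n, \<omega>)\<bar>}"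
  have F: "prob (?F n) \<le> r / 2" for n
  proof -
    have "prob (?F n) \<le> expectation (\<lambda>\<omega>. \<bar>f (n, \<omega>)\<bar>) / K"
      using int[of n] \<open>K > 0\<close> by (intro integral_Markov_inequality_measure[where A="{}"]) auto
    also have "\<dots> \<le> (\<bar>C\<bar> + 1) / K" using bound[of n] \<open>K > 0\<close> by (intro divide_right_mono) auto
    also have "\<dots> = r / 2" using \<open>r > 0\<close> by (simp add: K_def field_simps)
    finally show ?thesis .
  qed
  show "\<exists>N. (\<forall>n. N n \<in> events) \<and> (\<forall>\<^sub>F n in sequentially. prob (N n) \<le> r) \<and>
           (\<forall>n. \<forall>\<omega>\<in>space M - N n. dist (f (n, \<omega>) * g (n, \<omega>)) 0 < e)"
  proof (intro exI[of _ "\<lambda>n. N n \<union> ?F n"] conjI allI ballI)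
    show "\<forall>\<^sub>F n in sequentially. prob (N n \<union> ?F n) \<le> r" using N(2)
    proof eventually_elim
      case (elim n)
      have "prob (N n \<union> ?F n) \<le> prob (N n) + prob (?F n)"
        using N(1) by (intro measure_Un_le) auto
      then show ?case using elim F[of n] by simp
    qed
  next
    fix n \<omega> assume "\<omega> \<in> space M - (N n \<union> ?F n)"
    then have "\<bar>g (n, \<omega>)\<bar> < e / K" "\<bar>f (n, \<omega>)\<bar> < K" using N(3) by (auto simp: dist_real_def)
    then have "\<bar>f (n, \<omega>)\<bar> * \<bar>g (n, \<omega>)\<bar> < K * (e / K)" by (intro mult_strict_mono') auto
    then show "dist (f (n, \<omega>) * g (n, \<omega>)) 0 < e"
      using \<open>K > 0\<close> by (simp add: dist_real_def abs_mult)
  qed (use N(1) in auto)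
qed

lemma (in prob_space) bdd_in_prob_L2:
  fixes f :: "nat \<times> 'a \<Rightarrow> real"
  assumes int: "\<And>n. integrable M (\<lambda>\<omega>. (f (n, \<omega>))\<^sup>2)"
    and bound: "\<And>n. expectation (\<lambda>\<omega>. (f (n, \<omega>))\<^sup>2) \<le> C"
  shows "bdd_in_prob M f"
proof (rule bdd_in_prob_dominated)
  show "bdd_in_prob M (\<lambda>p. 1 + (f p)\<^sup>2)"
    using bdd_in_prob_L1[OF int] bound by (intro bdd_in_prob_add bdd_in_prob_const) auto
  have "\<bar>t\<bar> \<le> 1 + t\<^sup>2" for t :: real
    using zero_le_power2[of "\<bar>t\<bar> - 1"] by (simp add: power2_diff)
  then show "\<forall>\<^sub>F p in in_prob M. \<bar>f p\<bar> \<le> \<bar>1 + (f p)\<^sup>2\<bar>" by simp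
qed

section \<open>The weak law of large numbers\<close>

lemma integrable_product_of_squares:
  fixes X Y :: "'a \<Rightarrow> real"
  assumes [measurable]: "X \<in> borel_measurable M" "Y \<in> borel_measurable M"
    and int: "integrable M (\<lambda>\<omega>. (X \<omega>)\<^sup>2)" "integrable M (\<lambda>\<omega>. (Y \<omega>)\<^sup>2)"
  shows "integrable M (\<lambda>\<omega>. X \<omega> * Y \<omega>)"
proof (rule Bochner_Integration.integrable_bound)
  show "integrable M (\<lambda>\<omega>. (X \<omega>)\<^sup>2 + (Y \<omega>)\<^sup>2)" using int by simp
  have "\<bar>a * b\<bar> \<le> a\<^sup>2 + b\<^sup>2" for a b :: real
  proof -
    have "2 * (\<bar>a\<bar> * \<bar>b\<bar>) \<le> a\<^sup>2 + b\<^sup>2" using sum_squares_bound[of "\<bar>a\<bar>" "\<bar>b\<bar>"] by simp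
    moreover have "0 \<le> \<bar>a\<bar> * \<bar>b\<bar>" by simp
    ultimately show ?thesis unfolding abs_mult by linarith
  qed
  then show "AE \<omega> in M. norm (X \<omega> * Y \<omega>) \<le> norm ((X \<omega>)\<^sup>2 + (Y \<omega>)\<^sup>2)" by simp
qed measurable

lemma (in prob_space) second_moment_sum_orthogonal:
  fixes X :: "'i \<Rightarrow> 'a \<Rightarrow> real"
  assumes "finite I"
    and [measurable]: "\<And>i. i \<in> I \<Longrightarrow> X i \<in> borel_measurable M"
    and int: "\<And>i. i \<in> I \<Longrightarrow> integrable M (\<lambda>\<omega>. (X i \<omega>)\<^sup>2)"
    and orth: "\<And>i k. i \<in> I \<Longrightarrow> k \<in> I \<Longrightarrow> i \<noteq> k \<Longrightarrow> expectation (\<lambda>\<omega>. X i \<omega> * X k \<omega>) = 0"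
  shows "integrable M (\<lambda>\<omega>. (\<Sum>i\<in>I. X i \<omega>)\<^sup>2)" (is ?int)
    and "expectation (\<lambda>\<omega>. (\<Sum>i\<in>I. X i \<omega>)\<^sup>2) = (\<Sum>i\<in>I. expectation (\<lambda>\<omega>. (X i \<omega>)\<^sup>2))" (is ?eq)
proof -
  have int2: "integrable M (\<lambda>\<omega>. X i \<omega> * X k \<omega>)" if "i \<in> I" "k \<in> I" for i k
    by (rule integrable_product_of_squares) (use that int in auto)
  have expand: "(\<Sum>i\<in>I. X i \<omega>)\<^sup>2 = (\<Sum>i\<in>I. \<Sum>k\<in>I. X i \<omega> * X k \<omega>)" for \<omega>
    by (simp add: power2_eq_square sum_product)
  show ?int unfolding expand by (intro Bochner_Integration.integrable_sum int2)
  have "expectation (\<lambda>\<omega>. (\<Sum>i\<in>I. X i \<omega>)\<^sup>2) = (\<Sum>i\<in>I. \<Sum>k\<in>I. expectation (\<lambda>\<omega>. X i \<omega> * X k \<omega>))"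
    unfolding expand by (subst Bochner_Integration.integral_sum; intro Bochner_Integration.integrable_sum int2 sum.cong refl Bochner_Integration.integral_sum; assumption)
  also have "\<dots> = (\<Sum>i\<in>I. \<Sum>k\<in>I. if k = i then expectation (\<lambda>\<omega>. (X i \<omega>)\<^sup>2) else 0)"
    by (intro sum.cong refl) (auto simp: orth power2_eq_square)
  also have "\<dots> = (\<Sum>i\<in>I. expectation (\<lambda>\<omega>. (X i \<omega>)\<^sup>2))"
    using \<open>finite I\<close> by simp
  finally show ?eq .
qed

lemma avg_add: "avg n (\<lambda>i. f i + g i) = avg n f + avg n g"
  by (simp add: avg_def sum.distrib add_divide_distrib)

lemma avg_diff: "avg n (\<lambda>i. f i - g i) = avg n f - avg n g"
  by (simp add: avg_def sum_subtractf diff_divide_distrib)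

lemma avg_cmult: "avg n (\<lambda>i. k * f i) = k * avg n f"
  by (simp add: avg_def sum_distrib_left)

lemma avg_const: "n \<ge> 1 \<Longrightarrow> avg n (\<lambda>i. k) = k"
  by (simp add: avg_def)

lemma avg_mono: "(\<And>i. f i \<le> g i) \<Longrightarrow> avg n f \<le> avg n g"
  by (auto simp: avg_def intro!: divide_right_mono sum_mono)

lemma avg_nonneg: "(\<And>i. 0 \<le> f i) \<Longrightarrow> 0 \<le> avg n f"
  by (auto simp: avg_def intro!: divide_nonneg_nonneg sum_nonneg)

lemma avg_cong: "(\<And>i. i \<ge> 1 \<Longrightarrow> f i = g i) \<Longrightarrow> avg n f = avg n g"
  by (simp add: avg_def)

lemma avg_Cauchy_Schwarz: "(avg n (\<lambda>i. f i * g i))\<^sup>2 \<le> avg n (\<lambda>i. (f i)\<^sup>2) * avg n (\<lambda>i. (g i)\<^sup>2)"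
proof -
  have "(\<Sum>i=1..n. f i * g i)\<^sup>2 / (real n)\<^sup>2 \<le> ((\<Sum>i=1..n. (f i)\<^sup>2) * (\<Sum>i=1..n. (g i)\<^sup>2)) / (real n)\<^sup>2"
    by (intro divide_right_mono Cauchy_Schwarz_ineq_sum) auto
  then show ?thesis by (simp add: avg_def power_divide power2_eq_square)
qed

lemma avg_squared_le: "(avg n f)\<^sup>2 \<le> avg n (\<lambda>i. (f i)\<^sup>2)"
proof (cases "n = 0")
  case False
  then show ?thesis using avg_Cauchy_Schwarz[of n f "\<lambda>_. 1"] by (simp add: avg_const)
qed (simp add: avg_def)

lemma sample_variance_eq:
  assumes "n \<ge> 2"
  shows "sample_variance n f = real n / (real n - 1) * (avg n (\<lambda>i. (f i)\<^sup>2) - (avg n f)\<^sup>2)"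
proof -
  have "avg n (\<lambda>i. (f i - avg n f)\<^sup>2) = avg n (\<lambda>i. (f i)\<^sup>2 - 2 * avg n f * f i + (avg n f)\<^sup>2)"
    by (simp add: power2_diff algebra_simps)
  also have "\<dots> = avg n (\<lambda>i. (f i)\<^sup>2) - (avg n f)\<^sup>2"
    using assms by (simp add: avg_add avg_diff avg_cmult avg_const power2_eq_square)
  finally have "(\<Sum>i=1..n. (f i - avg n f)\<^sup>2) = real n * (avg n (\<lambda>i. (f i)\<^sup>2) - (avg n f)\<^sup>2)"
    using assms by (simp add: avg_def[of n "\<lambda>i. (f i - avg n f)\<^sup>2"] field_simps)
  then show ?thesis by (simp add: sample_variance_def)
qed

lemma tendsto_avg_product_zero:
  assumes f: "((\<lambda>p. avg (fst p) (\<lambda>i. (f p i)\<^sup>2)) \<longlongrightarrow> a) F"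
    and g: "((\<lambda>p. avg (fst p) (\<lambda>i. (g p i)\<^sup>2)) \<longlongrightarrow> 0) F"
  shows "((\<lambda>p. avg (fst p) (\<lambda>i. f p i * g p i)) \<longlongrightarrow> 0) F"
proof (rule Lim_null_comparison)
  have "((\<lambda>p. sqrt (avg (fst p) (\<lambda>i. (f p i)\<^sup>2) * avg (fst p) (\<lambda>i. (g p i)\<^sup>2))) \<longlongrightarrow> sqrt (a * 0)) F"
    by (intro tendsto_intros f g)
  then show "((\<lambda>p. sqrt (avg (fst p) (\<lambda>i. (f p i)\<^sup>2) * avg (fst p) (\<lambda>i. (g p i)\<^sup>2))) \<longlongrightarrow> 0) F" by simp
  show "\<forall>\<^sub>F p in F. norm (avg (fst p) (\<lambda>i. f p i * g p i)) \<le>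
      sqrt (avg (fst p) (\<lambda>i. (f p i)\<^sup>2) * avg (fst p) (\<lambda>i. (g p i)\<^sup>2))"
    by (intro always_eventually allI real_le_rsqrt) (simp add: avg_Cauchy_Schwarz)
qed

lemma tendsto_avg_zero:
  assumes "((\<lambda>p. avg (fst p) (\<lambda>i. (f p i)\<^sup>2)) \<longlongrightarrow> 0) F"
  shows "((\<lambda>p. avg (fst p) (f p)) \<longlongrightarrow> 0) F"
proof (rule Lim_null_comparison)
  show "((\<lambda>p. sqrt (avg (fst p) (\<lambda>i. (f p i)\<^sup>2))) \<longlongrightarrow> 0) F"
    using tendsto_real_sqrt[OF assms] by simp
  show "\<forall>\<^sub>F p in F. norm (avg (fst p) (f p)) \<le> sqrt (avg (fst p) (\<lambda>i. (f p i)\<^sup>2))"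
    by (intro always_eventually allI real_le_rsqrt) (simp add: avg_squared_le)
qed

lemma ident_distr_integral:
  fixes f :: "'b \<Rightarrow> real"
  assumes "X \<in> measurable M N" "Y \<in> measurable M N" "distr M N X = distr M N Y"
    and "f \<in> borel_measurable N"
  shows "integrable M (\<lambda>\<omega>. f (X \<omega>)) \<longleftrightarrow> integrable M (\<lambda>\<omega>. f (Y \<omega>))"
    and "(LINT \<omega>|M. f (X \<omega>)) = (LINT \<omega>|M. f (Y \<omega>))"
  using integrable_distr_eq[OF assms(1,4)] integrable_distr_eq[OF assms(2,4)]
    integral_distr[OF assms(1,4)] integral_distr[OF assms(2,4)] assms(3) by simp_all

text \<open>The product formula is demanded for preimages directly, which is convenient when an independent
  sequence is reindexed.\<close>

lemma (in prob_space) indep_varsI_prod: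
  assumes rv: "\<And>i. i \<in> I \<Longrightarrow> X i \<in> measurable M (N i)"
    and prod: "\<And>J A. finite J \<Longrightarrow> J \<noteq> {} \<Longrightarrow> J \<subseteq> I \<Longrightarrow> (\<And>i. i \<in> J \<Longrightarrow> A i \<in> sets (N i)) \<Longrightarrow>
      prob (\<Inter>i\<in>J. X i -` A i \<inter> space M) = (\<Prod>i\<in>J. prob (X i -` A i \<inter> space M))"
  shows "indep_vars N X I"
  unfolding indep_vars_def2
proof (intro conjI ballI rv indep_setsI)
  fix i assume i: "i \<in> I"
  then show "{X i -` A \<inter> space M |A. A \<in> sets (N i)} \<subseteq> events"
    using measurable_sets[OF rv[OF i]] by auto
next
  fix B J assume J: "J \<noteq> {}" "J \<subseteq> I" "finite J"
    and B: "\<forall>j\<in>J. B j \<in> {X j -` A \<inter> space M |A. A \<in> sets (N j)}"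
  then have "\<forall>j\<in>J. \<exists>A. B j = X j -` A \<inter> space M \<and> A \<in> sets (N j)" by auto
  then obtain A where A: "\<And>j. j \<in> J \<Longrightarrow> B j = X j -` A j \<inter> space M" "\<And>j. j \<in> J \<Longrightarrow> A j \<in> sets (N j)"
    by metis
  then show "prob (\<Inter>j\<in>J. B j) = (\<Prod>j\<in>J. prob (B j))"
    using prod[of J A] J by simp
qed

lemma (in prob_space) indep_vars_product_expectation:
  fixes X :: "'i \<Rightarrow> 'a \<Rightarrow> real"
  assumes "indep_vars (\<lambda>_. borel) X I" "i \<in> I" "k \<in> I" "i \<noteq> k"
    and "integrable M (X i)" "integrable M (X k)"
  shows "expectation (\<lambda>\<omega>. X i \<omega> * X k \<omega>) = expectation (X i) * expectation (X k)"
proof -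
  have "indep_vars (\<lambda>_. borel) X {i, k}"
    using assms by (intro indep_vars_subset[OF assms(1)]) auto
  then have "expectation (\<lambda>\<omega>. \<Prod>l\<in>{i, k}. X l \<omega>) = (\<Prod>l\<in>{i, k}. expectation (X l))"
    using assms by (intro indep_vars_lebesgue_integral) auto
  then show ?thesis using \<open>i \<noteq> k\<close> by simp
qed

lemma (in prob_space) iid_onD:
  fixes X :: "nat \<Rightarrow> 'a \<Rightarrow> 'b"
  assumes "iid_on M N {1..} X"
  shows "indep_vars (\<lambda>_. N) X {1..}"
    and "1 \<le> i \<Longrightarrow> distr M N (X i) = distr M N (X 1)"
proof -
  show "indep_vars (\<lambda>_. N) X {1..}" using assms unfolding iid_on_def by (rule conjunct1)
  have "\<forall>i\<in>{1..}. \<forall>k\<in>{1..}. distr M N (X i) = distr M N (X k)"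
    using assms unfolding iid_on_def by (rule conjunct2)
  moreover assume "1 \<le> i"
  ultimately show "distr M N (X i) = distr M N (X 1)" by (metis atLeast_iff order_refl)
qed

lemma (in prob_space) iid_on_rv:
  fixes X :: "nat \<Rightarrow> 'a \<Rightarrow> 'b"
  assumes "iid_on M N {1..} X" "1 \<le> i"
  shows "X i \<in> measurable M N"
  using iid_onD(1)[OF assms(1)] assms(2) by (simp add: indep_vars_def)

lemma (in prob_space) iid_on_compose:
  fixes X :: "nat \<Rightarrow> 'a \<Rightarrow> 'b"
  assumes iid: "iid_on M N {1..} X" and f: "f \<in> measurable N N'"
  shows "iid_on M N' {1..} (\<lambda>i \<omega>. f (X i \<omega>))"
  unfolding iid_on_def
proof (intro conjI ballI)
  show "indep_vars (\<lambda>_. N') (\<lambda>i \<omega>. f (X i \<omega>)) {1..}"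
    by (rule indep_vars_compose2[OF iid_onD(1)[OF iid] f])
  fix i k :: nat assume "i \<in> {1..}" "k \<in> {1..}"
  then have ik: "1 \<le> i" "1 \<le> k" by auto
  have "distr M N' (\<lambda>\<omega>. f (X l \<omega>)) = distr (distr M N (X l)) N' f" if "1 \<le> l" for l
    using distr_distr[OF f iid_on_rv[OF iid that]] by (simp add: comp_def)
  then show "distr M N' (\<lambda>\<omega>. f (X i \<omega>)) = distr M N' (\<lambda>\<omega>. f (X k \<omega>))"
    using iid_onD(2)[OF iid ik(1)] iid_onD(2)[OF iid ik(2)] ik by presburger
qed

lemma (in prob_space) iid_moments:
  fixes X :: "nat \<Rightarrow> 'a \<Rightarrow> 'b" and f :: "'b \<Rightarrow> real"
  assumes iid: "iid_on M N {1..} X" and f: "f \<in> borel_measurable N" and "1 \<le> i"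
  shows "integrable M (\<lambda>\<omega>. f (X i \<omega>)) \<longleftrightarrow> integrable M (\<lambda>\<omega>. f (X 1 \<omega>))"
    and "expectation (\<lambda>\<omega>. f (X i \<omega>)) = expectation (\<lambda>\<omega>. f (X 1 \<omega>))"
  using ident_distr_integral[OF iid_on_rv[OF iid \<open>1 \<le> i\<close>] iid_on_rv[OF iid order_refl] iid_onD(2)[OF iid \<open>1 \<le> i\<close>] f]
  by auto

lemma (in prob_space) iid_centered_orthogonal:
  fixes X :: "nat \<Rightarrow> 'a \<Rightarrow> 'b" and f :: "'b \<Rightarrow> real"
  assumes iid: "iid_on M N {1..} X" and f: "f \<in> borel_measurable N"
    and int: "integrable M (\<lambda>\<omega>. f (X 1 \<omega>))" and mean: "expectation (\<lambda>\<omega>. f (X 1 \<omega>)) = 0"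
    and ik: "1 \<le> i" "1 \<le> k" "i \<noteq> k"
  shows "integrable M (\<lambda>\<omega>. f (X i \<omega>) * f (X k \<omega>))"
    and "expectation (\<lambda>\<omega>. f (X i \<omega>) * f (X k \<omega>)) = 0"
proof -
  have ind: "indep_vars (\<lambda>_. borel) (\<lambda>i \<omega>. f (X i \<omega>)) {1..}"
    by (rule iid_onD(1)[OF iid_on_compose[OF iid f]])
  have I: "integrable M (\<lambda>\<omega>. f (X l \<omega>))" if "1 \<le> l" for l
    using iid_moments(1)[OF iid f that] int by simp
  show "expectation (\<lambda>\<omega>. f (X i \<omega>) * f (X k \<omega>)) = 0"
    using indep_vars_product_expectation[OF ind, of i k] ik I iid_moments(2)[OF iid f ik(1)] mean by simp
  have "indep_vars (\<lambda>_. borel) (\<lambda>i \<omega>. f (X i \<omega>)) {i, k}"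
    using ik by (intro indep_vars_subset[OF ind]) auto
  then have "integrable M (\<lambda>\<omega>. \<Prod>l\<in>{i, k}. f (X l \<omega>))"
    using I ik by (intro indep_vars_integrable) auto
  then show "integrable M (\<lambda>\<omega>. f (X i \<omega>) * f (X k \<omega>))" using ik(3) by simp
qed

text \<open>By orthogonality, \<open>sqrt n\<close> times the mean has the second moment of a single variable.\<close>

lemma (in prob_space) bdd_in_prob_scaled_avg:
  fixes X :: "nat \<Rightarrow> 'a \<Rightarrow> 'b" and f :: "'b \<Rightarrow> real"
  assumes iid: "iid_on M N {1..} X" and f [measurable]: "f \<in> borel_measurable N"
    and int2: "integrable M (\<lambda>\<omega>. (f (X 1 \<omega>))\<^sup>2)" and mean: "expectation (\<lambda>\<omega>. f (X 1 \<omega>)) = 0"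
  shows "bdd_in_prob M (\<lambda>p. sqrt (real (fst p)) * avg (fst p) (\<lambda>i. f (X i (snd p))))"
proof -
  have [measurable]: "1 \<le> i \<Longrightarrow> X i \<in> measurable M N" for i by (rule iid_on_rv[OF iid])
  have sq: "integrable M (\<lambda>\<omega>. (f (X i \<omega>))\<^sup>2)"
    "expectation (\<lambda>\<omega>. (f (X i \<omega>))\<^sup>2) = expectation (\<lambda>\<omega>. (f (X 1 \<omega>))\<^sup>2)" if "1 \<le> i" for i
    using iid_moments[OF iid _ that, of "\<lambda>x. (f x)\<^sup>2"] int2 by auto
  have int: "integrable M (\<lambda>\<omega>. f (X 1 \<omega>))"
    by (rule square_integrable_imp_integrable[OF _ int2]) simp
  show ?thesis
  proof (rule bdd_in_prob_L2, unfold fst_conv snd_conv)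
    fix n
    let ?S = "\<lambda>\<omega>. (\<Sum>i=1..n. f (X i \<omega>))\<^sup>2"
    have eq: "(sqrt (real n) * avg n (\<lambda>i. f (X i \<omega>)))\<^sup>2 = ?S \<omega> / real n" for \<omega>
      by (cases "n = 0") (simp_all add: avg_def power_mult_distrib power_divide power2_eq_square[of "real n"])
    have s: "integrable M ?S" "expectation ?S = (\<Sum>i=1..n. expectation (\<lambda>\<omega>. (f (X i \<omega>))\<^sup>2))"
      by (intro second_moment_sum_orthogonal iid_centered_orthogonal(2)[OF iid f int mean] sq; simp)+
    show "integrable M (\<lambda>\<omega>. (sqrt (real n) * avg n (\<lambda>i. f (X i \<omega>)))\<^sup>2)"
      unfolding eq using s(1) by (rule integrable_divide_zero)
    have "expectation ?S = real n * expectation (\<lambda>\<omega>. (f (X 1 \<omega>))\<^sup>2)"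
    proof -
      have "(\<Sum>i=1..n. expectation (\<lambda>\<omega>. (f (X i \<omega>))\<^sup>2)) = (\<Sum>i=1..n. expectation (\<lambda>\<omega>. (f (X 1 \<omega>))\<^sup>2))"
        by (intro sum.cong refl sq(2)) simp
      then show ?thesis unfolding s(2) by simp
    qed
    then have "expectation (\<lambda>\<omega>. ?S \<omega> / real n) = real n * expectation (\<lambda>\<omega>. (f (X 1 \<omega>))\<^sup>2) / real n"
      by simp
    also have "\<dots> \<le> expectation (\<lambda>\<omega>. (f (X 1 \<omega>))\<^sup>2)"
      by (cases "n = 0") simp_all
    finally show "expectation (\<lambda>\<omega>. (sqrt (real n) * avg n (\<lambda>i. f (X i \<omega>)))\<^sup>2) \<le> expectation (\<lambda>\<omega>. (f (X 1 \<omega>))\<^sup>2)"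
      unfolding eq .
  qed
qed

text \<open>Truncation at level \<open>K\<close>: the means of the truncated variables converge because these have second
  moments, the mean of the absolute remainders has expectation at most \<open>t K\<close>, and \<open>t K\<close> also bounds the
  change of the expectation; \<open>t K\<close> is small for large \<open>K\<close>.\<close>

lemma (in prob_space) weak_law_of_large_numbers:
  fixes X :: "nat \<Rightarrow> 'a \<Rightarrow> real"
  assumes iid: "iid_on M borel {1..} X" and int: "integrable M (X 1)"
  shows "((\<lambda>p. avg (fst p) (\<lambda>i. X i (snd p))) \<longlongrightarrow> expectation (X 1)) (in_prob M)"
proof -
  define m where "m = expectation (X 1)"
  have rv [measurable]: "i \<ge> 1 \<Longrightarrow> X i \<in> borel_measurable M" for i
    by (rule iid_on_rv[OF iid])
  define T :: "nat \<Rightarrow> real \<Rightarrow> real" where "T K x = (if \<bar>x\<bar> \<le> real K then x else 0)" for K x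
  have T_meas [measurable]: "T K \<in> borel_measurable borel" for K
    unfolding T_def by measurable
  have intT: "integrable M (\<lambda>\<omega>. T K (X 1 \<omega>))" for K
    by (rule integrable_const_bound[where B="real K"]) (auto simp: T_def)
  define t where "t K = expectation (\<lambda>\<omega>. \<bar>X 1 \<omega> - T K (X 1 \<omega>)\<bar>)" for K
  have t_lim: "t \<longlonglongrightarrow> 0"
  proof -
    have "(\<lambda>k. LINT \<omega>|M. \<bar>X 1 \<omega> - T k (X 1 \<omega>)\<bar>) \<longlonglongrightarrow> (LINT \<omega>|M. 0)"
    proof (rule integral_dominated_convergence[where w="\<lambda>\<omega>. \<bar>X 1 \<omega>\<bar>"])
      show "AE \<omega> in M. (\<lambda>k. \<bar>X 1 \<omega> - T k (X 1 \<omega>)\<bar>) \<longlonglongrightarrow> 0"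
      proof (rule AE_I2)
        fix \<omega>
        have "\<forall>\<^sub>F k in sequentially. \<bar>X 1 \<omega>\<bar> \<le> real k"
          using filterlim_real_sequentially by (simp add: filterlim_at_top)
        then have "\<forall>\<^sub>F k in sequentially. \<bar>X 1 \<omega> - T k (X 1 \<omega>)\<bar> = 0"
          by eventually_elim (simp add: T_def)
        then show "(\<lambda>k. \<bar>X 1 \<omega> - T k (X 1 \<omega>)\<bar>) \<longlonglongrightarrow> 0" by (rule tendsto_eventually)
      qed
    qed (use int in \<open>auto simp: T_def\<close>)
    then show ?thesis by (simp add: t_def[abs_def])
  qed
  have trunc: "((\<lambda>p. avg (fst p) (\<lambda>i. T K (X i (snd p))) - expectation (\<lambda>\<omega>. T K (X 1 \<omega>))) \<longlongrightarrow> 0) (in_prob M)" for K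
  proof -
    define b where "b = expectation (\<lambda>\<omega>. T K (X 1 \<omega>))"
    have "\<bar>T K x - b\<bar> \<le> real K + \<bar>b\<bar>" for x
      using abs_triangle_ineq4[of "T K x" b] by (auto simp: T_def)
    then have "(T K x - b)\<^sup>2 \<le> (real K + \<bar>b\<bar>)\<^sup>2" for x
      by (metis abs_ge_zero power2_abs power_mono)
    then have "integrable M (\<lambda>\<omega>. (T K (X 1 \<omega>) - b)\<^sup>2)"
      by (intro integrable_const_bound[where B="(real K + \<bar>b\<bar>)\<^sup>2"]) auto
    then have "bdd_in_prob M (\<lambda>p. sqrt (real (fst p)) * avg (fst p) (\<lambda>i. T K (X i (snd p)) - b))"
      by (intro bdd_in_prob_scaled_avg[OF iid, of "\<lambda>x. T K x - b"]) (use intT[of K] in \<open>simp_all add: b_def prob_space\<close>)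
    from bdd_in_prob_times_null(1)[OF this inverse_sqrt_tendsto_in_prob]
    show ?thesis unfolding b_def[symmetric]
      by (rule Lim_transform_eventually, intro eventually_mono[OF eventually_fst_ge_in_prob[of 1]])
         (simp add: avg_diff avg_const)
  qed
  define R where "R K n \<omega> = avg n (\<lambda>i. \<bar>X i \<omega> - T K (X i \<omega>)\<bar>)" for K n \<omega>
  have R_nonneg: "0 \<le> R K n \<omega>" for K n \<omega> unfolding R_def by (rule avg_nonneg) simp
  have R: "integrable M (R K n)" "expectation (R K n) \<le> t K" for K n
  proof -
    have i: "integrable M (\<lambda>\<omega>. \<bar>X i \<omega> - T K (X i \<omega>)\<bar>)" "expectation (\<lambda>\<omega>. \<bar>X i \<omega> - T K (X i \<omega>)\<bar>) = t K"
      if "1 \<le> i" for i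
      using iid_moments[OF iid _ that, of "\<lambda>x. \<bar>x - T K x\<bar>"] int intT[of K] by (auto simp: t_def)
    show "integrable M (R K n)"
      unfolding R_def[abs_def] avg_def by (intro integrable_divide_zero Bochner_Integration.integrable_sum i) simp
    have "expectation (R K n) = (\<Sum>i=1..n. expectation (\<lambda>\<omega>. \<bar>X i \<omega> - T K (X i \<omega>)\<bar>)) / real n"
      unfolding R_def[abs_def] avg_def integral_divide_zero
      by (intro arg_cong2[where f="(/)"] Bochner_Integration.integral_sum i refl) simp
    also have "\<dots> = (\<Sum>i=1..n. t K) / real n"
      by (intro arg_cong2[where f="(/)"] sum.cong refl i(2)) simp
    also have "\<dots> \<le> t K" by (cases "n = 0") (simp_all add: t_def)
    finally show "expectation (R K n) \<le> t K" .
  qed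
  have bias: "\<bar>expectation (\<lambda>\<omega>. T K (X 1 \<omega>)) - m\<bar> \<le> t K" for K
  proof -
    have "expectation (\<lambda>\<omega>. T K (X 1 \<omega>)) - m = - expectation (\<lambda>\<omega>. X 1 \<omega> - T K (X 1 \<omega>))"
      using int intT[of K] by (simp add: m_def)
    then show ?thesis using integral_abs_bound[of M "\<lambda>\<omega>. X 1 \<omega> - T K (X 1 \<omega>)"] by (simp add: t_def)
  qed
  show ?thesis
    unfolding m_def[symmetric] tendsto_iff eventually_in_prob
  proof (intro allI impI)
    fix r d :: real assume "0 < r" "0 < d"
    then have "0 < min (r / 4) (r / 4 * (d / 2))" by simp
    from order_tendstoD(2)[OF t_lim this] obtain K where K: "t K < r / 4" "t K < r / 4 * (d / 2)"
      by (auto simp: eventually_sequentially)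
    have "\<forall>\<^sub>F p in in_prob M. dist (avg (fst p) (\<lambda>i. T K (X i (snd p))) - expectation (\<lambda>\<omega>. T K (X 1 \<omega>))) 0 < r / 4"
      by (rule tendstoD[OF trunc]) (use \<open>0 < r\<close> in simp)
    then obtain N where N: "\<forall>n. N n \<in> events" "\<forall>\<^sub>F n in sequentially. prob (N n) \<le> d / 2"
        "\<forall>n. \<forall>\<omega>\<in>space M - N n. dist (avg n (\<lambda>i. T K (X i \<omega>)) - expectation (\<lambda>\<omega>. T K (X 1 \<omega>))) 0 < r / 4"
      unfolding eventually_in_prob fst_conv snd_conv by (meson \<open>0 < d\<close> half_gt_zero)
    let ?F = "\<lambda>n. {\<omega>\<in>space M. r / 4 \<le> R K n \<omega>}"
    have [measurable]: "R K n \<in> borel_measurable M" for n using R(1) by (rule borel_measurable_integrable)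
    have F: "prob (?F n) \<le> d / 2" for n
    proof -
      have "prob (?F n) \<le> expectation (R K n) / (r / 4)"
        using R(1)[of K n] \<open>0 < r\<close>
        by (intro integral_Markov_inequality_measure[where A="{}"]) (auto simp: R_nonneg)
      also have "\<dots> \<le> (r / 4 * (d / 2)) / (r / 4)"
        using R(2)[of K n] K(2) \<open>0 < r\<close> by (intro divide_right_mono) linarith+
      finally show ?thesis using \<open>0 < r\<close> by simp
    qed
    show "\<exists>N. (\<forall>n. N n \<in> events) \<and> (\<forall>\<^sub>F n in sequentially. prob (N n) \<le> d) \<and>
        (\<forall>n. \<forall>\<omega>\<in>space M - N n. dist (avg (fst (n, \<omega>)) (\<lambda>i. X i (snd (n, \<omega>)))) m < r)"
    proof (intro exI[of _ "\<lambda>n. N n \<union> ?F n"] conjI allI ballI)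
      show "\<forall>\<^sub>F n in sequentially. prob (N n \<union> ?F n) \<le> d" using N(2)
      proof eventually_elim
        case (elim n)
        have "prob (N n \<union> ?F n) \<le> prob (N n) + prob (?F n)"
          using N(1) by (intro measure_Un_le) auto
        then show ?case using elim F[of n] by simp
      qed
    next
      fix n \<omega> assume \<omega>: "\<omega> \<in> space M - (N n \<union> ?F n)"
      have "\<bar>avg n (\<lambda>i. X i \<omega>) - avg n (\<lambda>i. T K (X i \<omega>))\<bar> \<le> R K n \<omega>"
        unfolding avg_diff[symmetric] R_def by (auto simp: avg_def intro!: divide_right_mono)
      moreover have "R K n \<omega> < r / 4" using \<omega> by auto
      moreover have "\<bar>avg n (\<lambda>i. T K (X i \<omega>)) - expectation (\<lambda>\<omega>. T K (X 1 \<omega>))\<bar> < r / 4"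
        using N(3) \<omega> by (auto simp: dist_real_def)
      ultimately have "\<bar>avg n (\<lambda>i. X i \<omega>) - m\<bar> < r" using bias[of K] K(1) \<open>0 < r\<close> by linarith
      then show "dist (avg (fst (n, \<omega>)) (\<lambda>i. X i (snd (n, \<omega>)))) m < r" by (simp add: dist_real_def)
    qed (use N(1) in auto)
  qed
qed

lemma (in prob_space) weak_law_iid:
  fixes X :: "nat \<Rightarrow> 'a \<Rightarrow> 'b" and f :: "'b \<Rightarrow> real"
  assumes "iid_on M N {1..} X" "f \<in> borel_measurable N" "integrable M (\<lambda>\<omega>. f (X 1 \<omega>))"
  shows "((\<lambda>p. avg (fst p) (\<lambda>i. f (X i (snd p)))) \<longlongrightarrow> expectation (\<lambda>\<omega>. f (X 1 \<omega>))) (in_prob M)"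
  using iid_on_compose[OF assms(1,2)] assms(3)
  by (intro weak_law_of_large_numbers[of "\<lambda>i \<omega>. f (X i \<omega>)"])

section \<open>Weak convergence of studentized means\<close>

lemma norm_iexp_diff_le: "norm (iexp a - iexp b) \<le> \<bar>a - b\<bar>"
proof -
  have "iexp a - iexp b = iexp b * (iexp (a - b) - 1)"
    by (simp add: algebra_simps exp_add[symmetric] of_real_diff)
  then have "norm (iexp a - iexp b) = norm (iexp (a - b) - 1)"
    by (simp add: norm_mult)
  also have "\<dots> \<le> \<bar>a - b\<bar>" using iexp_approx1[of "a - b" 0] by simp
  finally show ?thesis .
qed

text \<open>Slutsky's theorem, by characteristic functions: where \<open>T\<close> and \<open>Z\<close> differ by less than \<open>e\<close>, the
  integrands differ by at most \<open>\<bar>t\<bar> e\<close>; on the remaining event, whose probability vanishes, they differ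
  by at most \<open>2\<close>.\<close>

lemma (in prob_space) weak_conv_m_in_prob_close:
  assumes [measurable]: "\<And>n. Z n \<in> borel_measurable M" "\<And>n. T n \<in> borel_measurable M"
    and N: "real_distribution N"
    and conv: "weak_conv_m (\<lambda>n. distr M borel (Z n)) N"
    and close: "((\<lambda>p. T (fst p) (snd p) - Z (fst p) (snd p)) \<longlongrightarrow> 0) (in_prob M)"
  shows "weak_conv_m (\<lambda>n. distr M borel (T n)) N"
proof (rule levy_continuity)
  fix t :: real
  have charZ: "(\<lambda>n. char (distr M borel (Z n)) t) \<longlonglongrightarrow> char N t"
    by (rule levy_continuity1[OF _ N conv]) simp
  have "(\<lambda>n. char (distr M borel (T n)) t - char (distr M borel (Z n)) t) \<longlonglongrightarrow> 0"
  proof (rule LIMSEQ_I)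
    fix r :: real assume "r > 0"
    define e where "e = r / (3 * (\<bar>t\<bar> + 1))"
    have "e > 0" using \<open>r > 0\<close> by (simp add: e_def)
    have te: "\<bar>t\<bar> * e \<le> r / 3"
    proof -
      have "\<bar>t\<bar> * e = r / 3 * (\<bar>t\<bar> / (\<bar>t\<bar> + 1))" by (simp add: e_def field_simps)
      also have "\<dots> \<le> r / 3 * 1" using \<open>r > 0\<close> by (intro mult_left_mono) auto
      finally show ?thesis by simp
    qed
    let ?A = "\<lambda>n. {\<omega>\<in>space M. e \<le> \<bar>T n \<omega> - Z n \<omega>\<bar>}"
    have "(\<lambda>n. prob (?A n)) \<longlonglongrightarrow> 0"
      using in_prob_tendstoD[OF close \<open>e > 0\<close>] by simp
    then have "\<forall>\<^sub>F n in sequentially. prob (?A n) < r / 3"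
      by (rule order_tendstoD(2)) (use \<open>r > 0\<close> in simp)
    then obtain n0 where n0: "\<forall>n\<ge>n0. prob (?A n) < r / 3" by (auto simp: eventually_sequentially)
    have "norm (char (distr M borel (T n)) t - char (distr M borel (Z n)) t) < r" if "n \<ge> n0" for n
    proof -
      have i1: "integrable M (\<lambda>\<omega>. iexp (t * T n \<omega>))" "integrable M (\<lambda>\<omega>. iexp (t * Z n \<omega>))"
        by (auto intro!: integrable_iexp)
      have i2: "integrable M (\<lambda>\<omega>. \<bar>t\<bar> * e + 2 * indicator (?A n) \<omega> :: real)"
        by (intro integrable_const_bound[where B="\<bar>t\<bar> * e + 2"])
           (use \<open>e > 0\<close> in \<open>auto simp: indicator_def\<close>)
      have "char (distr M borel (T n)) t - char (distr M borel (Z n)) t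
          = (CLINT \<omega>|M. iexp (t * T n \<omega>) - iexp (t * Z n \<omega>))"
        using i1 by (simp add: char_def integral_distr)
      then have "norm (char (distr M borel (T n)) t - char (distr M borel (Z n)) t)
          \<le> (LINT \<omega>|M. norm (iexp (t * T n \<omega>) - iexp (t * Z n \<omega>)))"
        by simp
      also have "\<dots> \<le> (LINT \<omega>|M. \<bar>t\<bar> * e + 2 * indicator (?A n) \<omega>)"
      proof (intro integral_mono integrable_norm Bochner_Integration.integrable_diff i1 i2)
        fix \<omega> assume \<omega>: "\<omega> \<in> space M"
        show "norm (iexp (t * T n \<omega>) - iexp (t * Z n \<omega>)) \<le> \<bar>t\<bar> * e + 2 * indicator (?A n) \<omega>"
        proof (cases "\<omega> \<in> ?A n")
          case True
          have "norm (iexp (t * T n \<omega>) - iexp (t * Z n \<omega>)) \<le> 1 + 1"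
            by (intro norm_triangle_le_diff add_mono) (auto simp: norm_exp_i_times)
          then show ?thesis using True \<open>e > 0\<close> by (simp add: add_increasing)
        next
          case False
          then have "\<bar>t * T n \<omega> - t * Z n \<omega>\<bar> \<le> \<bar>t\<bar> * e"
            using \<omega> by (auto simp: right_diff_distrib[symmetric] abs_mult intro!: mult_left_mono)
          then show ?thesis using norm_iexp_diff_le[of "t * T n \<omega>" "t * Z n \<omega>"] False by simp
        qed
      qed
      also have "\<dots> = \<bar>t\<bar> * e + 2 * prob (?A n)"
        by (subst Bochner_Integration.integral_add) (auto simp: prob_space emeasure_eq_measure)
      also have "\<dots> < r" using te n0 that by fastforce
      finally show ?thesis .
    qed
    then show "\<exists>n0. \<forall>n\<ge>n0. norm (char (distr M borel (T n)) t - char (distr M borel (Z n)) t - 0) < r"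
      by auto
  qed
  from tendsto_add[OF this charZ] show "(\<lambda>n. char (distr M borel (T n)) t) \<longlonglongrightarrow> char N t" by simp
qed (auto simp: N)

text \<open>The sample variance is insensitive to perturbations that are small in mean square, so closeness in
  mean square is all that is asked of \<open>V\<close>, whereas the numerator is compared on the finer scale
  \<open>1 / sqrt n\<close>.  The numerator \<open>T\<close> is kept apart from \<open>V\<close> because one numerator is to be
  studentized in two ways.\<close>

lemma (in prob_space) studentized_mean_weak_conv:
  fixes w :: "nat \<Rightarrow> 'a \<Rightarrow> real" and V :: "nat \<Rightarrow> 'a \<Rightarrow> nat \<Rightarrow> real"
  assumes iid: "iid_on M borel {1..} w"
    and mean: "expectation (w 1) = 0"
    and int2: "integrable M (\<lambda>\<omega>. (w 1 \<omega>)\<^sup>2)"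
    and pos: "expectation (\<lambda>\<omega>. (w 1 \<omega>)\<^sup>2) > 0"
    and V: "((\<lambda>p. avg (fst p) (\<lambda>i. (V (fst p) (snd p) i - w i (snd p))\<^sup>2)) \<longlongrightarrow> 0) (in_prob M)"
    and T: "((\<lambda>p. T (fst p) (snd p) - sqrt (real (fst p)) * avg (fst p) (\<lambda>i. w i (snd p))) \<longlongrightarrow> 0) (in_prob M)"
    and meas: "\<And>n. (\<lambda>\<omega>. T n \<omega> * sample_variance n (V n \<omega>) powr (- 1 / 2)) \<in> borel_measurable M"
  shows "weak_conv_m (\<lambda>n. distr M borel (\<lambda>\<omega>. T n \<omega> * sample_variance n (V n \<omega>) powr (- 1 / 2)))
    std_normal_distribution"
proof -
  define v where "v = expectation (\<lambda>\<omega>. (w 1 \<omega>)\<^sup>2)"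
  note indep = iid_onD(1)[OF iid] and ident = iid_onD(2)[OF iid]
  have rv [measurable]: "i \<ge> 1 \<Longrightarrow> w i \<in> borel_measurable M" for i
    by (rule iid_on_rv[OF iid])
  have sq: "integrable M (\<lambda>\<omega>. (w i \<omega>)\<^sup>2)" "expectation (\<lambda>\<omega>. (w i \<omega>)\<^sup>2) = v" if "i \<ge> 1" for i
    using iid_moments[OF iid _ that, of "\<lambda>x. x\<^sup>2"] int2 by (auto simp: v_def)
  have int: "integrable M (w 1)"
    by (rule square_integrable_imp_integrable[OF rv[OF order_refl] int2])
  have mean': "expectation (w i) = 0" if "i \<ge> 1" for i
    using iid_moments(2)[OF iid _ that, of "\<lambda>x. x"] mean by simp
  let ?w = "\<lambda>p i. w i (snd p)" and ?r = "\<lambda>p i. V (fst p) (snd p) i - w i (snd p)"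
  have w1: "((\<lambda>p. avg (fst p) (?w p)) \<longlongrightarrow> 0) (in_prob M)"
    using weak_law_of_large_numbers[OF iid int] mean by simp
  have w2: "((\<lambda>p. avg (fst p) (\<lambda>i. (?w p i)\<^sup>2)) \<longlongrightarrow> v) (in_prob M)"
    unfolding v_def by (rule weak_law_iid[OF iid]) (use int2 in auto)
  have wr: "((\<lambda>p. avg (fst p) (\<lambda>i. ?w p i * ?r p i)) \<longlongrightarrow> 0) (in_prob M)"
    by (rule tendsto_avg_product_zero[OF w2 V])
  have r1: "((\<lambda>p. avg (fst p) (?r p)) \<longlongrightarrow> 0) (in_prob M)"
    by (rule tendsto_avg_zero[OF V])
  have VV: "avg n (\<lambda>i. (f i)\<^sup>2) - (avg n f)\<^sup>2 = avg n (\<lambda>i. (g i)\<^sup>2) + 2 * avg n (\<lambda>i. g i * (f i - g i))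
      + avg n (\<lambda>i. (f i - g i)\<^sup>2) - (avg n g + avg n (\<lambda>i. f i - g i))\<^sup>2" for n and f g :: "nat \<Rightarrow> real"
  proof -
    have "avg n (\<lambda>i. (f i)\<^sup>2) = avg n (\<lambda>i. (g i)\<^sup>2 + 2 * (g i * (f i - g i)) + (f i - g i)\<^sup>2)"
      by (simp add: power2_eq_square algebra_simps)
    then show ?thesis by (simp add: avg_add avg_cmult avg_diff)
  qed
  have "((\<lambda>p. (real (fst p) / (real (fst p) - 1)) * (avg (fst p) (\<lambda>i. (?w p i)\<^sup>2) + 2 * avg (fst p) (\<lambda>i. ?w p i * ?r p i)
      + avg (fst p) (\<lambda>i. (?r p i)\<^sup>2) - (avg (fst p) (?w p) + avg (fst p) (?r p))\<^sup>2)) \<longlongrightarrow>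
      1 * (v + 2 * 0 + 0 - (0 + 0)\<^sup>2)) (in_prob M)"
  proof (intro tendsto_intros w1 w2 V wr r1)
    have "(\<lambda>n. real n / (real n - 1)) \<longlonglongrightarrow> 1" by real_asymp
    then show "((\<lambda>p. real (fst p) / (real (fst p) - 1)) \<longlongrightarrow> 1) (in_prob M)" by (rule tendsto_in_prob_lift)
  qed
  then have lim: "((\<lambda>p. (real (fst p) / (real (fst p) - 1)) * (avg (fst p) (\<lambda>i. (?w p i)\<^sup>2) + 2 * avg (fst p) (\<lambda>i. ?w p i * ?r p i)
      + avg (fst p) (\<lambda>i. (?r p i)\<^sup>2) - (avg (fst p) (?w p) + avg (fst p) (?r p))\<^sup>2)) \<longlongrightarrow> v) (in_prob M)"
    by simp
  note eventually_fst_ge_in_prob[of 2 M]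
  then have SV: "((\<lambda>p. sample_variance (fst p) (V (fst p) (snd p))) \<longlongrightarrow> v) (in_prob M)"
  proof (intro Lim_transform_eventually[OF lim], elim eventually_mono)
    fix p :: "nat \<times> 'a" assume "2 \<le> fst p"
    then show "(real (fst p) / (real (fst p) - 1)) * (avg (fst p) (\<lambda>i. (?w p i)\<^sup>2) + 2 * avg (fst p) (\<lambda>i. ?w p i * ?r p i)
      + avg (fst p) (\<lambda>i. (?r p i)\<^sup>2) - (avg (fst p) (?w p) + avg (fst p) (?r p))\<^sup>2) = sample_variance (fst p) (V (fst p) (snd p))"
      by (simp only: sample_variance_eq VV[of _ "V _ _" "?w p"])
  qed
  define u where "u = v powr (- 1 / 2)"
  have SVp: "((\<lambda>p. sample_variance (fst p) (V (fst p) (snd p)) powr (- 1 / 2)) \<longlongrightarrow> u) (in_prob M)"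
    unfolding u_def using pos by (intro tendsto_powr SV tendsto_const) (simp add: v_def)
  define Z where "Z n \<omega> = sqrt (real n) * avg n (\<lambda>i. w i \<omega>)" for n \<omega>
  have Z_meas [measurable]: "Z n \<in> borel_measurable M" for n
    unfolding Z_def avg_def by measurable
  have Zb: "bdd_in_prob M (\<lambda>p. Z (fst p) (snd p))"
    unfolding Z_def by (rule bdd_in_prob_scaled_avg[OF iid, of "\<lambda>x. x"]) (use int2 mean in auto)
  have uv: "u = 1 / sqrt v" using pos
  proof -
    have "v > 0" using pos by (simp only: v_def)
    have "u = v powr (- (1 / 2))" by (simp add: u_def)
    also have "\<dots> = inverse (v powr (1 / 2))" by (rule powr_minus)
    also have "\<dots> = 1 / sqrt v" using \<open>v > 0\<close> by (simp add: powr_half_sqrt inverse_eq_divide)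
    finally show ?thesis .
  qed
  have CLT: "weak_conv_m (\<lambda>n. distr M borel (\<lambda>\<omega>. Z n \<omega> * u)) std_normal_distribution"
  proof -
    have "weak_conv_m (\<lambda>n. distr M borel (\<lambda>\<omega>. (\<Sum>i<n. w (Suc i) \<omega>) / sqrt (real n * (sqrt v)\<^sup>2))) std_normal_distribution"
    proof (rule central_limit_theorem_zero_mean)
      show "indep_vars (\<lambda>i. borel) (\<lambda>i. w (Suc i)) UNIV"
      proof (rule indep_varsI_prod)
        fix J :: "nat set" and A :: "nat \<Rightarrow> real set"
        assume J: "finite J" "J \<noteq> {}" and A: "\<And>i. i \<in> J \<Longrightarrow> A i \<in> sets borel"
        have "prob (\<Inter>i\<in>Suc ` J. w i -` A (i - 1) \<inter> space M) = (\<Prod>i\<in>Suc ` J. prob (w i -` A (i - 1) \<inter> space M))"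
          using J A by (intro indep_varsD[OF indep]) auto
        moreover have "(\<Inter>i\<in>Suc ` J. w i -` A (i - 1) \<inter> space M) = (\<Inter>i\<in>J. w (Suc i) -` A i \<inter> space M)"
          by (simp only: image_image INF_image o_def diff_Suc_1)
        ultimately show "prob (\<Inter>i\<in>J. w (Suc i) -` A i \<inter> space M) = (\<Prod>i\<in>J. prob (w (Suc i) -` A i \<inter> space M))"
          by (simp add: prod.reindex)
      qed auto
      show "distr M borel (w (Suc n)) = distr M borel (w 1)" for n by (rule ident) simp
      show "expectation (w (Suc n)) = 0" "integrable M (\<lambda>x. (w (Suc n) x)\<^sup>2)" for n
        using mean' sq by auto
      show "variance (w (Suc n)) = (sqrt v)\<^sup>2" for n
        using mean'[of "Suc n"] sq[of "Suc n"] pos by (simp add: v_def)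
      show "0 < sqrt v" using pos by (simp add: v_def)
    qed
    moreover have "(\<Sum>i<n. w (Suc i) \<omega>) / sqrt (real n * (sqrt v)\<^sup>2) = Z n \<omega> * u" for n \<omega>
    proof (cases "n = 0")
      case False
      have "(\<Sum>i<n. w (Suc i) \<omega>) = (\<Sum>i=1..n. w i \<omega>)"
        by (rule sum.reindex_bij_witness[of _ "\<lambda>i. i - 1" Suc]) auto
      moreover have "X / sqrt (a * (sqrt v)\<^sup>2) = sqrt a * (X / a) * (1 / sqrt v)" if "a > 0" for X a :: real
      proof -
        have "v \<ge> 0" using pos by (simp only: v_def)
        then have "sqrt (a * (sqrt v)\<^sup>2) = sqrt a * sqrt v" by (simp only: real_sqrt_pow2 real_sqrt_mult)
        moreover have "sqrt a * (X / a) = X / sqrt a"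
        proof -
          have "sqrt a * (X / a) = X * sqrt a / (sqrt a * sqrt a)" using that by simp
          also have "\<dots> = X / sqrt a" by (rule nonzero_mult_divide_mult_cancel_right) (use that in simp)
          finally show ?thesis .
        qed
        ultimately show ?thesis by simp
      qed
      ultimately show ?thesis
        using False by (simp only: Z_def avg_def uv of_nat_0_less_iff)
    qed (simp add: Z_def avg_def)
    ultimately show ?thesis by (simp only:)
  qed
  show ?thesis
  proof (rule weak_conv_m_in_prob_close[OF _ meas real_dist_normal_dist CLT])
    let ?SV = "\<lambda>p. sample_variance (fst p) (V (fst p) (snd p)) powr (- 1 / 2)"
    have "((\<lambda>p. (T (fst p) (snd p) - Z (fst p) (snd p)) * ?SV p + Z (fst p) (snd p) * (?SV p - u)) \<longlongrightarrow> 0 * u + 0) (in_prob M)"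
    proof (intro tendsto_add tendsto_mult SVp bdd_in_prob_times_null(1)[OF Zb])
      show "((\<lambda>p. T (fst p) (snd p) - Z (fst p) (snd p)) \<longlongrightarrow> 0) (in_prob M)"
        using T by (simp add: Z_def)
      show "((\<lambda>p. ?SV p - u) \<longlongrightarrow> 0) (in_prob M)" by (rule LIM_zero[OF SVp])
    qed
    then show "((\<lambda>p. T (fst p) (snd p) * ?SV p - Z (fst p) (snd p) * u) \<longlongrightarrow> 0) (in_prob M)"
      by (simp add: algebra_simps)
  qed measurable
qed

section \<open>The domain of attraction of the normal law\<close>

text \<open>In a Skorohod representation, \<open>\<bar>t\<bar> \<le> 1\<close> implies that the integrands differ by at most
  \<open>min 2 \<bar>Y n - Y0\<bar>\<close>, a bound free of \<open>t\<close> whose integral tends to \<open>0\<close> by dominated convergence.\<close>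

lemma char_conv_uniform:
  assumes \<mu>: "\<And>n. real_distribution (\<mu> n)" and N: "real_distribution N"
    and conv: "weak_conv_m \<mu> N"
  obtains D where "D \<longlonglongrightarrow> 0" "\<And>n t. \<bar>t\<bar> \<le> 1 \<Longrightarrow> norm (char (\<mu> n) t - char N t) \<le> D n"
proof -
  obtain \<Omega> :: "real measure" and Y :: "nat \<Rightarrow> real \<Rightarrow> real" and Y0 :: "real \<Rightarrow> real" where
    sk: "prob_space \<Omega> \<and> (\<forall>n. Y n \<in> measurable \<Omega> borel) \<and> (\<forall>n. distr \<Omega> borel (Y n) = \<mu> n) \<and>
      Y0 \<in> measurable \<Omega> lborel \<and> distr \<Omega> borel Y0 = N \<and> (\<forall>\<omega> \<in> space \<Omega>. (\<lambda>n. Y n \<omega>) \<longlonglongrightarrow> Y0 \<omega>)"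
    using Skorohod[OF \<mu> N conv] by (elim exE)
  have \<Omega>: "prob_space \<Omega>" and Ym [measurable]: "Y n \<in> borel_measurable \<Omega>"
    and Yd: "distr \<Omega> borel (Y n) = \<mu> n" and Y0m [measurable]: "Y0 \<in> borel_measurable \<Omega>"
    and Y0d: "distr \<Omega> borel Y0 = N" and lim: "\<omega> \<in> space \<Omega> \<Longrightarrow> (\<lambda>n. Y n \<omega>) \<longlonglongrightarrow> Y0 \<omega>" for n \<omega>
    using sk by simp_all
  interpret \<Omega>: prob_space \<Omega> by fact
  define D where "D n = (LINT \<omega>|\<Omega>. min 2 \<bar>Y n \<omega> - Y0 \<omega>\<bar>)" for n
  have "(\<lambda>n. LINT \<omega>|\<Omega>. min 2 \<bar>Y n \<omega> - Y0 \<omega>\<bar>) \<longlonglongrightarrow> (LINT \<omega>|\<Omega>. 0)"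
  proof (rule integral_dominated_convergence[where w="\<lambda>_. 2"])
    show "AE \<omega> in \<Omega>. (\<lambda>n. min 2 \<bar>Y n \<omega> - Y0 \<omega>\<bar>) \<longlonglongrightarrow> 0"
    proof (rule AE_I2)
      fix \<omega> assume "\<omega> \<in> space \<Omega>"
      then have "(\<lambda>n. min 2 \<bar>Y n \<omega> - Y0 \<omega>\<bar>) \<longlonglongrightarrow> min 2 \<bar>Y0 \<omega> - Y0 \<omega>\<bar>"
        by (intro tendsto_intros lim)
      then show "(\<lambda>n. min 2 \<bar>Y n \<omega> - Y0 \<omega>\<bar>) \<longlonglongrightarrow> 0" by simp
    qed
  qed auto
  then have "D \<longlonglongrightarrow> 0" by (simp add: D_def[abs_def])
  moreover have "norm (char (\<mu> n) t - char N t) \<le> D n" if t: "\<bar>t\<bar> \<le> 1" for n t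
  proof -
    have i: "integrable \<Omega> (\<lambda>\<omega>. iexp (t * Y n \<omega>))" "integrable \<Omega> (\<lambda>\<omega>. iexp (t * Y0 \<omega>))"
      by (auto intro!: \<Omega>.integrable_iexp)
    have "char (\<mu> n) t - char N t = (CLINT \<omega>|\<Omega>. iexp (t * Y n \<omega>) - iexp (t * Y0 \<omega>))"
      using i by (simp add: char_def integral_distr Yd[symmetric] Y0d[symmetric])
    then have "norm (char (\<mu> n) t - char N t) \<le> (LINT \<omega>|\<Omega>. norm (iexp (t * Y n \<omega>) - iexp (t * Y0 \<omega>)))"
      by simp
    also have "\<dots> \<le> D n" unfolding D_def
    proof (intro integral_mono integrable_norm Bochner_Integration.integrable_diff i)
      show "integrable \<Omega> (\<lambda>\<omega>. min 2 \<bar>Y n \<omega> - Y0 \<omega>\<bar>)"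
        by (intro \<Omega>.integrable_const_bound[where B=2]) auto
      fix \<omega>
      have "norm (iexp (t * Y n \<omega>) - iexp (t * Y0 \<omega>)) \<le> 1 + 1"
        by (intro norm_triangle_le_diff add_mono) (auto simp: norm_exp_i_times)
      moreover have "\<bar>t * Y n \<omega> - t * Y0 \<omega>\<bar> \<le> \<bar>Y n \<omega> - Y0 \<omega>\<bar>"
        using t mult_right_mono[OF t, of "\<bar>Y n \<omega> - Y0 \<omega>\<bar>"]
        by (simp add: right_diff_distrib[symmetric] abs_mult)
      ultimately show "norm (iexp (t * Y n \<omega>) - iexp (t * Y0 \<omega>)) \<le> min 2 \<bar>Y n \<omega> - Y0 \<omega>\<bar>"
        using norm_iexp_diff_le[of "t * Y n \<omega>" "t * Y0 \<omega>"] by simp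
    qed
    finally show ?thesis .
  qed
  ultimately show ?thesis by (rule that)
qed

text \<open>Fatou's lemma along the truncations.\<close>

lemma (in prob_space) integrable_of_bounded_truncations:
  fixes f :: "'a \<Rightarrow> real"
  assumes [measurable]: "f \<in> borel_measurable M" and nonneg: "\<And>\<omega>. 0 \<le> f \<omega>"
    and bound: "\<And>L::nat. expectation (\<lambda>\<omega>. min (f \<omega>) (real L)) \<le> C"
  shows "integrable M f"
proof (rule integrableI_nonneg)
  have "(\<integral>\<^sup>+\<omega>. ennreal (f \<omega>) \<partial>M) \<le> (\<integral>\<^sup>+\<omega>. liminf (\<lambda>L. ennreal (min (f \<omega>) (real L))) \<partial>M)"
  proof (rule nn_integral_mono)
    fix \<omega>
    have "\<forall>\<^sub>F L in sequentially. f \<omega> \<le> real L"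
      using filterlim_real_sequentially by (simp add: filterlim_at_top)
    then have "\<forall>\<^sub>F L in sequentially. ennreal (min (f \<omega>) (real L)) = ennreal (f \<omega>)"
      by eventually_elim simp
    then have "(\<lambda>L. ennreal (min (f \<omega>) (real L))) \<longlonglongrightarrow> ennreal (f \<omega>)" by (rule tendsto_eventually)
    then show "ennreal (f \<omega>) \<le> liminf (\<lambda>L. ennreal (min (f \<omega>) (real L)))"
      by (simp add: lim_imp_Liminf)
  qed
  also have "\<dots> \<le> liminf (\<lambda>L. \<integral>\<^sup>+\<omega>. ennreal (min (f \<omega>) (real L)) \<partial>M)"
    by (rule nn_integral_liminf) simp
  also have "\<dots> \<le> ennreal C"
  proof (rule Liminf_le)
    have "(\<integral>\<^sup>+\<omega>. ennreal (min (f \<omega>) (real L)) \<partial>M) \<le> ennreal C" for L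
    proof -
      have "(\<integral>\<^sup>+\<omega>. ennreal (min (f \<omega>) (real L)) \<partial>M) = ennreal (expectation (\<lambda>\<omega>. min (f \<omega>) (real L)))"
        using nonneg by (intro nn_integral_eq_integral integrable_const_bound[where B="real L"]) auto
      then show ?thesis using bound[of L] by (simp add: ennreal_leI)
    qed
    then show "\<forall>\<^sub>F L in sequentially. (\<integral>\<^sup>+\<omega>. ennreal (min (f \<omega>) (real L)) \<partial>M) \<le> ennreal C"
      by simp
  qed simp
  finally show "(\<integral>\<^sup>+\<omega>. ennreal (f \<omega>) \<partial>M) < \<infinity>"
    by (rule le_less_trans) simp
qed (use nonneg in auto)

text \<open>On an event \<open>\<bar>Y\<bar> \<le> k\<close> of positive probability, \<open>\<bar>X\<bar>\<close> is at most \<open>\<bar>X - Y\<bar> + k\<close>, and by independence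
  restriction to this event multiplies the truncated expectations of \<open>\<bar>X\<bar>\<close> by a fixed constant.\<close>

lemma (in prob_space) integrable_of_difference_integrable:
  fixes X Y :: "'a \<Rightarrow> real"
  assumes ind: "indep_var borel X borel Y" and int: "integrable M (\<lambda>\<omega>. X \<omega> - Y \<omega>)"
  shows "integrable M X"
proof -
  have [measurable]: "X \<in> borel_measurable M" "Y \<in> borel_measurable M"
    using indep_var_rv1[OF ind] indep_var_rv2[OF ind] by auto
  define A where "A k = {\<omega>\<in>space M. \<bar>Y \<omega>\<bar> \<le> real k}" for k :: nat
  have A_meas [measurable]: "A k \<in> events" for k unfolding A_def by measurable
  have "\<exists>k. prob (A k) > 0"
  proof (rule ccontr)
    assume "\<not> (\<exists>k. prob (A k) > 0)"
    then have "prob (A k) = 0" for k using measure_nonneg[of M "A k"] by (metis less_eq_real_def)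
    then have "(\<lambda>k. prob (A k)) \<longlonglongrightarrow> 0" by simp
    moreover have "(\<lambda>k. prob (A k)) \<longlonglongrightarrow> prob (\<Union>k. A k)"
      by (intro finite_Lim_measure_incseq) (auto simp: incseq_def A_def)
    moreover have "(\<Union>k. A k) = space M"
      using real_arch_simple by (auto simp: A_def)
    ultimately show False using LIMSEQ_unique by (fastforce simp: prob_space)
  qed
  then obtain k where k: "prob (A k) > 0" ..
  define B where "B y = (indicator {-real k..real k} y :: real)" for y
  have [measurable]: "B \<in> borel_measurable borel" unfolding B_def by measurable
  have EB: "expectation (\<lambda>\<omega>. B (Y \<omega>)) = prob (A k)"
  proof -
    have "expectation (\<lambda>\<omega>. B (Y \<omega>)) = expectation (indicator (A k))"
      by (intro Bochner_Integration.integral_cong) (auto simp: A_def B_def indicator_def)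
    then show ?thesis by simp
  qed
  have "integrable M (\<lambda>\<omega>. \<bar>X \<omega>\<bar>)"
  proof (rule integrable_of_bounded_truncations)
    fix L :: nat
    have iX: "integrable M (\<lambda>\<omega>. min \<bar>X \<omega>\<bar> (real L))"
      by (intro integrable_const_bound[where B="real L"]) auto
    have iB: "integrable M (\<lambda>\<omega>. B (Y \<omega>))"
      by (intro integrable_const_bound[where B=1]) (auto simp: B_def indicator_def)
    have ind2: "indep_var borel (\<lambda>\<omega>. min \<bar>X \<omega>\<bar> (real L)) borel (\<lambda>\<omega>. B (Y \<omega>))"
      using indep_var_compose[OF ind, of "\<lambda>x. min \<bar>x\<bar> (real L)" borel B borel] by (simp add: comp_def)
    have "expectation (\<lambda>\<omega>. min \<bar>X \<omega>\<bar> (real L)) * prob (A k)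
        = expectation (\<lambda>\<omega>. min \<bar>X \<omega>\<bar> (real L) * B (Y \<omega>))"
      using indep_var_lebesgue_integral[OF ind2 iX iB] EB by simp
    also have "\<dots> \<le> expectation (\<lambda>\<omega>. \<bar>X \<omega> - Y \<omega>\<bar> + real k)"
      using int by (intro integral_mono indep_var_integrable[OF ind2 iX iB]) (auto simp: B_def indicator_def)
    also have "\<dots> = expectation (\<lambda>\<omega>. \<bar>X \<omega> - Y \<omega>\<bar>) + real k"
      using int by (simp add: prob_space)
    finally show "expectation (\<lambda>\<omega>. min \<bar>X \<omega>\<bar> (real L)) \<le> (expectation (\<lambda>\<omega>. \<bar>X \<omega> - Y \<omega>\<bar>) + real k) / prob (A k)"
      using k by (simp add: field_simps)
  qed auto
  then show ?thesis by (simp add: integrable_abs_iff)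
qed

text \<open>The scale \<open>k\<close> is chosen such that \<open>u = \<tau> \<bar>x\<bar> / (3/2)^k\<close> lies between \<open>1\<close> and \<open>3/2\<close>, where
  \<open>1 - cos u \<ge> 1 - cos 1\<close>.  The ratio \<open>3/2\<close> matches the growth of the norming constants in
  \<open>DAN_integrable\<close>.\<close>

lemma geometric_scale_bound:
  fixes \<tau> x :: real
  assumes "\<tau> > 0" "1 < \<tau> * \<bar>x\<bar>"
  obtains k where "\<bar>x\<bar> \<le> 3/2 / (\<tau> * (1 - cos 1)) * ((3/2)^k * (1 - cos (\<tau> / (3/2)^k * x)))"
proof -
  obtain l where l: "(3/2)^l > \<tau> * \<bar>x\<bar>" using real_arch_pow[of "3/2"] by auto
  define l0 where "l0 = (LEAST l. (3/2::real)^l > \<tau> * \<bar>x\<bar>)"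
  have l0: "(3/2)^l0 > \<tau> * \<bar>x\<bar>" unfolding l0_def by (rule LeastI, rule l)
  with assms(2) have "l0 \<noteq> 0" by (intro notI) simp
  then obtain k where k: "l0 = Suc k" using not0_implies_Suc by blast
  have k1: "(3/2)^k \<le> \<tau> * \<bar>x\<bar>" using not_less_Least[of k "\<lambda>l. (3/2::real)^l > \<tau> * \<bar>x\<bar>"] k
    by (simp add: l0_def[symmetric] not_less)
  have k2: "\<tau> * \<bar>x\<bar> < 3/2 * (3/2)^k" using l0 k by simp
  define u where "u = \<tau> / (3/2)^k * \<bar>x\<bar>"
  have u: "1 \<le> u" "u \<le> 3/2" using k1 k2 by (simp_all add: u_def field_simps)
  have "cos u \<le> cos 1" using u pi_gt3 by (intro cos_monotone_0_pi_le) auto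
  moreover have "cos u = cos (\<tau> / (3/2)^k * x)" by (cases "x \<ge> 0") (simp_all add: u_def)
  moreover have c: "cos 1 < (1::real)" using cos_monotone_0_pi[of 0 1] pi_gt3 by simp
  ultimately have "\<bar>x\<bar> * (1 - cos 1) \<le> \<bar>x\<bar> * (1 - cos (\<tau> / (3/2)^k * x))"
    by (intro mult_left_mono) auto
  also have "\<dots> \<le> (3/2 * (3/2)^k / \<tau>) * (1 - cos (\<tau> / (3/2)^k * x))"
    using k2 assms(1) by (intro mult_right_mono) (auto simp: field_simps)
  finally have "\<bar>x\<bar> \<le> 3/2 / (\<tau> * (1 - cos 1)) * ((3/2)^k * (1 - cos (\<tau> / (3/2)^k * x)))"
    using c assms(1) by (simp add: field_simps)
  then show ?thesis by (rule that)
qed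

text \<open>By \<open>geometric_scale_bound\<close>, \<open>\<bar>X\<bar>\<close> is dominated by a sum over all scales; the weights grow like \<open>(3/2)^k\<close>
  and the expectations decay like \<open>1 / 2^k\<close>, so the series is geometric with ratio \<open>3/4\<close>.\<close>

lemma (in prob_space) integrable_of_cosine_decay:
  fixes X :: "'a \<Rightarrow> real"
  assumes [measurable]: "X \<in> borel_measurable M" and "\<tau> > 0"
    and decay: "\<And>k. expectation (\<lambda>\<omega>. 1 - cos (\<tau> / (3/2)^k * X \<omega>)) \<le> D / 2 ^ k"
  shows "integrable M X"
proof (rule integrableI_bounded)
  define C where "C = 3/2 / (\<tau> * (1 - cos 1))"
  have "cos 1 < (1::real)" using cos_monotone_0_pi[of 0 1] pi_gt3 by simp
  then have "C > 0" using \<open>\<tau> > 0\<close> by (simp add: C_def)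
  define h where "h k x = C * ((3/2)^k * (1 - cos (\<tau> / (3/2)^k * x)))" for k :: nat and x :: real
  have h0: "0 \<le> h k x" for k x using \<open>C > 0\<close> by (simp add: h_def)
  have [measurable]: "h k \<in> borel_measurable borel" for k unfolding h_def by measurable
  have pw: "ennreal (norm (X \<omega>)) \<le> ennreal (1 / \<tau>) + (\<Sum>k. ennreal (h k (X \<omega>)))" for \<omega>
  proof (cases "1 < \<tau> * \<bar>X \<omega>\<bar>")
    case True
    with \<open>\<tau> > 0\<close> obtain k where "\<bar>X \<omega>\<bar> \<le> h k (X \<omega>)"
      unfolding h_def C_def using geometric_scale_bound by metis
    then have "ennreal (norm (X \<omega>)) \<le> ennreal (h k (X \<omega>))" by (simp add: ennreal_leI)
    also have "\<dots> \<le> (\<Sum>k. ennreal (h k (X \<omega>)))"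
      using sum_le_suminf[of "\<lambda>k. ennreal (h k (X \<omega>))" "{k}"] by simp
    finally show ?thesis by (rule order_trans) simp
  next
    case False
    then have "norm (X \<omega>) \<le> 1 / \<tau>" using \<open>\<tau> > 0\<close> by (simp add: field_simps)
    then have "ennreal (norm (X \<omega>)) \<le> ennreal (1 / \<tau>)" by (rule ennreal_leI)
    then show ?thesis by (rule order_trans) simp
  qed
  have "0 \<le> expectation (\<lambda>\<omega>. 1 - cos (\<tau> / (3/2)^0 * X \<omega>))"
    by (rule Bochner_Integration.integral_nonneg) simp
  also have "\<dots> \<le> D / 2 ^ 0" by (rule decay)
  finally have D0: "0 \<le> D" by simp
  have hk: "(\<integral>\<^sup>+\<omega>. ennreal (h k (X \<omega>)) \<partial>M) \<le> ennreal (C * D * (3/4)^k)" for k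
  proof -
    have i: "integrable M (\<lambda>\<omega>. 1 - cos (\<tau> / (3/2)^k * X \<omega>))"
      by (intro integrable_const_bound[where B=2] AE_I2)
         (auto intro: order_trans[OF abs_triangle_ineq4] simp: abs_le_iff[of "cos _"])
    have "(\<integral>\<^sup>+\<omega>. ennreal (h k (X \<omega>)) \<partial>M) = ennreal (expectation (\<lambda>\<omega>. h k (X \<omega>)))"
      using h0 i by (intro nn_integral_eq_integral) (auto simp: h_def)
    also have "expectation (\<lambda>\<omega>. h k (X \<omega>)) = C * ((3/2)^k * expectation (\<lambda>\<omega>. 1 - cos (\<tau> / (3/2)^k * X \<omega>)))"
      by (simp add: h_def)
    also have "\<dots> \<le> C * ((3/2)^k * (D / 2^k))"
      using \<open>C > 0\<close> decay by (intro mult_left_mono) auto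
    also have "\<dots> = C * D * (3/4)^k"
      by (simp add: power_divide field_simps flip: power_mult_distrib)
    finally show ?thesis using ennreal_leI by blast
  qed
  have sm: "summable (\<lambda>k. C * D * (3/4::real)^k)" by (intro summable_mult summable_geometric) simp
  have "(\<integral>\<^sup>+\<omega>. ennreal (norm (X \<omega>)) \<partial>M) \<le> (\<integral>\<^sup>+\<omega>. ennreal (1 / \<tau>) + (\<Sum>k. ennreal (h k (X \<omega>))) \<partial>M)"
    by (intro nn_integral_mono pw)
  also have "\<dots> = ennreal (1 / \<tau>) + (\<Sum>k. \<integral>\<^sup>+\<omega>. ennreal (h k (X \<omega>)) \<partial>M)"
    by (simp add: nn_integral_add nn_integral_suminf emeasure_space_1)
  also have "\<dots> \<le> ennreal (1 / \<tau>) + (\<Sum>k. ennreal (C * D * (3/4)^k))"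
    by (intro add_left_mono suminf_le hk) auto
  also have "\<dots> = ennreal (1 / \<tau>) + ennreal (\<Sum>k. C * D * (3/4)^k)"
    using \<open>C > 0\<close> D0 by (subst suminf_ennreal2) (auto intro: sm)
  also have "\<dots> < \<infinity>" by simp
  finally show "(\<integral>\<^sup>+\<omega>. ennreal (norm (X \<omega>)) \<partial>M) < \<infinity>" .
qed simp

text \<open>Passing to moduli removes the centring constants.\<close>

lemma (in prob_space) DAN_char_modulus_conv:
  fixes \<xi> :: "nat \<Rightarrow> 'a \<Rightarrow> real"
  assumes iid: "iid_on M borel {1..} \<xi>" and DAN: "DAN M \<xi>"
  obtains b D where "\<And>n. b n > (0::real)" "D \<longlonglongrightarrow> 0"
    "\<And>n t. \<bar>t\<bar> \<le> 1 \<Longrightarrow> \<bar>norm (char (distr M borel (\<xi> 1)) (t / b n)) ^ n - exp (- (t\<^sup>2) / 2)\<bar> \<le> D n"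
proof -
  note ind = iid_onD(1)[OF iid] and id = iid_onD(2)[OF iid]
  have rv [measurable]: "i \<ge> 1 \<Longrightarrow> \<xi> i \<in> borel_measurable M" for i
    using ind by (auto simp: indep_vars_def)
  obtain a b :: "nat \<Rightarrow> real" where b: "\<And>n. b n > 0" and conv:
     "weak_conv_m (\<lambda>n. distr M borel (\<lambda>\<omega>. ((\<Sum>i=1..n. \<xi> i \<omega>) - a n) / b n)) std_normal_distribution"
    using DAN by (auto simp: DAN_def)
  let ?\<mu> = "\<lambda>n. distr M borel (\<lambda>\<omega>. ((\<Sum>i=1..n. \<xi> i \<omega>) - a n) / b n)"
  have rd: "real_distribution (?\<mu> n)" for n by (rule real_distribution_distr) measurable
  obtain D where D: "D \<longlonglongrightarrow> 0"
    "\<And>n t. \<bar>t\<bar> \<le> 1 \<Longrightarrow> norm (char (?\<mu> n) t - char std_normal_distribution t) \<le> D n"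
    using char_conv_uniform[OF rd real_dist_normal_dist conv] by metis
  have mod: "norm (char (?\<mu> n) t) = norm (char (distr M borel (\<xi> 1)) (t / b n)) ^ n" for n t
  proof -
    have "char (?\<mu> n) t = (CLINT \<omega>|M. iexp (- t * a n / b n) * iexp (t / b n * (\<Sum>i=1..n. \<xi> i \<omega>)))"
      unfolding char_def
      by (subst integral_distr; (measurable | intro Bochner_Integration.integral_cong refl))
         (simp add: exp_add[symmetric] diff_divide_distrib algebra_simps)
    also have "\<dots> = iexp (- t * a n / b n) * char (distr M borel (\<lambda>\<omega>. \<Sum>i=1..n. \<xi> i \<omega>)) (t / b n)"
      unfolding char_def by (subst integral_distr) auto
    also have "char (distr M borel (\<lambda>\<omega>. \<Sum>i=1..n. \<xi> i \<omega>)) (t / b n) = (\<Prod>i=1..n. char (distr M borel (\<xi> i)) (t / b n))"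
      by (rule char_distr_sum, rule indep_vars_subset[OF ind]) auto
    also have "\<dots> = (\<Prod>i=1..n. char (distr M borel (\<xi> 1)) (t / b n))"
      by (intro prod.cong refl arg_cong2[where f=char] id) simp
    also have "\<dots> = char (distr M borel (\<xi> 1)) (t / b n) ^ n" by simp
    finally show ?thesis by (simp add: norm_mult norm_power norm_exp_i_times del: of_real_minus of_real_divide of_real_mult)
  qed
  have "\<bar>norm (char (distr M borel (\<xi> 1)) (t / b n)) ^ n - exp (- (t\<^sup>2) / 2)\<bar> \<le> D n" if "\<bar>t\<bar> \<le> 1" for n t
  proof -
    have "norm (char std_normal_distribution t) = exp (- (t\<^sup>2) / 2)"
      by (simp only: char_std_normal_distribution norm_of_real abs_exp_cancel)
    then show ?thesis
      using norm_triangle_ineq3[of "char (?\<mu> n) t" "char std_normal_distribution t"] D(2)[OF that, of n]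
      by (simp only: mod)
  qed
  with b D(1) show ?thesis by (rule that)
qed

text \<open>The characteristic function of a constant has modulus \<open>1\<close>, but the limit at \<open>t = 1\<close> is \<open>exp (- 1 / 2)\<close>.\<close>

lemma (in prob_space) DAN_nondegenerate:
  fixes \<xi> :: "nat \<Rightarrow> 'a \<Rightarrow> real"
  assumes iid: "iid_on M borel {1..} \<xi>" and DAN: "DAN M \<xi>"
  shows "\<not> (AE \<omega> in M. \<xi> 1 \<omega> = a)"
proof
  assume a: "AE \<omega> in M. \<xi> 1 \<omega> = a"
  obtain b D where bD: "\<And>n. b n > (0::real)" "D \<longlonglongrightarrow> 0"
    "\<And>n t. \<bar>t\<bar> \<le> 1 \<Longrightarrow> \<bar>norm (char (distr M borel (\<xi> 1)) (t / b n)) ^ n - exp (- (t\<^sup>2) / 2)\<bar> \<le> D n"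
    using DAN_char_modulus_conv[OF assms] by metis
  have rv [measurable]: "i \<ge> 1 \<Longrightarrow> \<xi> i \<in> borel_measurable M" for i
    using iid_onD(1)[OF iid] by (simp add: indep_vars_def)
  have "char (distr M borel (\<xi> 1)) t = iexp (t * a)" for t
  proof -
    have "char (distr M borel (\<xi> 1)) t = (CLINT \<omega>|M. iexp (t * \<xi> 1 \<omega>))"
      unfolding char_def by (subst integral_distr) auto
    also have "\<dots> = (CLINT \<omega>|M. iexp (t * a))"
      by (intro integral_cong_AE) (use a in auto)
    finally show ?thesis by (simp add: prob_space)
  qed
  then have "1 - exp (- 1 / 2) \<le> D n" for n
    using bD(3)[of 1 n] by (simp add: norm_exp_i_times del: of_real_mult)
  then have "1 - exp (- 1 / 2 :: real) \<le> 0"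
    using bD(2) by (intro tendsto_lowerbound[OF bD(2)]) auto
  then show False by simp
qed

text \<open>A sum of \<open>2 n\<close> variables is the sum of two independent sums of \<open>n\<close> variables, so \<open>b (2 n) / b n\<close>
  tends to \<open>sqrt 2\<close>, which is below \<open>3/2\<close>.  Along \<open>n = n0 * 2^k\<close> the norming constants therefore grow at
  most like \<open>(3/2)^k\<close>, while \<open>1 - \<bar>\<phi>(t / b n)\<bar>\<^sup>2\<close> is of order \<open>1 / n\<close>, that is \<open>1 / 2^k\<close>.  As \<open>\<bar>\<phi>\<bar>\<^sup>2\<close> is the
  characteristic function of \<open>\<xi> 1 - \<xi> 2\<close>, the difference is integrable by
  \<open>integrable_of_cosine_decay\<close>, and hence so is \<open>\<xi> 1\<close>.\<close>

lemma (in prob_space) DAN_integrable: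
  fixes \<xi> :: "nat \<Rightarrow> 'a \<Rightarrow> real"
  assumes iid: "iid_on M borel {1..} \<xi>" and DAN: "DAN M \<xi>"
  shows "integrable M (\<xi> 1)"
proof -
  note ind = iid_onD(1)[OF iid] and id = iid_onD(2)[OF iid]
  have rv [measurable]: "i \<ge> 1 \<Longrightarrow> \<xi> i \<in> borel_measurable M" for i
    using ind by (auto simp: indep_vars_def)
  define h where "h t = norm (char (distr M borel (\<xi> 1)) t)" for t
  have h1: "0 \<le> h t" "h t \<le> 1" for t
    using real_distribution.cmod_char_le_1[OF real_distribution_distr[OF rv[OF order_refl]]]
    by (simp_all add: h_def)
  obtain b D where b: "\<And>n. b n > (0::real)" and D: "D \<longlonglongrightarrow> 0"
    and hD: "\<And>n t. \<bar>t\<bar> \<le> 1 \<Longrightarrow> \<bar>h (t / b n) ^ n - exp (- (t\<^sup>2) / 2)\<bar> \<le> D n"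
    using DAN_char_modulus_conv[OF assms] unfolding h_def by metis
  \<comment> \<open>If \<open>b (2 n) > 3/2 * b n\<close>, comparing the values at \<open>t = 1\<close> for \<open>2 n\<close> and at \<open>r = b n / b (2 n)\<close> for \<open>n\<close>
    would give \<open>exp (- 1 / 2) \<ge> exp (- 4 / 9)\<close> in the limit.\<close>
  have ratio: "\<forall>\<^sub>F n in sequentially. b (2 * n) \<le> 3/2 * b n"
  proof -
    have D2: "(\<lambda>n. D (2 * n)) \<longlonglongrightarrow> 0"
      by (rule filterlim_compose[OF D]) (simp add: mult_nat_left_at_top)
    have "(\<lambda>n. (exp (- 2 / 9) - D n)\<^sup>2 - (exp (- 1 / 2) + D (2 * n))) \<longlonglongrightarrow> (exp (- 2 / 9) - 0)\<^sup>2 - (exp (- 1 / 2) + 0)"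
      by (intro tendsto_intros D D2)
    moreover have "(exp (- 2 / 9 :: real) - 0)\<^sup>2 - (exp (- 1 / 2) + 0) > 0"
      by (simp add: power2_eq_square exp_add[symmetric])
    ultimately have "\<forall>\<^sub>F n in sequentially. 0 < (exp (- 2 / 9) - D n)\<^sup>2 - (exp (- 1 / 2) + D (2 * n))"
      by (rule order_tendstoD(1))
    moreover have "\<forall>\<^sub>F n in sequentially. D n < exp (- 2 / 9)" by (rule order_tendstoD(2)[OF D]) simp
    ultimately show ?thesis
    proof eventually_elim
      case (elim n)
      show ?case
      proof (rule ccontr)
        assume neg: "\<not> b (2 * n) \<le> 3/2 * b n"
        define r where "r = b n / b (2 * n)"
        have r: "0 \<le> r" "r \<le> 2/3" using neg b[of n] b[of "2 * n"] by (simp_all add: r_def field_simps)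
        have "r\<^sup>2 \<le> (2/3)\<^sup>2" using r by (intro power_mono)
        then have "exp (- 2 / 9) \<le> exp (- (r\<^sup>2) / 2)" by (simp add: power2_eq_square)
        moreover have "\<bar>h (r / b n) ^ n - exp (- (r\<^sup>2) / 2)\<bar> \<le> D n" using r by (intro hD) simp
        ultimately have "exp (- 2 / 9) - D n \<le> h (r / b n) ^ n" by linarith
        then have "(exp (- 2 / 9) - D n)\<^sup>2 \<le> (h (r / b n) ^ n)\<^sup>2" using elim by (intro power_mono) auto
        also have "\<dots> = h (1 / b (2 * n)) ^ (2 * n)"
          using b[of n] by (simp add: r_def power_mult[symmetric] mult.commute)
        also have "\<dots> \<le> exp (- 1 / 2) + D (2 * n)"
          using hD[of 1 "2 * n"] unfolding power_one by linarith
        finally show False using elim by simp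
      qed
    qed
  qed
  have "\<forall>\<^sub>F n in sequentially. D n < exp (- 1 / 2) - 1 / 4"
  proof (rule order_tendstoD(2)[OF D])
    show "0 < exp (- 1 / 2) - 1 / (4::real)" using exp_ge_add_one_self[of "- 1 / 2"] by linarith
  qed
  then obtain n0 where n0: "n0 \<ge> 1" "\<And>n. n \<ge> n0 \<Longrightarrow> b (2 * n) \<le> 3/2 * b n"
      "\<And>n. n \<ge> n0 \<Longrightarrow> D n < exp (- 1 / 2) - 1 / 4"
  proof -
    assume that: "\<And>n0. n0 \<ge> 1 \<Longrightarrow> (\<And>n. n \<ge> n0 \<Longrightarrow> b (2 * n) \<le> 3/2 * b n) \<Longrightarrow>
      (\<And>n. n \<ge> n0 \<Longrightarrow> D n < exp (- 1 / 2) - 1 / 4) \<Longrightarrow> thesis"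
    have "\<forall>\<^sub>F n in sequentially. D n < exp (- 1 / 2) - 1 / 4" by fact
    with ratio have "\<forall>\<^sub>F n in sequentially. b (2 * n) \<le> 3/2 * b n \<and> D n < exp (- 1 / 2) - 1 / 4"
      by (rule eventually_conj)
    then obtain k where "\<And>n. n \<ge> k \<Longrightarrow> b (2 * n) \<le> 3/2 * b n \<and> D n < exp (- 1 / 2) - 1 / 4"
      unfolding eventually_sequentially by blast
    then show thesis by (intro that[of "max 1 k"]) auto
  qed
  \<comment> \<open>The bound \<open>1 / 4 \<le> h ^ n\<close> gives \<open>ln 16 \<ge> - n * ln (h\<^sup>2) \<ge> n * (1 - h\<^sup>2)\<close>.\<close>
  have decay: "1 - (h (t / b n))\<^sup>2 \<le> ln 16 / real n" if n: "n \<ge> n0" and t: "\<bar>t\<bar> \<le> 1" for n t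
  proof -
    have "t\<^sup>2 \<le> 1" using t by (simp add: abs_square_le_1)
    then have "exp (- 1 / 2) \<le> exp (- (t\<^sup>2) / 2)" by simp
    then have half: "1 / 4 \<le> h (t / b n) ^ n" using hD[OF t, of n] n0(3)[OF n] by linarith
    have n1: "n \<ge> 1" using n n0 by simp
    have pos: "h (t / b n) > 0" using half n1 h1(1)[of "t / b n"] 
      by (cases "h (t / b n) = 0") (auto simp: power_0_left)
    have "(1 / 4)\<^sup>2 \<le> (h (t / b n) ^ n)\<^sup>2" using half by (intro power_mono) auto
    then have "ln ((1 / 4)\<^sup>2) \<le> ln ((h (t / b n) ^ n)\<^sup>2)" using pos by (intro ln_mono) auto
    moreover have "ln ((1 / 4)\<^sup>2 :: real) = - ln 16" by (simp add: power2_eq_square ln_div)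
    moreover have "(h (t / b n) ^ n)\<^sup>2 = ((h (t / b n))\<^sup>2) ^ n" by (simp add: power_mult[symmetric] mult.commute)
    ultimately have "- ln 16 \<le> ln (((h (t / b n))\<^sup>2) ^ n)" by (simp only:)
    also have "\<dots> = real n * ln ((h (t / b n))\<^sup>2)" using pos by (simp add: ln_realpow)
    also have "\<dots> \<le> real n * ((h (t / b n))\<^sup>2 - 1)" using pos by (intro mult_left_mono ln_le_minus_one) auto
    finally show ?thesis using n1 by (simp add: field_simps)
  qed
  define Y where "Y \<omega> = \<xi> 1 \<omega> - \<xi> 2 \<omega>" for \<omega>
  \<comment> \<open>\<open>h\<^sup>2\<close> is the characteristic function of the symmetrized variable \<open>Y\<close>\<close>
  have sym: "expectation (\<lambda>\<omega>. 1 - cos (t * Y \<omega>)) = 1 - (h t)\<^sup>2" for t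
  proof -
    have ic: "integrable M (\<lambda>\<omega>. cos (t * \<xi> i \<omega>))" "integrable M (\<lambda>\<omega>. sin (t * \<xi> i \<omega>))" if "i \<ge> 1" for i
      using that by (auto intro!: integrable_const_bound[where B=1])
    have ic2: "integrable M (\<lambda>\<omega>. cos (t * \<xi> 1 \<omega>) * cos (t * \<xi> 2 \<omega>))"
        "integrable M (\<lambda>\<omega>. sin (t * \<xi> 1 \<omega>) * sin (t * \<xi> 2 \<omega>))"
      by (auto intro!: integrable_const_bound[where B=1] simp: abs_mult mult_le_one)
    have e2: "expectation (\<lambda>\<omega>. cos (t * \<xi> 2 \<omega>)) = expectation (\<lambda>\<omega>. cos (t * \<xi> 1 \<omega>))"
        "expectation (\<lambda>\<omega>. sin (t * \<xi> 2 \<omega>)) = expectation (\<lambda>\<omega>. sin (t * \<xi> 1 \<omega>))"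
      by (intro ident_distr_integral(2)[OF rv rv id]; simp)+
    have cc: "expectation (\<lambda>\<omega>. cos (t * \<xi> 1 \<omega>) * cos (t * \<xi> 2 \<omega>)) = (expectation (\<lambda>\<omega>. cos (t * \<xi> 1 \<omega>)))\<^sup>2"
      using indep_vars_product_expectation[OF indep_vars_compose2[OF ind, of "\<lambda>_ x. cos (t * x)"], of 1 2] ic e2
      by (simp add: power2_eq_square)
    have ss: "expectation (\<lambda>\<omega>. sin (t * \<xi> 1 \<omega>) * sin (t * \<xi> 2 \<omega>)) = (expectation (\<lambda>\<omega>. sin (t * \<xi> 1 \<omega>)))\<^sup>2"
      using indep_vars_product_expectation[OF indep_vars_compose2[OF ind, of "\<lambda>_ x. sin (t * x)"], of 1 2] ic e2
      by (simp add: power2_eq_square)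
    have ch: "char (distr M borel (\<xi> 1)) t = Complex (expectation (\<lambda>\<omega>. cos (t * \<xi> 1 \<omega>))) (expectation (\<lambda>\<omega>. sin (t * \<xi> 1 \<omega>)))"
    proof -
      have i: "integrable M (\<lambda>\<omega>. iexp (t * \<xi> 1 \<omega>))" by (auto intro!: integrable_iexp)
      have "char (distr M borel (\<xi> 1)) t = (CLINT \<omega>|M. iexp (t * \<xi> 1 \<omega>))"
        unfolding char_def by (subst integral_distr) auto
      then show ?thesis
        using integral_Re[OF i] integral_Im[OF i]
        by (simp add: complex_eq_iff Re_exp Im_exp)
    qed
    have "expectation (\<lambda>\<omega>. 1 - cos (t * Y \<omega>)) = expectation (\<lambda>\<omega>. 1 - (cos (t * \<xi> 1 \<omega>) * cos (t * \<xi> 2 \<omega>) + sin (t * \<xi> 1 \<omega>) * sin (t * \<xi> 2 \<omega>)))"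
      by (simp add: Y_def right_diff_distrib cos_diff)
    also have "\<dots> = 1 - (expectation (\<lambda>\<omega>. cos (t * \<xi> 1 \<omega>) * cos (t * \<xi> 2 \<omega>)) + expectation (\<lambda>\<omega>. sin (t * \<xi> 1 \<omega>) * sin (t * \<xi> 2 \<omega>)))"
      using ic2 by (simp add: prob_space)
    also have "\<dots> = 1 - (h t)\<^sup>2"
      by (simp only: cc ss h_def ch cmod_power2 complex.sel)
    finally show ?thesis .
  qed
  have bk: "b (n0 * 2^k) \<le> (3/2)^k * b n0" for k
  proof (induction k)
    case (Suc k)
    have "b (n0 * 2^Suc k) = b (2 * (n0 * 2^k))" by (simp add: ac_simps)
    also have "\<dots> \<le> 3/2 * b (n0 * 2^k)" by (intro n0(2)) simp
    also have "\<dots> \<le> 3/2 * ((3/2)^k * b n0)" using Suc by simp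
    finally show ?case by simp
  qed simp
  have "integrable M Y"
  proof (rule integrable_of_cosine_decay)
    show "Y \<in> borel_measurable M" unfolding Y_def by measurable
    show "0 < 1 / b n0" using b by simp
    fix k
    let ?n = "n0 * 2^k"
    define t where "t = 1 / b n0 / (3/2)^k * b ?n"
    have "0 \<le> t" "t \<le> 1" using b[of n0] b[of ?n] bk[of k] by (simp_all add: t_def field_simps)
    then have "1 - (h (t / b ?n))\<^sup>2 \<le> ln 16 / real ?n" by (intro decay) auto
    moreover have "t / b ?n = 1 / b n0 / (3/2)^k" using b[of ?n] by (simp add: t_def)
    ultimately have "expectation (\<lambda>\<omega>. 1 - cos (1 / b n0 / (3/2)^k * Y \<omega>)) \<le> ln 16 / real ?n"
      by (simp only: sym)
    then show "expectation (\<lambda>\<omega>. 1 - cos (1 / b n0 / (3/2)^k * Y \<omega>)) \<le> ln 16 / real n0 / 2^k"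
      by simp
  qed
  moreover have "indep_var borel (\<xi> 1) borel (\<xi> 2)"
  proof -
    have "indep_var (PiM {1} (\<lambda>_. borel)) (\<lambda>\<omega>. restrict (\<lambda>i. \<xi> i \<omega>) {1})
        (PiM {2} (\<lambda>_. borel)) (\<lambda>\<omega>. restrict (\<lambda>i. \<xi> i \<omega>) {2})"
      by (rule indep_var_restrict[OF ind]) auto
    moreover have m: "(\<lambda>f. f i) \<in> measurable (PiM {i} (\<lambda>_. borel)) (borel :: real measure)" for i :: nat
      by (rule measurable_component_singleton) simp
    ultimately have ind12: "indep_var borel ((\<lambda>f. f 1) \<circ> (\<lambda>\<omega>. restrict (\<lambda>i. \<xi> i \<omega>) {1}))
        borel ((\<lambda>f. f 2) \<circ> (\<lambda>\<omega>. restrict (\<lambda>i. \<xi> i \<omega>) {2}))"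
      by (intro indep_var_compose[OF _ m m])
    have "(\<lambda>f. f i) \<circ> (\<lambda>\<omega>. restrict (\<lambda>i. \<xi> i \<omega>) {i}) = \<xi> i" for i
      by (simp add: fun_eq_iff)
    with ind12 show ?thesis by (simp only:)
  qed
  ultimately show ?thesis
    unfolding Y_def by (intro integrable_of_difference_integrable[of "\<xi> 1" "\<xi> 2"])
qed

section \<open>Samples with independent regressors and errors\<close>

text \<open>Finite-dimensional events belong to the \<open>\<sigma>\<close>-algebra generated by the whole sequence; this is how
  independence of two sequences is brought down to finitely many indices.\<close>

lemma sequence_vimage_INT:
  fixes X :: "nat \<Rightarrow> 'a \<Rightarrow> 'b::topological_space"
  assumes X: "(\<lambda>\<omega>. \<lambda>i\<in>{1..}. X i \<omega>) \<in> measurable M (\<Pi>\<^sub>M i\<in>{1..}. borel)"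
    and K: "finite K" "K \<noteq> {}" "K \<subseteq> {1..}" and A: "\<And>j. j \<in> K \<Longrightarrow> A j \<in> sets borel"
  shows "\<exists>E\<in>sets (\<Pi>\<^sub>M i\<in>{1..}. borel). (\<lambda>\<omega>. \<lambda>i\<in>{1..}. X i \<omega>) -` E \<inter> space M = (\<Inter>j\<in>K. X j -` A j \<inter> space M)"
proof
  let ?P = "\<Pi>\<^sub>M i\<in>{1::nat..}. (borel :: 'b measure)"
  let ?E = "{f \<in> space ?P. \<forall>j\<in>K. f j \<in> A j}"
  have "{f \<in> space ?P. f j \<in> A j} \<in> sets ?P" if j: "j \<in> K" for j
  proof -
    have "(\<lambda>f. f j) \<in> measurable ?P borel" using j K(3) by (intro measurable_component_singleton) auto
    from measurable_sets[OF this A[OF j]] show ?thesis by (simp add: vimage_def Int_def conj_commute)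
  qed
  then show "?E \<in> sets ?P" by (rule sets.sets_Collect_finite_All[OF _ K(1)])
  have "(\<lambda>i\<in>{1..}. X i \<omega>) \<in> ?E \<longleftrightarrow> (\<forall>j\<in>K. X j \<omega> \<in> A j)" if "\<omega> \<in> space M" for \<omega>
  proof -
    have "(\<lambda>i\<in>{1..}. X i \<omega>) j = X j \<omega>" if "j \<in> K" for j using that K(3) by auto
    then show ?thesis using measurable_space[OF X that] by simp
  qed
  then show "(\<lambda>\<omega>. \<lambda>i\<in>{1..}. X i \<omega>) -` ?E \<inter> space M = (\<Inter>j\<in>K. X j -` A j \<inter> space M)"
    using K(2) by (intro set_eqI) (simp only: Int_iff vimage_eq INT_iff, blast)
qed

text \<open>The errors form one sequence of pairs, since the two components may be correlated.  Integrability and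
  non-degeneracy are what the domain of attraction provides for the regressors.\<close>

locale structural_sample = prob_space M for M :: "'a measure" +
  fixes \<xi> :: "nat \<Rightarrow> 'a \<Rightarrow> real" and e :: "nat \<Rightarrow> 'a \<Rightarrow> real \<times> real"
  assumes xi_iid: "iid_on M borel {1..} \<xi>"
    and e_iid: "iid_on M borel {1..} e"
    and cross_indep: "independent_elements M (\<Pi>\<^sub>M i\<in>{1..}. borel) (\<lambda>\<omega>. \<lambda>i\<in>{1..}. \<xi> i \<omega>)
      (\<Pi>\<^sub>M i\<in>{1..}. borel) (\<lambda>\<omega>. \<lambda>i\<in>{1..}. e i \<omega>)"
    and xi_int: "integrable M (\<xi> 1)"
    and xi_nondegenerate: "\<not> (AE \<omega> in M. \<xi> 1 \<omega> = a)"
begin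

abbreviation xi_seq :: "'a \<Rightarrow> nat \<Rightarrow> real" where "xi_seq \<omega> \<equiv> (\<lambda>i\<in>{1..}. \<xi> i \<omega>)"
abbreviation e_seq :: "'a \<Rightarrow> nat \<Rightarrow> real \<times> real" where "e_seq \<omega> \<equiv> (\<lambda>i\<in>{1..}. e i \<omega>)"

lemma xi_rv [measurable]: "1 \<le> i \<Longrightarrow> \<xi> i \<in> borel_measurable M"
  by (rule iid_on_rv[OF xi_iid])

lemma e_rv [measurable]: "1 \<le> i \<Longrightarrow> e i \<in> borel_measurable M"
  by (rule iid_on_rv[OF e_iid])

lemma seq_measurable:
  "xi_seq \<in> measurable M (\<Pi>\<^sub>M i\<in>{1..}. borel)" "e_seq \<in> measurable M (\<Pi>\<^sub>M i\<in>{1..}. borel)"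
  using cross_indep by (simp_all add: independent_elements_def)

lemma prob_cross:
  assumes "A \<in> sets (\<Pi>\<^sub>M i\<in>{1..}. borel)" "B \<in> sets (\<Pi>\<^sub>M i\<in>{1..}. borel)"
  shows "prob ((xi_seq -` A \<inter> space M) \<inter> (e_seq -` B \<inter> space M)) =
    prob (xi_seq -` A \<inter> space M) * prob (e_seq -` B \<inter> space M)"
  using cross_indep assms unfolding independent_elements_def by (intro indep_setD) auto

lemma prob_cross_INT:
  assumes K: "finite K" "K \<noteq> {}" "K \<subseteq> {1..}"
    and A: "\<And>j. j \<in> K \<Longrightarrow> A j \<in> sets borel" and B: "\<And>j. j \<in> K \<Longrightarrow> B j \<in> sets borel"
  shows "prob ((\<Inter>j\<in>K. \<xi> j -` A j \<inter> space M) \<inter> (\<Inter>j\<in>K. e j -` B j \<inter> space M)) =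
    prob (\<Inter>j\<in>K. \<xi> j -` A j \<inter> space M) * prob (\<Inter>j\<in>K. e j -` B j \<inter> space M)"
proof -
  obtain E where E: "E \<in> sets (\<Pi>\<^sub>M i\<in>{1..}. borel)" "xi_seq -` E \<inter> space M = (\<Inter>j\<in>K. \<xi> j -` A j \<inter> space M)"
    using sequence_vimage_INT[of \<xi>, OF seq_measurable(1) K] A by (metis (no_types, lifting))
  obtain E' where E': "E' \<in> sets (\<Pi>\<^sub>M i\<in>{1..}. borel)" "e_seq -` E' \<inter> space M = (\<Inter>j\<in>K. e j -` B j \<inter> space M)"
    using sequence_vimage_INT[of e, OF seq_measurable(2) K] B by (metis (no_types, lifting))
  show ?thesis using prob_cross[OF E(1) E'(1)] unfolding E(2) E'(2) .
qed

lemma coordinate_measurable [measurable]: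
  "1 \<le> i \<Longrightarrow> (\<lambda>f. f i) \<in> borel_measurable (\<Pi>\<^sub>M i\<in>{1..}. borel)"
  by (rule measurable_component_singleton) simp

lemma cross_indep_var:
  assumes h: "h \<in> measurable (\<Pi>\<^sub>M i\<in>{1..}. borel) N1" and g: "g \<in> measurable (\<Pi>\<^sub>M i\<in>{1..}. borel) N2"
  shows "indep_var N1 (\<lambda>\<omega>. h (xi_seq \<omega>)) N2 (\<lambda>\<omega>. g (e_seq \<omega>))"
  unfolding indep_var_eq
proof (intro conjI indep_set_sigma_sets)
  have hm: "(\<lambda>\<omega>. h (xi_seq \<omega>)) \<in> measurable M N1" and gm: "(\<lambda>\<omega>. g (e_seq \<omega>)) \<in> measurable M N2"
    using measurable_compose[OF seq_measurable(1) h] measurable_compose[OF seq_measurable(2) g] by simp_all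
  then show "random_variable N1 (\<lambda>\<omega>. h (xi_seq \<omega>))" "random_variable N2 (\<lambda>\<omega>. g (e_seq \<omega>))" .
  have stable: "Int_stable {X -` A \<inter> space M |A. A \<in> sets N}" for X :: "'a \<Rightarrow> 'n" and N
  proof (rule Int_stableI)
    fix a b assume "a \<in> {X -` A \<inter> space M |A. A \<in> sets N}" "b \<in> {X -` A \<inter> space M |A. A \<in> sets N}"
    then obtain A B where "a = X -` A \<inter> space M" "b = X -` B \<inter> space M" "A \<in> sets N" "B \<in> sets N" by auto
    then have "a \<inter> b = X -` (A \<inter> B) \<inter> space M" "A \<inter> B \<in> sets N" by auto
    then show "a \<inter> b \<in> {X -` A \<inter> space M |A. A \<in> sets N}" by blast
  qed
  show "Int_stable {(\<lambda>\<omega>. h (xi_seq \<omega>)) -` A \<inter> space M |A. A \<in> sets N1}" by (rule stable)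
  show "Int_stable {(\<lambda>\<omega>. g (e_seq \<omega>)) -` A \<inter> space M |A. A \<in> sets N2}" by (rule stable)
  show "indep_set {(\<lambda>\<omega>. h (xi_seq \<omega>)) -` A \<inter> space M |A. A \<in> sets N1}
      {(\<lambda>\<omega>. g (e_seq \<omega>)) -` A \<inter> space M |A. A \<in> sets N2}"
    unfolding indep_sets2_eq
  proof (intro conjI ballI)
    show "{(\<lambda>\<omega>. h (xi_seq \<omega>)) -` A \<inter> space M |A. A \<in> sets N1} \<subseteq> events"
      using measurable_sets[OF hm] by auto
    show "{(\<lambda>\<omega>. g (e_seq \<omega>)) -` A \<inter> space M |A. A \<in> sets N2} \<subseteq> events"
      using measurable_sets[OF gm] by auto
    fix a b assume "a \<in> {(\<lambda>\<omega>. h (xi_seq \<omega>)) -` A \<inter> space M |A. A \<in> sets N1}"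
      "b \<in> {(\<lambda>\<omega>. g (e_seq \<omega>)) -` A \<inter> space M |A. A \<in> sets N2}"
    then obtain A B where AB: "A \<in> sets N1" "B \<in> sets N2"
      and a: "a = (\<lambda>\<omega>. h (xi_seq \<omega>)) -` A \<inter> space M" and b: "b = (\<lambda>\<omega>. g (e_seq \<omega>)) -` B \<inter> space M" by auto
    let ?P = "\<Pi>\<^sub>M i\<in>{1::nat..}. (borel :: real measure)" and ?R = "\<Pi>\<^sub>M i\<in>{1::nat..}. (borel :: (real \<times> real) measure)"
    have "a = xi_seq -` (h -` A \<inter> space ?P) \<inter> space M"
      using measurable_space[OF seq_measurable(1)] unfolding a by blast
    moreover have "b = e_seq -` (g -` B \<inter> space ?R) \<inter> space M"
      using measurable_space[OF seq_measurable(2)] unfolding b by blast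
    ultimately show "prob (a \<inter> b) = prob a * prob b"
      using prob_cross[OF measurable_sets[OF h AB(1)] measurable_sets[OF g AB(2)]] by (simp only:)
  qed
qed

lemma cross_expectation:
  fixes h :: "(nat \<Rightarrow> real) \<Rightarrow> real" and g :: "(nat \<Rightarrow> real \<times> real) \<Rightarrow> real"
  assumes h: "h \<in> borel_measurable (\<Pi>\<^sub>M i\<in>{1..}. borel)" and g: "g \<in> borel_measurable (\<Pi>\<^sub>M i\<in>{1..}. borel)"
    and int: "integrable M (\<lambda>\<omega>. h (xi_seq \<omega>))" "integrable M (\<lambda>\<omega>. g (e_seq \<omega>))"
  shows "integrable M (\<lambda>\<omega>. h (xi_seq \<omega>) * g (e_seq \<omega>))"
    and "expectation (\<lambda>\<omega>. h (xi_seq \<omega>) * g (e_seq \<omega>)) = expectation (\<lambda>\<omega>. h (xi_seq \<omega>)) * expectation (\<lambda>\<omega>. g (e_seq \<omega>))"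
  using indep_var_integrable[OF cross_indep_var[OF h g] int] indep_var_lebesgue_integral[OF cross_indep_var[OF h g] int]
  by simp_all

text \<open>Rectangles \<open>\<xi> i \<in> A, e i \<in> B\<close> form an intersection-stable generator of the events of \<open>(\<xi> i, e i)\<close>, and for
  them the product formula follows from the independence of the two sequences and of the variables within each of them.\<close>

lemma joint_iid: "iid_on M (borel \<Otimes>\<^sub>M borel) {1..} (\<lambda>i \<omega>. (\<xi> i \<omega>, e i \<omega>))"
  unfolding iid_on_def
proof (intro conjI ballI)
  define F where "F i = {\<xi> i -` A \<inter> e i -` B \<inter> space M | A B. A \<in> sets borel \<and> B \<in> sets borel}" for i
  have F_sub: "F i \<subseteq> events" if "1 \<le> i" for i
  proof
    fix b assume "b \<in> F i"
    then obtain A B where AB: "A \<in> sets borel" "B \<in> sets borel" and "b = \<xi> i -` A \<inter> e i -` B \<inter> space M"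
      unfolding F_def by blast
    then have b: "b = (\<xi> i -` A \<inter> space M) \<inter> (e i -` B \<inter> space M)" by blast
    show "b \<in> events"
      unfolding b using AB by (intro sets.Int measurable_sets[OF xi_rv[OF that]] measurable_sets[OF e_rv[OF that]])
  qed
  have F_indep: "indep_sets F {1..}"
  proof (rule indep_setsI)
    fix b J assume J: "J \<noteq> {}" "J \<subseteq> {1::nat..}" "finite J" and b: "\<forall>j\<in>J. b j \<in> F j"
    have "\<exists>A B. b j = \<xi> j -` A \<inter> e j -` B \<inter> space M \<and> A \<in> sets borel \<and> B \<in> sets borel" if "j \<in> J" for j
      using bspec[OF b that] unfolding F_def by (rule CollectD)
    then obtain A B where "\<And>j. j \<in> J \<Longrightarrow> b j = \<xi> j -` A j \<inter> e j -` B j \<inter> space M \<and> A j \<in> sets borel \<and> B j \<in> sets borel"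
      by metis
    then have bj0: "\<And>j. j \<in> J \<Longrightarrow> b j = \<xi> j -` A j \<inter> e j -` B j \<inter> space M"
      and A: "\<And>j. j \<in> J \<Longrightarrow> A j \<in> sets borel" and B: "\<And>j. j \<in> J \<Longrightarrow> B j \<in> sets borel" by simp_all
    have bj: "b j = (\<xi> j -` A j \<inter> space M) \<inter> (e j -` B j \<inter> space M)" if "j \<in> J" for j
      using bj0[OF that] by blast
    have single: "prob (b j) = prob (\<xi> j -` A j \<inter> space M) * prob (e j -` B j \<inter> space M)" if "j \<in> J" for j
      using prob_cross_INT[of "{j}" A B] J(2) that A B unfolding bj[OF that] by auto
    have "(\<Inter>j\<in>J. b j) = (\<Inter>j\<in>J. \<xi> j -` A j \<inter> space M) \<inter> (\<Inter>j\<in>J. e j -` B j \<inter> space M)"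
      unfolding INT_Int_distrib[symmetric] by (intro INF_cong refl bj)
    also have "prob \<dots> = prob (\<Inter>j\<in>J. \<xi> j -` A j \<inter> space M) * prob (\<Inter>j\<in>J. e j -` B j \<inter> space M)"
      by (rule prob_cross_INT[OF J(3,1,2) A B])
    also have "\<dots> = (\<Prod>j\<in>J. prob (\<xi> j -` A j \<inter> space M)) * (\<Prod>j\<in>J. prob (e j -` B j \<inter> space M))"
      using indep_varsD[OF iid_onD(1)[OF xi_iid] J(1,3,2) A] indep_varsD[OF iid_onD(1)[OF e_iid] J(1,3,2) B]
      by (simp only:)
    also have "\<dots> = (\<Prod>j\<in>J. prob (b j))" by (simp add: single prod.distrib)
    finally show "prob (\<Inter>j\<in>J. b j) = (\<Prod>j\<in>J. prob (b j))" .
  qed (use F_sub in auto)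
  have F_stable: "Int_stable (F i)" for i
  proof (rule Int_stableI)
    fix a b assume "a \<in> F i" "b \<in> F i"
    then obtain A B A' B' where "A \<in> sets borel" "B \<in> sets borel" "A' \<in> sets borel" "B' \<in> sets borel"
      "a = \<xi> i -` A \<inter> e i -` B \<inter> space M" "b = \<xi> i -` A' \<inter> e i -` B' \<inter> space M" by (auto simp: F_def)
    then have "a \<inter> b = \<xi> i -` (A \<inter> A') \<inter> e i -` (B \<inter> B') \<inter> space M" "A \<inter> A' \<in> sets borel" "B \<inter> B' \<in> sets borel"
      by auto
    then show "a \<inter> b \<in> F i" unfolding F_def by blast
  qed
  show "indep_vars (\<lambda>_. borel \<Otimes>\<^sub>M borel) (\<lambda>i \<omega>. (\<xi> i \<omega>, e i \<omega>)) {1..}"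
    unfolding indep_vars_def2
  proof (intro conjI ballI)
    show "indep_sets (\<lambda>i. {(\<lambda>\<omega>. (\<xi> i \<omega>, e i \<omega>)) -` C \<inter> space M |C. C \<in> sets (borel \<Otimes>\<^sub>M borel)}) {1..}"
    proof (rule indep_sets_mono_sets[OF indep_sets_sigma[OF F_indep F_stable]])
      fix i :: nat assume "i \<in> {1..}"
      let ?S = "sigma (space M) (F i)"
      have FP: "F i \<subseteq> Pow (space M)" by (auto simp: F_def)
      have "\<xi> i \<in> measurable ?S borel" "e i \<in> measurable ?S borel"
      proof -
        have "\<xi> i -` A \<inter> space M \<in> F i" if "A \<in> sets borel" for A
          unfolding F_def using that by (intro CollectI exI[of _ A] exI[of _ UNIV]) auto
        then show "\<xi> i \<in> measurable ?S borel" 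
          by (intro measurableI) (simp_all add: space_measure_of[OF FP] sets_measure_of[OF FP] sigma_sets.Basic)
        have "e i -` B \<inter> space M \<in> F i" if "B \<in> sets borel" for B
          unfolding F_def using that by (intro CollectI exI[of _ UNIV] exI[of _ B]) auto
        then show "e i \<in> measurable ?S borel" 
          by (intro measurableI) (simp_all add: space_measure_of[OF FP] sets_measure_of[OF FP] sigma_sets.Basic)
      qed
      then have "(\<lambda>\<omega>. (\<xi> i \<omega>, e i \<omega>)) \<in> measurable ?S (borel \<Otimes>\<^sub>M borel)" by (rule measurable_Pair)
      from measurable_sets[OF this]
      show "{(\<lambda>\<omega>. (\<xi> i \<omega>, e i \<omega>)) -` C \<inter> space M |C. C \<in> sets (borel \<Otimes>\<^sub>M borel)} \<subseteq> sigma_sets (space M) (F i)"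
        unfolding space_measure_of[OF FP] sets_measure_of[OF FP] by blast
    qed
  qed simp
  \<comment> \<open>The joint law of independent variables is the product of their laws; for this, both have to take values
    in the same type, so \<open>\<xi> i\<close> is replaced with the pair \<open>(\<xi> i, 0)\<close>.\<close>
  define i0 :: "real \<Rightarrow> real \<times> real" where "i0 x = (x, 0)" for x
  have [measurable]: "i0 \<in> borel_measurable borel"
    unfolding i0_def by (intro borel_measurable_continuous_onI continuous_intros)
  have [measurable]: "(fst :: real \<times> real \<Rightarrow> real) \<in> borel_measurable borel"
    by (intro borel_measurable_continuous_onI continuous_intros)
  have law: "distr M (borel \<Otimes>\<^sub>M borel) (\<lambda>\<omega>. (\<xi> i \<omega>, e i \<omega>)) =
      distr (distr (distr M borel (\<xi> i)) borel i0 \<Otimes>\<^sub>M distr M borel (e i)) (borel \<Otimes>\<^sub>M borel) (\<lambda>z. (fst (fst z), snd z))"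
    if i: "1 \<le> i" for i
  proof -
    have [measurable]: "\<xi> i \<in> borel_measurable M" "e i \<in> borel_measurable M" using i by (rule xi_rv, rule e_rv)
    have "indep_var borel (\<lambda>\<omega>. i0 (xi_seq \<omega> i)) borel (\<lambda>\<omega>. e_seq \<omega> i)"
      using i by (intro cross_indep_var[of "\<lambda>f. i0 (f i)" borel "\<lambda>f. f i"] coordinate_measurable
          measurable_compose[OF coordinate_measurable]) auto
    then have "indep_var borel (\<lambda>\<omega>. i0 (\<xi> i \<omega>)) borel (e i)" using i by simp
    then have "distr M borel (\<lambda>\<omega>. i0 (\<xi> i \<omega>)) \<Otimes>\<^sub>M distr M borel (e i) = distr M (borel \<Otimes>\<^sub>M borel) (\<lambda>\<omega>. (i0 (\<xi> i \<omega>), e i \<omega>))"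
      by (simp add: indep_var_distribution_eq)
    moreover have "distr (distr M borel (\<xi> i)) borel i0 = distr M borel (\<lambda>\<omega>. i0 (\<xi> i \<omega>))"
      by (subst distr_distr) (auto simp: comp_def)
    moreover have "distr (distr M (borel \<Otimes>\<^sub>M borel) (\<lambda>\<omega>. (i0 (\<xi> i \<omega>), e i \<omega>))) (borel \<Otimes>\<^sub>M borel) (\<lambda>z. (fst (fst z), snd z))
        = distr M (borel \<Otimes>\<^sub>M borel) (\<lambda>\<omega>. (\<xi> i \<omega>, e i \<omega>))"
      by (subst distr_distr) (auto simp: comp_def i0_def)
    ultimately show ?thesis by simp
  qed
  fix i k :: nat assume "i \<in> {1..}" "k \<in> {1..}"
  then have ik: "1 \<le> i" "1 \<le> k" by auto
  show "distr M (borel \<Otimes>\<^sub>M borel) (\<lambda>\<omega>. (\<xi> i \<omega>, e i \<omega>)) = distr M (borel \<Otimes>\<^sub>M borel) (\<lambda>\<omega>. (\<xi> k \<omega>, e k \<omega>))"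
    unfolding law[OF ik(1)] law[OF ik(2)] iid_onD(2)[OF xi_iid ik(1)] iid_onD(2)[OF xi_iid ik(2)]
      iid_onD(2)[OF e_iid ik(1)] iid_onD(2)[OF e_iid ik(2)] ..
qed

text \<open>The yardstick of the whole analysis: in probability, this converges to \<open>E \<xi>\<^sup>2\<close> or grows beyond all
  bounds, and in both cases the other sample moments are compared with it.\<close>

definition mean_sq :: "nat \<times> 'a \<Rightarrow> real" where
  "mean_sq p = avg (fst p) (\<lambda>i. (\<xi> i (snd p))\<^sup>2)"

lemma mean_sq_nonneg: "0 \<le> mean_sq p"
  unfolding mean_sq_def by (rule avg_nonneg) simp

lemma mean_sq_measurable [measurable]: "(\<lambda>\<omega>. mean_sq (n, \<omega>)) \<in> borel_measurable M"
  unfolding mean_sq_def avg_def fst_conv snd_conv by measurable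

lemma weight_bound:
  assumes "1 \<le> i" "i \<le> n" "1 \<le> k" "k \<le> n"
  shows "\<bar>\<xi> i \<omega> * \<xi> k \<omega> / mean_sq (n, \<omega>)\<bar> \<le> real n"
proof (cases "mean_sq (n, \<omega>) = 0")
  case False
  with mean_sq_nonneg[of "(n, \<omega>)"] have pos: "mean_sq (n, \<omega>) > 0" by simp
  have le: "(\<xi> l \<omega>)\<^sup>2 \<le> real n * mean_sq (n, \<omega>)" if "1 \<le> l" "l \<le> n" for l
  proof -
    have "(\<xi> l \<omega>)\<^sup>2 \<le> (\<Sum>i=1..n. (\<xi> i \<omega>)\<^sup>2)"
      using that by (intro member_le_sum) auto
    also have "\<dots> = real n * mean_sq (n, \<omega>)" using that by (simp add: mean_sq_def avg_def)
    finally show ?thesis .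
  qed
  have "2 * (\<bar>\<xi> i \<omega>\<bar> * \<bar>\<xi> k \<omega>\<bar>) \<le> (\<xi> i \<omega>)\<^sup>2 + (\<xi> k \<omega>)\<^sup>2"
    using sum_squares_bound[of "\<bar>\<xi> i \<omega>\<bar>" "\<bar>\<xi> k \<omega>\<bar>"] by simp
  then have "\<bar>\<xi> i \<omega> * \<xi> k \<omega>\<bar> \<le> real n * mean_sq (n, \<omega>)"
    using le[OF assms(1,2)] le[OF assms(3,4)] unfolding abs_mult by linarith
  then show ?thesis using pos by (simp add: field_simps)
qed simp

text \<open>The weights depend on the regressors only and are bounded, so the expectation factorizes whatever
  the tails of \<open>\<xi>\<close> are.\<close>

lemma weighted_product:
  assumes ik: "1 \<le> i" "i \<le> n" "1 \<le> k" "k \<le> n"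
    and g: "g \<in> borel_measurable borel" and int: "integrable M (\<lambda>\<omega>. g (e i \<omega>) * g (e k \<omega>))"
  shows "integrable M (\<lambda>\<omega>. \<xi> i \<omega> * \<xi> k \<omega> / mean_sq (n, \<omega>))" (is ?I1)
    and "integrable M (\<lambda>\<omega>. \<xi> i \<omega> * \<xi> k \<omega> / mean_sq (n, \<omega>) * (g (e i \<omega>) * g (e k \<omega>)))" (is ?I2)
    and "expectation (\<lambda>\<omega>. \<xi> i \<omega> * \<xi> k \<omega> / mean_sq (n, \<omega>) * (g (e i \<omega>) * g (e k \<omega>))) =
      expectation (\<lambda>\<omega>. \<xi> i \<omega> * \<xi> k \<omega> / mean_sq (n, \<omega>)) * expectation (\<lambda>\<omega>. g (e i \<omega>) * g (e k \<omega>))" (is ?E)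
proof -
  define h where "h f = f i * f k / avg n (\<lambda>l. (f l)\<^sup>2)" for f :: "nat \<Rightarrow> real"
  define G where "G f = g (f i) * g (f k)" for f :: "nat \<Rightarrow> real \<times> real"
  have hm: "h \<in> borel_measurable (\<Pi>\<^sub>M i\<in>{1..}. borel)"
    unfolding h_def avg_def using ik
    by (intro borel_measurable_divide borel_measurable_times borel_measurable_sum borel_measurable_power
        coordinate_measurable borel_measurable_const) auto
  have Gm: "G \<in> borel_measurable (\<Pi>\<^sub>M i\<in>{1..}. borel)"
    unfolding G_def using ik
    by (intro borel_measurable_times measurable_compose[OF coordinate_measurable g])
  have h_eq: "h (xi_seq \<omega>) = \<xi> i \<omega> * \<xi> k \<omega> / mean_sq (n, \<omega>)" for \<omega>
    using ik by (simp add: h_def mean_sq_def avg_def)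
  have G_eq: "G (e_seq \<omega>) = g (e i \<omega>) * g (e k \<omega>)" for \<omega>
    using ik by (simp add: G_def)
  show I1: ?I1
    using ik by (intro integrable_const_bound[where B="real n"] AE_I2) (simp_all add: weight_bound del: abs_mult abs_divide)
  show ?I2 ?E
    using cross_expectation[OF hm Gm] I1 int unfolding h_eq G_eq by blast+
qed

lemma weights_sum_le: "(\<Sum>i=1..n. expectation (\<lambda>\<omega>. \<xi> i \<omega> * \<xi> i \<omega> / mean_sq (n, \<omega>))) \<le> real n"
proof -
  have I: "integrable M (\<lambda>\<omega>. \<xi> i \<omega> * \<xi> i \<omega> / mean_sq (n, \<omega>))" if "i \<in> {1..n}" for i
    using that by (intro weighted_product(1)[where g="\<lambda>_. 1"]) auto
  have "(\<Sum>i=1..n. expectation (\<lambda>\<omega>. \<xi> i \<omega> * \<xi> i \<omega> / mean_sq (n, \<omega>))) =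
      expectation (\<lambda>\<omega>. \<Sum>i=1..n. \<xi> i \<omega> * \<xi> i \<omega> / mean_sq (n, \<omega>))"
    by (rule Bochner_Integration.integral_sum[symmetric, OF I])
  also have "\<dots> \<le> expectation (\<lambda>_. real n)"
  proof (intro integral_mono Bochner_Integration.integrable_sum I integrable_const)
    fix \<omega>
    have "(\<Sum>i=1..n. \<xi> i \<omega> * \<xi> i \<omega> / mean_sq (n, \<omega>)) = real n * mean_sq (n, \<omega>) / mean_sq (n, \<omega>)"
      unfolding sum_divide_distrib[symmetric]
      by (cases "n = 0") (simp_all add: mean_sq_def avg_def power2_eq_square)
    then show "(\<Sum>i=1..n. \<xi> i \<omega> * \<xi> i \<omega> / mean_sq (n, \<omega>)) \<le> real n" by simp
  qed
  finally show ?thesis by (simp add: prob_space)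
qed

text \<open>Given the regressors, \<open>\<xi> i * g (e i)\<close> has conditional variance \<open>(\<xi> i)\<^sup>2 E g\<^sup>2\<close>; dividing by the root of
  \<open>mean_sq\<close> therefore leaves a second moment of at most \<open>E g\<^sup>2\<close>, even if \<open>\<xi>\<close> has infinite variance.\<close>

lemma bdd_in_prob_weighted_avg:
  assumes g [measurable]: "g \<in> borel_measurable borel"
    and int2: "integrable M (\<lambda>\<omega>. (g (e 1 \<omega>))\<^sup>2)" and mean: "expectation (\<lambda>\<omega>. g (e 1 \<omega>)) = 0"
  shows "bdd_in_prob M (\<lambda>p. sqrt (real (fst p)) * avg (fst p) (\<lambda>i. \<xi> i (snd p) * g (e i (snd p))) / sqrt (mean_sq p))"
proof -
  define v where "v = expectation (\<lambda>\<omega>. (g (e 1 \<omega>))\<^sup>2)"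
  have int: "integrable M (\<lambda>\<omega>. g (e 1 \<omega>))"
    by (rule square_integrable_imp_integrable[OF _ int2]) simp
  have sq: "integrable M (\<lambda>\<omega>. g (e i \<omega>) * g (e i \<omega>))" "expectation (\<lambda>\<omega>. g (e i \<omega>) * g (e i \<omega>)) = v" if "1 \<le> i" for i
    using iid_moments[OF e_iid _ that, of "\<lambda>x. (g x)\<^sup>2"] int2 by (auto simp: v_def power2_eq_square)
  have v0: "0 \<le> v" unfolding v_def by (rule Bochner_Integration.integral_nonneg) simp
  show ?thesis
  proof (rule bdd_in_prob_L2, unfold fst_conv snd_conv)
    fix n
    define X where "X i \<omega> = \<xi> i \<omega> / sqrt (mean_sq (n, \<omega>)) * g (e i \<omega>)" for i \<omega>
    have XX: "X i \<omega> * X k \<omega> = \<xi> i \<omega> * \<xi> k \<omega> / mean_sq (n, \<omega>) * (g (e i \<omega>) * g (e k \<omega>))" for i k \<omega>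
    proof -
      have "sqrt (mean_sq (n, \<omega>)) * sqrt (mean_sq (n, \<omega>)) = mean_sq (n, \<omega>)"
        using mean_sq_nonneg by simp
      then show ?thesis by (simp add: X_def)
    qed
    have Xm: "X i \<in> borel_measurable M" if "i \<in> {1..n}" for i
    proof -
      have [measurable]: "\<xi> i \<in> borel_measurable M" "e i \<in> borel_measurable M"
        using that by (auto intro: xi_rv e_rv)
      show ?thesis unfolding X_def by measurable
    qed
    have eq: "(sqrt (real n) * avg n (\<lambda>i. \<xi> i \<omega> * g (e i \<omega>)) / sqrt (mean_sq (n, \<omega>)))\<^sup>2 = (\<Sum>i=1..n. X i \<omega>)\<^sup>2 / real n" for \<omega>
    proof -
      have "(\<Sum>i=1..n. X i \<omega>) = (\<Sum>i=1..n. \<xi> i \<omega> * g (e i \<omega>)) / sqrt (mean_sq (n, \<omega>))"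
        unfolding sum_divide_distrib by (simp add: X_def)
      then show ?thesis
        by (cases "n = 0") (simp_all add: avg_def power_mult_distrib power_divide power2_eq_square[of "real n"])
    qed
    have X2: "integrable M (\<lambda>\<omega>. (X i \<omega>)\<^sup>2)"
      "expectation (\<lambda>\<omega>. (X i \<omega>)\<^sup>2) = expectation (\<lambda>\<omega>. \<xi> i \<omega> * \<xi> i \<omega> / mean_sq (n, \<omega>)) * v" if "i \<in> {1..n}" for i
    proof -
      have i: "1 \<le> i" "i \<le> n" using that by auto
      note w = weighted_product[OF i i g sq(1)[OF i(1)]]
      show "integrable M (\<lambda>\<omega>. (X i \<omega>)\<^sup>2)" unfolding power2_eq_square XX by (rule w(2))
      show "expectation (\<lambda>\<omega>. (X i \<omega>)\<^sup>2) = expectation (\<lambda>\<omega>. \<xi> i \<omega> * \<xi> i \<omega> / mean_sq (n, \<omega>)) * v"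
        unfolding power2_eq_square XX w(3) sq(2)[OF i(1)] ..
    qed
    have orth: "expectation (\<lambda>\<omega>. X i \<omega> * X k \<omega>) = 0" if "i \<in> {1..n}" "k \<in> {1..n}" "i \<noteq> k" for i k
    proof -
      have i: "1 \<le> i" "i \<le> n" and k: "1 \<le> k" "k \<le> n" using that by auto
      note o = iid_centered_orthogonal[OF e_iid g int mean i(1) k(1) that(3)]
      show ?thesis unfolding XX weighted_product(3)[OF i k g o(1)] o(2) by simp
    qed
    have s: "integrable M (\<lambda>\<omega>. (\<Sum>i=1..n. X i \<omega>)\<^sup>2)"
      "expectation (\<lambda>\<omega>. (\<Sum>i=1..n. X i \<omega>)\<^sup>2) = (\<Sum>i=1..n. expectation (\<lambda>\<omega>. (X i \<omega>)\<^sup>2))"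
      by (rule second_moment_sum_orthogonal[OF finite_atLeastAtMost Xm X2(1) orth]; assumption)+
    show "integrable M (\<lambda>\<omega>. (sqrt (real n) * avg n (\<lambda>i. \<xi> i \<omega> * g (e i \<omega>)) / sqrt (mean_sq (n, \<omega>)))\<^sup>2)"
      unfolding eq using s(1) by (rule integrable_divide_zero)
    have "expectation (\<lambda>\<omega>. (\<Sum>i=1..n. X i \<omega>)\<^sup>2) = (\<Sum>i=1..n. expectation (\<lambda>\<omega>. \<xi> i \<omega> * \<xi> i \<omega> / mean_sq (n, \<omega>)) * v)"
      unfolding s(2) by (intro sum.cong refl X2(2))
    also have "\<dots> = (\<Sum>i=1..n. expectation (\<lambda>\<omega>. \<xi> i \<omega> * \<xi> i \<omega> / mean_sq (n, \<omega>))) * v"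
      by (rule sum_distrib_right[symmetric])
    also have "\<dots> \<le> real n * v" by (rule mult_right_mono[OF weights_sum_le v0])
    finally have "expectation (\<lambda>\<omega>. (\<Sum>i=1..n. X i \<omega>)\<^sup>2) / real n \<le> real n * v / real n"
      by (rule divide_right_mono) simp
    also have "\<dots> \<le> v" using v0 by (cases "n = 0") simp_all
    finally show "expectation (\<lambda>\<omega>. (sqrt (real n) * avg n (\<lambda>i. \<xi> i \<omega> * g (e i \<omega>)) / sqrt (mean_sq (n, \<omega>)))\<^sup>2) \<le> v"
      unfolding eq by simp
  qed
qed

lemma bdd_in_prob_weighted_squares:
  assumes g [measurable]: "g \<in> borel_measurable borel"
    and int2: "integrable M (\<lambda>\<omega>. (g (e 1 \<omega>))\<^sup>2)"
  shows "bdd_in_prob M (\<lambda>p. avg (fst p) (\<lambda>i. (\<xi> i (snd p))\<^sup>2 * (g (e i (snd p)))\<^sup>2) / mean_sq p)"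
proof -
  define v where "v = expectation (\<lambda>\<omega>. (g (e 1 \<omega>))\<^sup>2)"
  have sq: "integrable M (\<lambda>\<omega>. g (e i \<omega>) * g (e i \<omega>))" "expectation (\<lambda>\<omega>. g (e i \<omega>) * g (e i \<omega>)) = v" if "1 \<le> i" for i
    using iid_moments[OF e_iid _ that, of "\<lambda>x. (g x)\<^sup>2"] int2 by (auto simp: v_def power2_eq_square)
  have v0: "0 \<le> v" unfolding v_def by (rule Bochner_Integration.integral_nonneg) simp
  show ?thesis
  proof (rule bdd_in_prob_L1, unfold fst_conv snd_conv)
    fix n
    let ?X = "\<lambda>i \<omega>. \<xi> i \<omega> * \<xi> i \<omega> / mean_sq (n, \<omega>) * (g (e i \<omega>) * g (e i \<omega>))"
    have eq: "avg n (\<lambda>i. (\<xi> i \<omega>)\<^sup>2 * (g (e i \<omega>))\<^sup>2) / mean_sq (n, \<omega>) = (\<Sum>i=1..n. ?X i \<omega>) / real n" for \<omega>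
      unfolding avg_def sum_divide_distrib by (simp add: power2_eq_square mult.commute)
    have w: "integrable M (?X i)" "expectation (?X i) = expectation (\<lambda>\<omega>. \<xi> i \<omega> * \<xi> i \<omega> / mean_sq (n, \<omega>)) * v"
      if "i \<in> {1..n}" for i
    proof -
      have i: "1 \<le> i" "i \<le> n" using that by auto
      note w = weighted_product[OF i i g sq(1)[OF i(1)]]
      show "integrable M (?X i)" by (rule w(2))
      show "expectation (?X i) = expectation (\<lambda>\<omega>. \<xi> i \<omega> * \<xi> i \<omega> / mean_sq (n, \<omega>)) * v"
        unfolding w(3) sq(2)[OF i(1)] ..
    qed
    show "integrable M (\<lambda>\<omega>. avg n (\<lambda>i. (\<xi> i \<omega>)\<^sup>2 * (g (e i \<omega>))\<^sup>2) / mean_sq (n, \<omega>))"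
      unfolding eq by (intro integrable_divide_zero Bochner_Integration.integrable_sum w(1))
    have "expectation (\<lambda>\<omega>. \<Sum>i=1..n. ?X i \<omega>) = (\<Sum>i=1..n. expectation (?X i))"
      by (rule Bochner_Integration.integral_sum[OF w(1)])
    also have "\<dots> = (\<Sum>i=1..n. expectation (\<lambda>\<omega>. \<xi> i \<omega> * \<xi> i \<omega> / mean_sq (n, \<omega>)) * v)"
      by (intro sum.cong refl w(2))
    also have "\<dots> = (\<Sum>i=1..n. expectation (\<lambda>\<omega>. \<xi> i \<omega> * \<xi> i \<omega> / mean_sq (n, \<omega>))) * v"
      by (rule sum_distrib_right[symmetric])
    also have "\<dots> \<le> real n * v" by (rule mult_right_mono[OF weights_sum_le v0])
    finally have "expectation (\<lambda>\<omega>. \<Sum>i=1..n. ?X i \<omega>) / real n \<le> real n * v / real n"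
      by (rule divide_right_mono) simp
    also have "\<dots> \<le> v" using v0 by (cases "n = 0") simp_all
    moreover have "\<bar>avg n (\<lambda>i. (\<xi> i \<omega>)\<^sup>2 * (g (e i \<omega>))\<^sup>2) / mean_sq (n, \<omega>)\<bar> = (\<Sum>i=1..n. ?X i \<omega>) / real n" for \<omega>
    proof -
      have "0 \<le> avg n (\<lambda>i. (\<xi> i \<omega>)\<^sup>2 * (g (e i \<omega>))\<^sup>2) / mean_sq (n, \<omega>)"
        by (intro divide_nonneg_nonneg avg_nonneg mean_sq_nonneg) simp
      then show ?thesis using eq by (simp only: abs_of_nonneg)
    qed
    ultimately show "expectation (\<lambda>\<omega>. \<bar>avg n (\<lambda>i. (\<xi> i \<omega>)\<^sup>2 * (g (e i \<omega>))\<^sup>2) / mean_sq (n, \<omega>)\<bar>) \<le> v"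
      by simp
  qed
qed

end

section \<open>Limits of the second moments of the sample\<close>

lemma tendsto_avg_sum_null:
  assumes "((\<lambda>t. avg (fst t) (\<lambda>i. (f t i)\<^sup>2)) \<longlongrightarrow> 0) F" "((\<lambda>t. avg (fst t) (\<lambda>i. (g t i)\<^sup>2)) \<longlongrightarrow> 0) F"
  shows "((\<lambda>t. avg (fst t) (\<lambda>i. (f t i + g t i)\<^sup>2)) \<longlongrightarrow> 0) F"
proof -
  have "((\<lambda>t. avg (fst t) (\<lambda>i. (f t i)\<^sup>2) + 2 * avg (fst t) (\<lambda>i. f t i * g t i) + avg (fst t) (\<lambda>i. (g t i)\<^sup>2))
      \<longlongrightarrow> 0 + 2 * 0 + 0) F"
    by (intro tendsto_intros assms tendsto_avg_product_zero[OF assms(1) assms(2)])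
  moreover have "avg n (\<lambda>i. (a i + b i)\<^sup>2) = avg n (\<lambda>i. (a i)\<^sup>2) + 2 * avg n (\<lambda>i. a i * b i) + avg n (\<lambda>i. (b i)\<^sup>2)"
    for n and a b :: "nat \<Rightarrow> real"
    unfolding power2_sum by (simp add: avg_add avg_cmult[symmetric] mult.assoc)
  ultimately show ?thesis by simp
qed

lemma tendsto_avg_scaled_null:
  assumes "((\<lambda>t. (s t)\<^sup>2 * avg (fst t) (\<lambda>i. (f t i)\<^sup>2)) \<longlongrightarrow> 0) F"
  shows "((\<lambda>t. avg (fst t) (\<lambda>i. (s t * f t i)\<^sup>2)) \<longlongrightarrow> 0) F"
  using assms by (simp add: power_mult_distrib avg_cmult)

lemma tendsto_avg_scalar_null:
  assumes "(s \<longlongrightarrow> 0) (in_prob M)"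
  shows "((\<lambda>t. avg (fst t) (\<lambda>i. (s t)\<^sup>2)) \<longlongrightarrow> (0::real)) (in_prob M)"
proof (rule Lim_null_comparison)
  have "((\<lambda>t. (s t)\<^sup>2) \<longlongrightarrow> 0\<^sup>2) (in_prob M)" by (intro tendsto_intros assms)
  then show "((\<lambda>t. (s t)\<^sup>2) \<longlongrightarrow> 0) (in_prob M)" by simp
  show "\<forall>\<^sub>F t in in_prob M. norm (avg (fst t) (\<lambda>i. (s t)\<^sup>2)) \<le> (s t)\<^sup>2"
    by (intro always_eventually allI) (simp add: avg_def)
qed

lemma avg_squares_le: "avg n (\<lambda>i. (a i)\<^sup>2) / real n \<le> (avg n a)\<^sup>2" if "\<And>i. 0 \<le> a i"
proof -
  have "(\<Sum>i=1..n. (a i)\<^sup>2) \<le> (\<Sum>i=1..n. a i * (\<Sum>k=1..n. a k))"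
    unfolding power2_eq_square using that by (intro sum_mono mult_left_mono member_le_sum) auto
  also have "\<dots> = (\<Sum>i=1..n. a i)\<^sup>2" by (simp add: power2_eq_square sum_distrib_right)
  finally have "(\<Sum>i=1..n. (a i)\<^sup>2) / (real n)\<^sup>2 \<le> (\<Sum>i=1..n. a i)\<^sup>2 / (real n)\<^sup>2"
    by (rule divide_right_mono) simp
  then show ?thesis by (simp add: avg_def power_divide power2_eq_square)
qed

text \<open>Because \<open>c * c = c\<close>.\<close>

lemma S_eq:
  assumes "c = 0 \<or> c = 1"
  shows "S c n u v = avg n (\<lambda>i. u i * v i) - c * avg n u * avg n v"
proof (cases "n = 0")
  case False
  have "S c n u v = avg n (\<lambda>i. u i * v i - c * avg n v * u i - c * avg n u * v i + c * c * avg n u * avg n v)"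
    unfolding S_def cross_def by (simp add: algebra_simps)
  also have "\<dots> = avg n (\<lambda>i. u i * v i) - c * avg n v * avg n u - c * avg n u * avg n v + c * c * avg n u * avg n v"
    using False by (simp add: avg_add avg_diff avg_cmult avg_const)
  finally show ?thesis using assms by auto
qed (simp add: S_def avg_def)

context structural_sample
begin

lemma mean_sq_tendsto:
  assumes "integrable M (\<lambda>\<omega>. (\<xi> 1 \<omega>)\<^sup>2)"
  shows "(mean_sq \<longlongrightarrow> expectation (\<lambda>\<omega>. (\<xi> 1 \<omega>)\<^sup>2)) (in_prob M)"
  using weak_law_iid[OF xi_iid, of "\<lambda>x. x\<^sup>2"] assms unfolding mean_sq_def by simp

lemma xi_second_moment_gt:
  assumes "integrable M (\<lambda>\<omega>. (\<xi> 1 \<omega>)\<^sup>2)"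
  shows "(expectation (\<xi> 1))\<^sup>2 < expectation (\<lambda>\<omega>. (\<xi> 1 \<omega>)\<^sup>2)"
proof -
  let ?m = "expectation (\<xi> 1)"
  have [measurable]: "\<xi> 1 \<in> borel_measurable M" by (rule xi_rv) simp
  have "variance (\<xi> 1) = expectation (\<lambda>\<omega>. (\<xi> 1 \<omega>)\<^sup>2) - ?m\<^sup>2"
    by (rule variance_eq[OF xi_int assms])
  moreover have "0 \<le> variance (\<xi> 1)" by (rule variance_positive)
  moreover have "variance (\<xi> 1) \<noteq> 0"
  proof
    assume 0: "variance (\<xi> 1) = 0"
    have "(\<xi> 1 \<omega> - ?m)\<^sup>2 = (\<xi> 1 \<omega>)\<^sup>2 - 2 * ?m * \<xi> 1 \<omega> + ?m\<^sup>2" for \<omega>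
      by (simp add: power2_diff)
    then have "integrable M (\<lambda>\<omega>. (\<xi> 1 \<omega> - ?m)\<^sup>2)" using assms xi_int by simp
    then have "AE \<omega> in M. (\<xi> 1 \<omega> - ?m)\<^sup>2 = 0"
      using integral_nonneg_eq_0_iff_AE[of M "\<lambda>\<omega>. (\<xi> 1 \<omega> - ?m)\<^sup>2"] 0 by simp
    then have "AE \<omega> in M. \<xi> 1 \<omega> = ?m" by eventually_elim simp
    then show False using xi_nondegenerate by blast
  qed
  ultimately show ?thesis by linarith
qed

text \<open>The squares truncated at \<open>L\<close> obey the law of large numbers, and their expectations exceed every bound as
  \<open>L\<close> grows.\<close>

lemma mean_sq_at_top:
  assumes "\<not> integrable M (\<lambda>\<omega>. (\<xi> 1 \<omega>)\<^sup>2)"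
  shows "filterlim mean_sq at_top (in_prob M)"
  unfolding filterlim_at_top
proof
  fix C :: real
  have [measurable]: "\<xi> 1 \<in> borel_measurable M" by (rule xi_rv) simp
  have "\<exists>L::nat. \<not> expectation (\<lambda>\<omega>. min ((\<xi> 1 \<omega>)\<^sup>2) (real L)) \<le> C"
  proof (rule ccontr)
    assume "\<nexists>L::nat. \<not> expectation (\<lambda>\<omega>. min ((\<xi> 1 \<omega>)\<^sup>2) (real L)) \<le> C"
    then have "integrable M (\<lambda>\<omega>. (\<xi> 1 \<omega>)\<^sup>2)"
      by (intro integrable_of_bounded_truncations[where C=C]) auto
    with assms show False ..
  qed
  then obtain L :: nat where L: "C < expectation (\<lambda>\<omega>. min ((\<xi> 1 \<omega>)\<^sup>2) (real L))" by (auto simp: not_le)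
  have "integrable M (\<lambda>\<omega>. min ((\<xi> 1 \<omega>)\<^sup>2) (real L))"
    by (intro integrable_const_bound[where B="real L"]) auto
  then have "((\<lambda>t. avg (fst t) (\<lambda>i. min ((\<xi> i (snd t))\<^sup>2) (real L))) \<longlongrightarrow> expectation (\<lambda>\<omega>. min ((\<xi> 1 \<omega>)\<^sup>2) (real L))) (in_prob M)"
    by (intro weak_law_iid[OF xi_iid, of "\<lambda>x. min (x\<^sup>2) (real L)"]) auto
  then have "\<forall>\<^sub>F t in in_prob M. C < avg (fst t) (\<lambda>i. min ((\<xi> i (snd t))\<^sup>2) (real L))"
    using L by (rule order_tendstoD(1))
  then show "\<forall>\<^sub>F t in in_prob M. C \<le> mean_sq t"
  proof eventually_elim
    case (elim t)
    have "avg (fst t) (\<lambda>i. min ((\<xi> i (snd t))\<^sup>2) (real L)) \<le> mean_sq t"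
      unfolding mean_sq_def by (rule avg_mono) simp
    with elim show ?case by simp
  qed
qed

text \<open>Finite and infinite variance are treated alike by means of \<open>p\<close>, the inverse of \<open>E \<xi>\<^sup>2\<close> or \<open>0\<close>.
  The strict inequality reflects that \<open>\<xi>\<close> is not constant; it keeps the limit of the centred second
  moment, relative to \<open>mean_sq\<close>, away from zero.\<close>

lemma inverse_mean_sq_limit:
  obtains p where "0 \<le> p" "(expectation (\<xi> 1))\<^sup>2 * p < 1"
    "((\<lambda>t. 1 / mean_sq t) \<longlongrightarrow> p) (in_prob M)" "\<forall>\<^sub>F t in in_prob M. 0 < mean_sq t"
    "p \<noteq> 0 \<Longrightarrow> integrable M (\<lambda>\<omega>. (\<xi> 1 \<omega>)\<^sup>2)"
proof (cases "integrable M (\<lambda>\<omega>. (\<xi> 1 \<omega>)\<^sup>2)")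
  case True
  define s where "s = expectation (\<lambda>\<omega>. (\<xi> 1 \<omega>)\<^sup>2)"
  have lt: "(expectation (\<xi> 1))\<^sup>2 < s" unfolding s_def by (rule xi_second_moment_gt[OF True])
  then have s: "0 < s" using zero_le_power2[of "expectation (\<xi> 1)"] by linarith
  have lim: "(mean_sq \<longlongrightarrow> s) (in_prob M)" unfolding s_def by (rule mean_sq_tendsto[OF True])
  show ?thesis
  proof (rule that[of "1 / s"])
    show "((\<lambda>t. 1 / mean_sq t) \<longlongrightarrow> 1 / s) (in_prob M)"
      by (intro tendsto_intros lim) (use s in simp)
    show "\<forall>\<^sub>F t in in_prob M. 0 < mean_sq t" by (rule order_tendstoD(1)[OF lim s])
    show "(expectation (\<xi> 1))\<^sup>2 * (1 / s) < 1" using lt s by simp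
  qed (use s True in auto)
next
  case False
  note top = mean_sq_at_top[OF False]
  show ?thesis
  proof (rule that[of 0])
    show "((\<lambda>t. 1 / mean_sq t) \<longlongrightarrow> 0) (in_prob M)"
      using tendsto_inverse_0_at_top[OF top] by (simp add: inverse_eq_divide)
    show "\<forall>\<^sub>F t in in_prob M. 0 < mean_sq t"
      using top by (simp add: filterlim_at_top_dense)
  qed auto
qed

text \<open>Squares up to \<open>K\<close> contribute at most \<open>K\<^sup>2 / n\<close>.  For the larger ones the sum of the squared squares is
  at most the square of their sum, hence their contribution is at most the squared mean of the tails,
  whose limit is small for large \<open>K\<close>.\<close>

lemma fourth_power_mean_negligible:
  assumes int: "integrable M (\<lambda>\<omega>. (\<xi> 1 \<omega>)\<^sup>2)"
  shows "((\<lambda>t. avg (fst t) (\<lambda>i. ((\<xi> i (snd t))\<^sup>2)\<^sup>2) / real (fst t)) \<longlongrightarrow> 0) (in_prob M)"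
proof (rule order_tendstoI)
  fix a :: real assume "a < 0"
  have "0 \<le> avg (fst t) (\<lambda>i. ((\<xi> i (snd t))\<^sup>2)\<^sup>2) / real (fst t)" for t
    by (intro divide_nonneg_nonneg avg_nonneg) auto
  then show "\<forall>\<^sub>F t in in_prob M. a < avg (fst t) (\<lambda>i. ((\<xi> i (snd t))\<^sup>2)\<^sup>2) / real (fst t)"
    using \<open>a < 0\<close> by (intro always_eventually allI) (rule less_le_trans)
next
  fix r :: real assume r: "0 < r"
  have [measurable]: "\<xi> 1 \<in> borel_measurable M" by (rule xi_rv) simp
  define T where "T K x = (if x\<^sup>2 \<le> real K then 0 else x\<^sup>2)" for K :: nat and x :: real
  have Tm [measurable]: "T K \<in> borel_measurable borel" for K unfolding T_def by measurable
  have "(\<lambda>K. LINT \<omega>|M. T K (\<xi> 1 \<omega>)) \<longlonglongrightarrow> (LINT \<omega>|M. 0)"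
  proof (rule integral_dominated_convergence[where w="\<lambda>\<omega>. (\<xi> 1 \<omega>)\<^sup>2"])
    show "AE \<omega> in M. (\<lambda>K. T K (\<xi> 1 \<omega>)) \<longlonglongrightarrow> 0"
    proof (rule AE_I2)
      fix \<omega>
      have "\<forall>\<^sub>F K in sequentially. (\<xi> 1 \<omega>)\<^sup>2 \<le> real K"
        using filterlim_real_sequentially by (simp add: filterlim_at_top)
      then have "\<forall>\<^sub>F K in sequentially. T K (\<xi> 1 \<omega>) = 0" by eventually_elim (simp add: T_def)
      then show "(\<lambda>K. T K (\<xi> 1 \<omega>)) \<longlonglongrightarrow> 0" by (rule tendsto_eventually)
    qed
  qed (use int in \<open>auto simp: T_def\<close>)
  then have "(\<lambda>K. (expectation (\<lambda>\<omega>. T K (\<xi> 1 \<omega>)))\<^sup>2) \<longlonglongrightarrow> 0"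
    using tendsto_power[of "\<lambda>K. expectation (\<lambda>\<omega>. T K (\<xi> 1 \<omega>))" 0 sequentially 2] by simp
  from order_tendstoD(2)[OF this r] obtain K where K: "(expectation (\<lambda>\<omega>. T K (\<xi> 1 \<omega>)))\<^sup>2 < r"
    by (auto simp: eventually_sequentially)
  have "integrable M (\<lambda>\<omega>. T K (\<xi> 1 \<omega>))"
    by (rule Bochner_Integration.integrable_bound[OF int]) (auto simp: T_def)
  note wl = weak_law_iid[OF xi_iid Tm this]
  have "((\<lambda>t. (real K)\<^sup>2 * (1 / real (fst t)) + (avg (fst t) (\<lambda>i. T K (\<xi> i (snd t))))\<^sup>2) \<longlongrightarrow>
      (real K)\<^sup>2 * 0 + (expectation (\<lambda>\<omega>. T K (\<xi> 1 \<omega>)))\<^sup>2) (in_prob M)"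
    by (intro tendsto_intros wl tendsto_in_prob_lift[OF lim_1_over_n])
  then have "\<forall>\<^sub>F t in in_prob M. (real K)\<^sup>2 * (1 / real (fst t)) + (avg (fst t) (\<lambda>i. T K (\<xi> i (snd t))))\<^sup>2 < r"
    by (rule order_tendstoD(2)) (use K in simp)
  then show "\<forall>\<^sub>F t in in_prob M. avg (fst t) (\<lambda>i. ((\<xi> i (snd t))\<^sup>2)\<^sup>2) / real (fst t) < r"
  proof eventually_elim
    case (elim t)
    let ?n = "fst t"
    have pw: "(x\<^sup>2)\<^sup>2 \<le> (real K)\<^sup>2 + (T K x)\<^sup>2" for x
    proof (cases "x\<^sup>2 \<le> real K")
      case True
      then have "(x\<^sup>2)\<^sup>2 \<le> (real K)\<^sup>2" by (intro power_mono) auto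
      then show ?thesis using zero_le_power2[of "T K x"] by linarith
    next
      case False
      then have "T K x = x\<^sup>2" by (simp add: T_def)
      then show ?thesis by simp
    qed
    have "avg ?n (\<lambda>i. ((\<xi> i (snd t))\<^sup>2)\<^sup>2) / real ?n \<le> avg ?n (\<lambda>i. (real K)\<^sup>2 + (T K (\<xi> i (snd t)))\<^sup>2) / real ?n"
      by (intro divide_right_mono avg_mono pw) simp
    also have "\<dots> = avg ?n (\<lambda>i. (real K)\<^sup>2) / real ?n + avg ?n (\<lambda>i. (T K (\<xi> i (snd t)))\<^sup>2) / real ?n"
      by (simp add: avg_add add_divide_distrib)
    also have "avg ?n (\<lambda>i. (real K)\<^sup>2) / real ?n \<le> (real K)\<^sup>2 * (1 / real ?n)"
      by (simp add: avg_def)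
    also have "avg ?n (\<lambda>i. (T K (\<xi> i (snd t)))\<^sup>2) / real ?n \<le> (avg ?n (\<lambda>i. T K (\<xi> i (snd t))))\<^sup>2"
      by (rule avg_squares_le) (simp add: T_def)
    finally show ?case using elim by simp
  qed
qed

lemma weighted_avg_null:
  assumes p: "((\<lambda>t. 1 / mean_sq t) \<longlongrightarrow> p) (in_prob M)" and Q: "\<forall>\<^sub>F t in in_prob M. 0 < mean_sq t"
    and g: "g \<in> borel_measurable borel" "integrable M (\<lambda>\<omega>. (g (e 1 \<omega>))\<^sup>2)" "expectation (\<lambda>\<omega>. g (e 1 \<omega>)) = 0"
  shows "((\<lambda>t. avg (fst t) (\<lambda>i. \<xi> i (snd t) * g (e i (snd t))) / mean_sq t) \<longlongrightarrow> 0) (in_prob M)"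
proof -
  let ?N = "\<lambda>t. sqrt (real (fst t)) * avg (fst t) (\<lambda>i. \<xi> i (snd t) * g (e i (snd t))) / sqrt (mean_sq t)"
  have "((\<lambda>t. sqrt (1 / mean_sq t) * (1 / sqrt (real (fst t)))) \<longlongrightarrow> sqrt p * 0) (in_prob M)"
    by (intro tendsto_intros p inverse_sqrt_tendsto_in_prob)
  then have null: "((\<lambda>t. sqrt (1 / mean_sq t) * (1 / sqrt (real (fst t)))) \<longlongrightarrow> 0) (in_prob M)" by simp
  note lim = bdd_in_prob_times_null(1)[OF bdd_in_prob_weighted_avg[OF g] null]
  show ?thesis
  proof (rule Lim_transform_eventually[OF lim])
    note eventually_fst_ge_in_prob[of 1 M]
    with Q show "\<forall>\<^sub>F t in in_prob M. ?N t * (sqrt (1 / mean_sq t) * (1 / sqrt (real (fst t)))) =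
        avg (fst t) (\<lambda>i. \<xi> i (snd t) * g (e i (snd t))) / mean_sq t"
    proof eventually_elim
      case (elim t)
      define s where "s = sqrt (mean_sq t)"
      have s: "s > 0" "mean_sq t = s * s" using elim by (simp_all add: s_def)
      have "sqrt (1 / mean_sq t) = 1 / s" by (simp add: s_def real_sqrt_divide)
      moreover have "sqrt (real (fst t)) \<noteq> 0" using elim by simp
      ultimately show ?case unfolding s_def[symmetric] using s(1) by (simp add: s(2) field_simps)
    qed
  qed
qed

lemma xi_mean_tendsto: "((\<lambda>t. avg (fst t) (\<lambda>i. \<xi> i (snd t))) \<longlongrightarrow> expectation (\<xi> 1)) (in_prob M)"
  using weak_law_iid[OF xi_iid, of "\<lambda>x. x"] xi_int by simp

lemma linear_mean_tendsto:
  assumes f: "f \<in> borel_measurable borel" "integrable M (\<lambda>\<omega>. f (e 1 \<omega>))" "expectation (\<lambda>\<omega>. f (e 1 \<omega>)) = 0"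
  shows "((\<lambda>t. avg (fst t) (\<lambda>i. a * \<xi> i (snd t) + f (e i (snd t)))) \<longlongrightarrow> a * expectation (\<xi> 1)) (in_prob M)"
proof -
  have "((\<lambda>t. a * avg (fst t) (\<lambda>i. \<xi> i (snd t)) + avg (fst t) (\<lambda>i. f (e i (snd t)))) \<longlongrightarrow> a * expectation (\<xi> 1) + 0) (in_prob M)"
    using weak_law_iid[OF e_iid f(1,2)] f(3) by (intro tendsto_intros xi_mean_tendsto) simp
  then show ?thesis by (simp add: avg_add avg_cmult)
qed

text \<open>The mean of the products is \<open>a * b * mean_sq\<close>, plus mixed terms of the order of the root of
  \<open>mean_sq / n\<close>, plus the mean of the error products, which \<open>\<tau>\<close> cancels in the limit.  Division by
  \<open>mean_sq\<close> leaves \<open>a * b\<close> and the product of the sample means.\<close>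

lemma cross_moment_limit:
  fixes f g :: "real \<times> real \<Rightarrow> real"
  assumes p: "((\<lambda>t. 1 / mean_sq t) \<longlongrightarrow> p) (in_prob M)" and Q: "\<forall>\<^sub>F t in in_prob M. 0 < mean_sq t"
    and c: "c = 0 \<or> c = 1"
    and f [measurable]: "f \<in> borel_measurable borel" and f2: "integrable M (\<lambda>\<omega>. (f (e 1 \<omega>))\<^sup>2)" "expectation (\<lambda>\<omega>. f (e 1 \<omega>)) = 0"
    and g [measurable]: "g \<in> borel_measurable borel" and g2: "integrable M (\<lambda>\<omega>. (g (e 1 \<omega>))\<^sup>2)" "expectation (\<lambda>\<omega>. g (e 1 \<omega>)) = 0"
    and fg: "integrable M (\<lambda>\<omega>. f (e 1 \<omega>) * g (e 1 \<omega>))" "expectation (\<lambda>\<omega>. f (e 1 \<omega>) * g (e 1 \<omega>)) = \<tau>"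
  shows "((\<lambda>t. (S c (fst t) (\<lambda>i. a * \<xi> i (snd t) + f (e i (snd t))) (\<lambda>i. b * \<xi> i (snd t) + g (e i (snd t))) - \<tau>) / mean_sq t)
    \<longlongrightarrow> a * b * (1 - c * (expectation (\<xi> 1))\<^sup>2 * p)) (in_prob M)"
proof -
  have [measurable]: "e 1 \<in> borel_measurable M" by (rule e_rv) simp
  have fi: "integrable M (\<lambda>\<omega>. f (e 1 \<omega>))" and gi: "integrable M (\<lambda>\<omega>. g (e 1 \<omega>))"
    by (rule square_integrable_imp_integrable[OF _ f2(1)] square_integrable_imp_integrable[OF _ g2(1)]; simp)+
  let ?m = "expectation (\<xi> 1)"
  let ?z = "\<lambda>t i. a * \<xi> i (snd t) + f (e i (snd t))" and ?x = "\<lambda>t i. b * \<xi> i (snd t) + g (e i (snd t))"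
  have fgl: "((\<lambda>t. avg (fst t) (\<lambda>i. f (e i (snd t)) * g (e i (snd t)))) \<longlongrightarrow> \<tau>) (in_prob M)"
    using weak_law_iid[OF e_iid, of "\<lambda>x. f x * g x"] fg by simp
  have "((\<lambda>t. a * b + a * (avg (fst t) (\<lambda>i. \<xi> i (snd t) * g (e i (snd t))) / mean_sq t)
      + b * (avg (fst t) (\<lambda>i. \<xi> i (snd t) * f (e i (snd t))) / mean_sq t)
      + (avg (fst t) (\<lambda>i. f (e i (snd t)) * g (e i (snd t))) - \<tau>) * (1 / mean_sq t)
      - c * avg (fst t) (?z t) * avg (fst t) (?x t) * (1 / mean_sq t)) \<longlongrightarrow>
      a * b + a * 0 + b * 0 + (\<tau> - \<tau>) * p - c * (a * ?m) * (b * ?m) * p) (in_prob M)"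
    by (intro tendsto_intros p fgl weighted_avg_null[OF p Q f f2] weighted_avg_null[OF p Q g g2]
        linear_mean_tendsto f g fi gi f2(2) g2(2))
  then have lim: "((\<lambda>t. a * b + a * (avg (fst t) (\<lambda>i. \<xi> i (snd t) * g (e i (snd t))) / mean_sq t)
      + b * (avg (fst t) (\<lambda>i. \<xi> i (snd t) * f (e i (snd t))) / mean_sq t)
      + (avg (fst t) (\<lambda>i. f (e i (snd t)) * g (e i (snd t))) - \<tau>) * (1 / mean_sq t)
      - c * avg (fst t) (?z t) * avg (fst t) (?x t) * (1 / mean_sq t)) \<longlongrightarrow> a * b * (1 - c * ?m\<^sup>2 * p)) (in_prob M)"
    by (rule tendsto_eq_rhs) (simp add: power2_eq_square algebra_simps)
  show ?thesis
  proof (rule Lim_transform_eventually[OF lim], rule eventually_mono[OF Q])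
    fix t assume Qt: "0 < mean_sq t"
    have "avg (fst t) (\<lambda>i. ?z t i * ?x t i) = avg (fst t) (\<lambda>i. a * b * (\<xi> i (snd t))\<^sup>2 + a * (\<xi> i (snd t) * g (e i (snd t)))
        + b * (\<xi> i (snd t) * f (e i (snd t))) + f (e i (snd t)) * g (e i (snd t)))"
      by (simp add: power2_eq_square algebra_simps)
    also have "\<dots> = a * b * mean_sq t + a * avg (fst t) (\<lambda>i. \<xi> i (snd t) * g (e i (snd t)))
        + b * avg (fst t) (\<lambda>i. \<xi> i (snd t) * f (e i (snd t))) + avg (fst t) (\<lambda>i. f (e i (snd t)) * g (e i (snd t)))"
      by (simp add: avg_add avg_cmult mean_sq_def)
    finally show "a * b + a * (avg (fst t) (\<lambda>i. \<xi> i (snd t) * g (e i (snd t))) / mean_sq t)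
      + b * (avg (fst t) (\<lambda>i. \<xi> i (snd t) * f (e i (snd t))) / mean_sq t)
      + (avg (fst t) (\<lambda>i. f (e i (snd t)) * g (e i (snd t))) - \<tau>) * (1 / mean_sq t)
      - c * avg (fst t) (?z t) * avg (fst t) (?x t) * (1 / mean_sq t) = (S c (fst t) (?z t) (?x t) - \<tau>) / mean_sq t"
      using Qt unfolding S_eq[OF c] by (simp add: add_divide_distrib diff_divide_distrib)
  qed
qed

end

section \<open>The estimating equation\<close>

lemma bdd_in_prob_cong:
  assumes "bdd_in_prob M g" "\<forall>\<^sub>F t in in_prob M. f t = g t"
  shows "bdd_in_prob M f"
  by (rule bdd_in_prob_dominated[OF assms(1)], rule eventually_mono[OF assms(2)]) simp

lemma square_integrable_add:
  fixes X Y :: "'a \<Rightarrow> real"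
  assumes [measurable]: "X \<in> borel_measurable M" "Y \<in> borel_measurable M"
    and int: "integrable M (\<lambda>\<omega>. (X \<omega>)\<^sup>2)" "integrable M (\<lambda>\<omega>. (Y \<omega>)\<^sup>2)"
  shows "integrable M (\<lambda>\<omega>. (X \<omega> + Y \<omega>)\<^sup>2)"
proof -
  have "integrable M (\<lambda>\<omega>. (X \<omega>)\<^sup>2 + (Y \<omega>)\<^sup>2 + 2 * (X \<omega> * Y \<omega>))"
    using int integrable_product_of_squares[OF assms] by simp
  then show ?thesis by (simp add: power2_sum mult.assoc)
qed

lemma square_integrable_cmult:
  fixes X :: "'a \<Rightarrow> real"
  assumes "integrable M (\<lambda>\<omega>. (X \<omega>)\<^sup>2)"
  shows "integrable M (\<lambda>\<omega>. (a * X \<omega>)\<^sup>2)"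
  using assms by (simp add: power_mult_distrib)

text \<open>The common form of the two estimators: the slope \<open>b\<close> is chosen such that the sample covariance of \<open>z\<close> and
  \<open>y - b x\<close> equals the covariance of their errors, with \<open>z = \<kappa> \<xi> + f(e)\<close>.  The functions \<open>f\<close>, \<open>g\<close> and \<open>h\<close> give the errors of \<open>z\<close>, of \<open>x\<close> and of the
  residual \<open>y - \<alpha> - \<beta> x\<close>; \<open>\<rho>\<close> and \<open>\<tau>\<close> are the covariances that correct the products of \<open>z\<close> with the
  residual and with \<open>x\<close>.\<close>

locale slope_equation = structural_sample M \<xi> e
  for M :: "'a measure" and \<xi> :: "nat \<Rightarrow> 'a \<Rightarrow> real" and e :: "nat \<Rightarrow> 'a \<Rightarrow> real \<times> real" +
  fixes f g h :: "real \<times> real \<Rightarrow> real" and \<kappa> c p \<rho> \<tau> :: real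
  assumes f_meas [measurable]: "f \<in> borel_measurable borel"
    and g_meas [measurable]: "g \<in> borel_measurable borel"
    and h_meas [measurable]: "h \<in> borel_measurable borel"
    and f_sq: "integrable M (\<lambda>\<omega>. (f (e 1 \<omega>))\<^sup>2)" and f_mean: "expectation (\<lambda>\<omega>. f (e 1 \<omega>)) = 0"
    and g_sq: "integrable M (\<lambda>\<omega>. (g (e 1 \<omega>))\<^sup>2)" and g_mean: "expectation (\<lambda>\<omega>. g (e 1 \<omega>)) = 0"
    and h_sq: "integrable M (\<lambda>\<omega>. (h (e 1 \<omega>))\<^sup>2)" and h_mean: "expectation (\<lambda>\<omega>. h (e 1 \<omega>)) = 0"
    and h_pos: "expectation (\<lambda>\<omega>. (h (e 1 \<omega>))\<^sup>2) > 0"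
    and fh_sq: "integrable M (\<lambda>\<omega>. (f (e 1 \<omega>) * h (e 1 \<omega>))\<^sup>2)"
    and fg_sq: "integrable M (\<lambda>\<omega>. (f (e 1 \<omega>) * g (e 1 \<omega>))\<^sup>2)"
    and fh_mean: "expectation (\<lambda>\<omega>. f (e 1 \<omega>) * h (e 1 \<omega>)) = \<rho>"
    and fg_mean: "expectation (\<lambda>\<omega>. f (e 1 \<omega>) * g (e 1 \<omega>)) = \<tau>"
    and kappa: "\<kappa> \<noteq> 0" and c01: "c = 0 \<or> c = 1"
    and p_nonneg: "0 \<le> p" and p_bound: "(expectation (\<xi> 1))\<^sup>2 * p < 1"
    and p_lim: "((\<lambda>t. 1 / mean_sq t) \<longlongrightarrow> p) (in_prob M)"
    and mean_sq_pos: "\<forall>\<^sub>F t in in_prob M. 0 < mean_sq t"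
    and p_int: "p \<noteq> 0 \<Longrightarrow> integrable M (\<lambda>\<omega>. (\<xi> 1 \<omega>)\<^sup>2)"
begin

abbreviation "m \<equiv> expectation (\<xi> 1)"

text \<open>In the notation of the estimators, \<open>D\<close> is \<open>U(j,n)\<close>, \<open>ubar\<close> is the mean of the \<open>u\<^sub>i(j,n)\<close>, \<open>K\<close> is
  \<open>xbar / U(j,n)\<close>, \<open>V\<close> is \<open>v\<^sub>i(j,n)\<close>, and \<open>W\<close> is its version with a tilde.  The limits of \<open>D / mean_sq\<close> and
  \<open>K\<close> are \<open>\<kappa> * q\<close> and \<open>k\<close>.  The variable \<open>w\<close> arises from \<open>V\<close> by replacing \<open>K\<close> with \<open>k\<close> and the sample means with
  their limits; \<open>hr\<close> collects the part of \<open>w\<close> that is multiplied by \<open>k\<close> and does not involve the regressor.\<close>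

definition zz :: "nat \<times> 'a \<Rightarrow> nat \<Rightarrow> real" where "zz t i = \<kappa> * \<xi> i (snd t) + f (e i (snd t))"
definition xx :: "nat \<times> 'a \<Rightarrow> nat \<Rightarrow> real" where "xx t i = \<xi> i (snd t) + g (e i (snd t))"
definition hh :: "nat \<times> 'a \<Rightarrow> nat \<Rightarrow> real" where "hh t i = h (e i (snd t))"
definition D :: "nat \<times> 'a \<Rightarrow> real" where "D t = S c (fst t) (zz t) (xx t) - \<tau>"
definition ubar :: "nat \<times> 'a \<Rightarrow> real" where "ubar t = S c (fst t) (zz t) (hh t) - \<rho>"
definition K :: "nat \<times> 'a \<Rightarrow> real" where "K t = avg (fst t) (xx t) / D t"
definition V :: "nat \<times> 'a \<Rightarrow> nat \<Rightarrow> real" where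
  "V t i = hh t i - K t * (cross c (fst t) (zz t) (hh t) i - \<rho>)"
definition W :: "nat \<times> 'a \<Rightarrow> nat \<Rightarrow> real" where
  "W t i = V t i - ubar t / D t * (xx t i - K t * (cross c (fst t) (zz t) (xx t) i - \<tau>))"
definition q :: real where "q = 1 - c * m\<^sup>2 * p"
definition k :: real where "k = m * p / (\<kappa> * q)"
definition hr :: "real \<times> real \<Rightarrow> real" where "hr v = (f v - c * \<kappa> * m) * h v - \<rho>"
definition w :: "nat \<Rightarrow> 'a \<Rightarrow> real" where
  "w i \<omega> = h (e i \<omega>) - k * (\<kappa> * (\<xi> i \<omega> * h (e i \<omega>)) + hr (e i \<omega>))"
definition rQ :: "nat \<times> 'a \<Rightarrow> real" where "rQ t = sqrt (mean_sq t)"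

lemma e1_meas [measurable]: "e 1 \<in> borel_measurable M" "e (Suc 0) \<in> borel_measurable M"
  by (rule e_rv; simp)+

lemma hr_meas [measurable]: "hr \<in> borel_measurable borel"
  unfolding hr_def by measurable

lemma f_int: "integrable M (\<lambda>\<omega>. f (e 1 \<omega>))" and g_int: "integrable M (\<lambda>\<omega>. g (e 1 \<omega>))"
  and h_int: "integrable M (\<lambda>\<omega>. h (e 1 \<omega>))"
  and fh_int: "integrable M (\<lambda>\<omega>. f (e 1 \<omega>) * h (e 1 \<omega>))"
  and fg_int: "integrable M (\<lambda>\<omega>. f (e 1 \<omega>) * g (e 1 \<omega>))"
  by (rule square_integrable_imp_integrable[OF _ f_sq] square_integrable_imp_integrable[OF _ g_sq]
      square_integrable_imp_integrable[OF _ h_sq] square_integrable_imp_integrable[OF _ fh_sq]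
      square_integrable_imp_integrable[OF _ fg_sq]; measurable)+

lemma hr_sq: "integrable M (\<lambda>\<omega>. (hr (e 1 \<omega>))\<^sup>2)"
proof -
  have "integrable M (\<lambda>\<omega>. (f (e 1 \<omega>) * h (e 1 \<omega>) + (- (c * \<kappa> * m)) * h (e 1 \<omega>) + (- \<rho>))\<^sup>2)"
    by (intro square_integrable_add square_integrable_cmult fh_sq h_sq) auto
  moreover have "hr v = f v * h v + (- (c * \<kappa> * m)) * h v + (- \<rho>)" for v
    by (simp add: hr_def algebra_simps)
  ultimately show ?thesis by simp
qed

lemma hr_mean: "expectation (\<lambda>\<omega>. hr (e 1 \<omega>)) = 0"
proof -
  have "expectation (\<lambda>\<omega>. hr (e 1 \<omega>)) = expectation (\<lambda>\<omega>. f (e 1 \<omega>) * h (e 1 \<omega>) - c * \<kappa> * m * h (e 1 \<omega>) - \<rho>)"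
    by (simp add: hr_def algebra_simps)
  also have "\<dots> = \<rho> - c * \<kappa> * m * 0 - \<rho>"
    using fh_int h_int fh_mean h_mean by (simp add: prob_space)
  finally show ?thesis by simp
qed

lemma q_pos: "0 < q"
  using c01 p_bound by (auto simp: q_def)

lemma D_lim: "((\<lambda>t. D t / mean_sq t) \<longlongrightarrow> \<kappa> * q) (in_prob M)"
  using cross_moment_limit[OF p_lim mean_sq_pos c01 f_meas f_sq f_mean g_meas g_sq g_mean fg_int fg_mean, of \<kappa> 1]
  unfolding D_def zz_def[abs_def] xx_def[abs_def] q_def by simp

lemma xbar_lim: "((\<lambda>t. avg (fst t) (xx t)) \<longlongrightarrow> m) (in_prob M)"
  using linear_mean_tendsto[OF g_meas g_int g_mean, of 1] unfolding xx_def[abs_def] by simp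

lemma zbar_lim: "((\<lambda>t. avg (fst t) (zz t)) \<longlongrightarrow> \<kappa> * m) (in_prob M)"
  using linear_mean_tendsto[OF f_meas f_int f_mean, of \<kappa>] unfolding zz_def[abs_def] .

lemma hbar_lim: "((\<lambda>t. avg (fst t) (hh t)) \<longlongrightarrow> 0) (in_prob M)"
  using weak_law_iid[OF e_iid h_meas h_int] h_mean unfolding hh_def[abs_def] by simp

lemma K_lim: "(K \<longlongrightarrow> k) (in_prob M)"
proof (rule Lim_transform_eventually)
  have "((\<lambda>t. avg (fst t) (xx t) * (1 / mean_sq t) / (D t / mean_sq t)) \<longlongrightarrow> m * p / (\<kappa> * q)) (in_prob M)"
    using kappa q_pos by (intro tendsto_intros xbar_lim p_lim D_lim) simp
  then show "((\<lambda>t. avg (fst t) (xx t) * (1 / mean_sq t) / (D t / mean_sq t)) \<longlongrightarrow> k) (in_prob M)"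
    by (simp only: k_def)
  show "\<forall>\<^sub>F t in in_prob M. avg (fst t) (xx t) * (1 / mean_sq t) / (D t / mean_sq t) = K t"
    using mean_sq_pos by eventually_elim (simp add: K_def)
qed

text \<open>A finer statement than the convergence of \<open>K\<close>: it allows for factors that grow like the root of
  \<open>mean_sq\<close>.\<close>

lemma K_rQ_lim: "((\<lambda>t. K t * rQ t) \<longlongrightarrow> m * sqrt p / (\<kappa> * q)) (in_prob M)"
proof (rule Lim_transform_eventually)
  show "((\<lambda>t. avg (fst t) (xx t) * sqrt (1 / mean_sq t) / (D t / mean_sq t)) \<longlongrightarrow> m * sqrt p / (\<kappa> * q)) (in_prob M)"
    using kappa q_pos by (intro tendsto_intros xbar_lim p_lim D_lim) simp
  show "\<forall>\<^sub>F t in in_prob M. avg (fst t) (xx t) * sqrt (1 / mean_sq t) / (D t / mean_sq t) = K t * rQ t"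
    using mean_sq_pos
  proof eventually_elim
    case (elim t)
    then have s: "rQ t > 0" "mean_sq t = rQ t * rQ t" "sqrt (1 / mean_sq t) = 1 / rQ t"
      by (simp_all add: rQ_def real_sqrt_divide)
    show ?case unfolding K_def s(3) unfolding s(2) using s(1) by simp
  qed
qed

text \<open>If \<open>p = 0\<close> then \<open>k = 0\<close> and the limit in \<open>K_rQ_lim\<close> vanishes; otherwise \<open>rQ\<close> converges and the two
  limits agree.\<close>

lemma K_diff_rQ_lim: "((\<lambda>t. (K t - k) * rQ t) \<longlongrightarrow> 0) (in_prob M)"
proof (cases "p = 0")
  case True
  have k0: "k = 0" unfolding k_def using True by simp
  have "m * sqrt p / (\<kappa> * q) = 0" using True by simp
  then show ?thesis using K_rQ_lim unfolding k0 by (simp only: diff_zero)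
next
  case False
  with p_nonneg have p: "p > 0" by simp
  have "((\<lambda>t. K t * rQ t - k * sqrt (1 / (1 / mean_sq t))) \<longlongrightarrow> m * sqrt p / (\<kappa> * q) - k * sqrt (1 / p)) (in_prob M)"
    by (intro tendsto_intros K_rQ_lim p_lim) (use p in simp)
  moreover have "m * sqrt p / (\<kappa> * q) - k * sqrt (1 / p) = 0"
  proof -
    have "p * (1 / sqrt p) = sqrt p" using p by (simp add: real_div_sqrt)
    moreover have "k * sqrt (1 / p) = m * (p * (1 / sqrt p)) / (\<kappa> * q)"
      unfolding k_def real_sqrt_divide by simp
    ultimately show ?thesis by (simp only: diff_self)
  qed
  ultimately show ?thesis by (simp add: rQ_def left_diff_distrib)
qed

lemma K_diff_lim: "((\<lambda>t. K t - k) \<longlongrightarrow> 0) (in_prob M)"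
  by (rule LIM_zero[OF K_lim])

lemma scaled_h_bdd: "bdd_in_prob M (\<lambda>t. sqrt (real (fst t)) * avg (fst t) (hh t))"
  using bdd_in_prob_scaled_avg[OF e_iid h_meas h_sq h_mean] unfolding hh_def[abs_def] .

lemma scaled_hr_bdd: "bdd_in_prob M (\<lambda>t. sqrt (real (fst t)) * avg (fst t) (\<lambda>i. hr (e i (snd t))))"
  by (rule bdd_in_prob_scaled_avg[OF e_iid hr_meas hr_sq hr_mean])

text \<open>The means of \<open>\<xi> i * h (e i)\<close> on the scale on which they are bounded in probability.\<close>

definition N :: "nat \<times> 'a \<Rightarrow> real" where
  "N t = sqrt (real (fst t)) * avg (fst t) (\<lambda>i. \<xi> i (snd t) * h (e i (snd t))) / rQ t"

lemma N_bdd: "bdd_in_prob M N"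
  using bdd_in_prob_weighted_avg[OF h_meas h_sq h_mean] unfolding N_def[abs_def] rQ_def .

lemma zh_avg: "avg n (\<lambda>i. zz t i * hh t i) =
    \<kappa> * avg n (\<lambda>i. \<xi> i (snd t) * h (e i (snd t))) + avg n (\<lambda>i. f (e i (snd t)) * h (e i (snd t)))"
  unfolding avg_cmult[symmetric] avg_add[symmetric] by (simp add: zz_def hh_def algebra_simps)

lemma hr_avg: "1 \<le> n \<Longrightarrow> avg n (\<lambda>i. hr (e i \<omega>)) =
    avg n (\<lambda>i. f (e i \<omega>) * h (e i \<omega>)) - c * \<kappa> * m * avg n (\<lambda>i. h (e i \<omega>)) - \<rho>"
proof -
  assume n: "1 \<le> n"
  have "avg n (\<lambda>i. hr (e i \<omega>)) = avg n (\<lambda>i. f (e i \<omega>) * h (e i \<omega>) - c * \<kappa> * m * h (e i \<omega>) - \<rho>)"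
    by (simp add: hr_def algebra_simps)
  then show ?thesis using n by (simp add: avg_diff avg_cmult avg_const)
qed

text \<open>The difference is a combination of \<open>sqrt n\<close>-scaled means, which are bounded in probability, with
  coefficients that tend to zero.  The mean of \<open>\<xi> i * h (e i)\<close> is bounded only relative to \<open>rQ\<close>; there
  \<open>K_diff_rQ_lim\<close> supplies the missing factor.\<close>

lemma numerator_lim:
  "((\<lambda>t. sqrt (real (fst t)) * (avg (fst t) (hh t) - K t * ubar t) - sqrt (real (fst t)) * avg (fst t) (\<lambda>i. w i (snd t))) \<longlongrightarrow> 0) (in_prob M)"
proof (rule Lim_transform_eventually)
  let ?h = "\<lambda>t. sqrt (real (fst t)) * avg (fst t) (hh t)"
  let ?r = "\<lambda>t. sqrt (real (fst t)) * avg (fst t) (\<lambda>i. hr (e i (snd t)))"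
  have "((\<lambda>t. K t * c * (avg (fst t) (zz t) - \<kappa> * m)) \<longlongrightarrow> k * c * (\<kappa> * m - \<kappa> * m)) (in_prob M)"
    by (intro tendsto_intros K_lim zbar_lim)
  then have z: "((\<lambda>t. K t * c * (avg (fst t) (zz t) - \<kappa> * m)) \<longlongrightarrow> 0) (in_prob M)" by simp
  have "((\<lambda>t. - (\<kappa> * ((K t - k) * rQ t * N t) + (K t - k) * ?r t) + K t * c * (avg (fst t) (zz t) - \<kappa> * m) * ?h t)
      \<longlongrightarrow> - (\<kappa> * 0 + 0) + 0) (in_prob M)"
    by (intro tendsto_add tendsto_minus tendsto_mult_left bdd_in_prob_times_null(2)[OF N_bdd K_diff_rQ_lim]
        bdd_in_prob_times_null(2)[OF scaled_hr_bdd K_diff_lim] bdd_in_prob_times_null(2)[OF scaled_h_bdd z])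
  then show "((\<lambda>t. - (\<kappa> * ((K t - k) * rQ t * N t) + (K t - k) * ?r t) + K t * c * (avg (fst t) (zz t) - \<kappa> * m) * ?h t)
      \<longlongrightarrow> 0) (in_prob M)" by simp
  show "\<forall>\<^sub>F t in in_prob M. - (\<kappa> * ((K t - k) * rQ t * N t) + (K t - k) * ?r t) + K t * c * (avg (fst t) (zz t) - \<kappa> * m) * ?h t
      = sqrt (real (fst t)) * (avg (fst t) (hh t) - K t * ubar t) - sqrt (real (fst t)) * avg (fst t) (\<lambda>i. w i (snd t))"
    using mean_sq_pos eventually_fst_ge_in_prob[of 1]
  proof eventually_elim
    case (elim t)
    let ?n = "fst t"
    define s where "s = sqrt (real ?n)"
    define a where "a = avg ?n (\<lambda>i. \<xi> i (snd t) * h (e i (snd t)))"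
    define b where "b = avg ?n (\<lambda>i. f (e i (snd t)) * h (e i (snd t)))"
    define d where "d = avg ?n (hh t)"
    define z where "z = avg ?n (zz t)"
    have rN: "rQ t * N t = s * a" using elim(1) by (simp add: N_def rQ_def s_def a_def)
    have d': "avg ?n (\<lambda>i. h (e i (snd t))) = d" by (simp add: d_def hh_def[abs_def])
    have r: "avg ?n (\<lambda>i. hr (e i (snd t))) = b - c * \<kappa> * m * d - \<rho>"
      using hr_avg[OF elim(2)] by (simp add: b_def d')
    have u: "ubar t = \<kappa> * a + b - c * z * d - \<rho>"
      unfolding ubar_def S_eq[OF c01] zh_avg by (simp add: a_def b_def z_def d_def)
    have w: "avg ?n (\<lambda>i. w i (snd t)) = d - k * (\<kappa> * a + (b - c * \<kappa> * m * d - \<rho>))"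
      unfolding w_def avg_diff avg_cmult avg_add r d' by (simp add: a_def)
    have "(K t - k) * rQ t * N t = (K t - k) * (s * a)" unfolding mult.assoc rN ..
    note KN = this
    show ?case unfolding KN w u r s_def[symmetric] d_def[symmetric] z_def[symmetric]
      by (simp add: algebra_simps)
  qed
qed

text \<open>The mean of \<open>(\<xi> i)\<^sup>2 * (v (e i))\<^sup>2\<close> is of the order of \<open>mean_sq\<close>, so the coefficient has to vanish relative to
  \<open>rQ\<close>.\<close>

lemma xi_h_sq_null:
  assumes v: "v \<in> borel_measurable borel" "integrable M (\<lambda>\<omega>. (v (e 1 \<omega>))\<^sup>2)"
    and s: "((\<lambda>t. s t * rQ t) \<longlongrightarrow> 0) (in_prob M)"
  shows "((\<lambda>t. avg (fst t) (\<lambda>i. (s t * (\<xi> i (snd t) * v (e i (snd t))))\<^sup>2)) \<longlongrightarrow> 0) (in_prob M)"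
proof (rule tendsto_avg_scaled_null, rule Lim_transform_eventually)
  have "((\<lambda>t. (s t * rQ t)\<^sup>2) \<longlongrightarrow> 0\<^sup>2) (in_prob M)" by (intro tendsto_intros s)
  then have "((\<lambda>t. (s t * rQ t)\<^sup>2) \<longlongrightarrow> 0) (in_prob M)" by simp
  from bdd_in_prob_times_null(2)[OF bdd_in_prob_weighted_squares[OF v] this]
  show "((\<lambda>t. (s t * rQ t)\<^sup>2 * (avg (fst t) (\<lambda>i. (\<xi> i (snd t))\<^sup>2 * (v (e i (snd t)))\<^sup>2) / mean_sq t)) \<longlongrightarrow> 0) (in_prob M)" .
  show "\<forall>\<^sub>F t in in_prob M. (s t * rQ t)\<^sup>2 * (avg (fst t) (\<lambda>i. (\<xi> i (snd t))\<^sup>2 * (v (e i (snd t)))\<^sup>2) / mean_sq t)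
      = (s t)\<^sup>2 * avg (fst t) (\<lambda>i. (\<xi> i (snd t) * v (e i (snd t)))\<^sup>2)"
    using mean_sq_pos by eventually_elim (simp add: rQ_def power_mult_distrib)
qed

lemma xi_sq_null:
  assumes s: "((\<lambda>t. s t * rQ t) \<longlongrightarrow> 0) (in_prob M)"
  shows "((\<lambda>t. avg (fst t) (\<lambda>i. (s t * \<xi> i (snd t))\<^sup>2)) \<longlongrightarrow> 0) (in_prob M)"
  using xi_h_sq_null[of "\<lambda>_. 1", OF _ _ s] by simp

lemma e_sq_null:
  assumes v [measurable]: "v \<in> borel_measurable borel" and v2: "integrable M (\<lambda>\<omega>. (v (e 1 \<omega>))\<^sup>2)"
    and s: "(s \<longlongrightarrow> 0) (in_prob M)"
  shows "((\<lambda>t. avg (fst t) (\<lambda>i. (s t * v (e i (snd t)))\<^sup>2)) \<longlongrightarrow> 0) (in_prob M)"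
proof (rule tendsto_avg_scaled_null)
  have "((\<lambda>t. (s t)\<^sup>2 * avg (fst t) (\<lambda>i. (v (e i (snd t)))\<^sup>2)) \<longlongrightarrow> 0\<^sup>2 * expectation (\<lambda>\<omega>. (v (e 1 \<omega>))\<^sup>2)) (in_prob M)"
    by (intro tendsto_intros s weak_law_iid[OF e_iid, of "\<lambda>x. (v x)\<^sup>2"] v2) measurable
  then show "((\<lambda>t. (s t)\<^sup>2 * avg (fst t) (\<lambda>i. (v (e i (snd t)))\<^sup>2)) \<longlongrightarrow> 0) (in_prob M)" by simp
qed

text \<open>Expanding the centred products leaves multiples of \<open>\<xi> * h\<close>, \<open>hr\<close>, \<open>h\<close>, \<open>\<xi>\<close>, \<open>f\<close> and \<open>1\<close>; each coefficient
  tends to zero, for the terms with \<open>\<xi>\<close> even after multiplication by \<open>rQ\<close>.\<close>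

lemma V_close: "((\<lambda>t. avg (fst t) (\<lambda>i. (V t i - w i (snd t))\<^sup>2)) \<longlongrightarrow> 0) (in_prob M)"
proof -
  let ?z = "\<lambda>t. avg (fst t) (zz t)" and ?h = "\<lambda>t. avg (fst t) (hh t)"
  have decomp: "V t i - w i (snd t) = - \<kappa> * (K t - k) * (\<xi> i (snd t) * h (e i (snd t))) + - (K t - k) * hr (e i (snd t))
      + K t * c * (?z t - \<kappa> * m) * h (e i (snd t)) + K t * c * ?h t * \<kappa> * \<xi> i (snd t) + K t * c * ?h t * f (e i (snd t))
      + - (K t * c * ?z t * ?h t)" for t i
  proof -
    have "cross c (fst t) (zz t) (hh t) i = zz t i * hh t i - c * ?z t * hh t i - c * ?h t * zz t i + c * ?z t * ?h t"
      using c01 by (auto simp: cross_def algebra_simps)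
    note cross = this
    show ?thesis unfolding V_def cross
      by (simp add: w_def hr_def zz_def hh_def algebra_simps)
  qed
  have "((\<lambda>t. - \<kappa> * ((K t - k) * rQ t)) \<longlongrightarrow> - \<kappa> * 0) (in_prob M)"
    by (intro tendsto_mult_left K_diff_rQ_lim)
  then have 1: "((\<lambda>t. - \<kappa> * (K t - k) * rQ t) \<longlongrightarrow> 0) (in_prob M)" by (simp add: mult.assoc)
  have 2: "((\<lambda>t. - (K t - k)) \<longlongrightarrow> 0) (in_prob M)"
    using tendsto_minus[OF K_diff_lim] by simp
  have "((\<lambda>t. K t * c * (?z t - \<kappa> * m)) \<longlongrightarrow> k * c * (\<kappa> * m - \<kappa> * m)) (in_prob M)"
    by (intro tendsto_intros K_lim zbar_lim)
  then have 3: "((\<lambda>t. K t * c * (?z t - \<kappa> * m)) \<longlongrightarrow> 0) (in_prob M)" by simp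
  have "((\<lambda>t. K t * rQ t * c * ?h t * \<kappa>) \<longlongrightarrow> m * sqrt p / (\<kappa> * q) * c * 0 * \<kappa>) (in_prob M)"
    by (intro tendsto_intros K_rQ_lim hbar_lim)
  then have 4: "((\<lambda>t. K t * c * ?h t * \<kappa> * rQ t) \<longlongrightarrow> 0) (in_prob M)" by (simp add: ac_simps)
  have "((\<lambda>t. K t * c * ?h t) \<longlongrightarrow> k * c * 0) (in_prob M)"
    by (intro tendsto_intros K_lim hbar_lim)
  then have 5: "((\<lambda>t. K t * c * ?h t) \<longlongrightarrow> 0) (in_prob M)" by simp
  have "((\<lambda>t. - (K t * c * ?z t * ?h t)) \<longlongrightarrow> - (k * c * (\<kappa> * m) * 0)) (in_prob M)"
    by (intro tendsto_intros K_lim zbar_lim hbar_lim)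
  then have 6: "((\<lambda>t. - (K t * c * ?z t * ?h t)) \<longlongrightarrow> 0) (in_prob M)" by simp
  show ?thesis unfolding decomp
    by (intro tendsto_avg_sum_null xi_h_sq_null[OF h_meas h_sq 1] e_sq_null[OF hr_meas hr_sq 2]
        e_sq_null[OF h_meas h_sq 3] xi_sq_null[OF 4] e_sq_null[OF f_meas f_sq 5] tendsto_avg_scalar_null[OF 6])
qed

text \<open>The error \<open>ubar / D\<close> of the slope estimator, scaled by its order \<open>1 / (sqrt n * rQ)\<close>.\<close>

definition G :: "nat \<times> 'a \<Rightarrow> real" where "G t = sqrt (real (fst t)) * (ubar t / D t) * rQ t"

lemma G_bdd: "bdd_in_prob M G"
proof (rule bdd_in_prob_cong)
  define fh where "fh v = f v * h v - \<rho>" for v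
  have fh_meas: "fh \<in> borel_measurable borel" unfolding fh_def by measurable
  have "integrable M (\<lambda>\<omega>. (f (e 1 \<omega>) * h (e 1 \<omega>) + (- \<rho>))\<^sup>2)"
    by (intro square_integrable_add fh_sq) auto
  then have fh2: "integrable M (\<lambda>\<omega>. (fh (e 1 \<omega>))\<^sup>2)" by (simp add: fh_def)
  have fh0: "expectation (\<lambda>\<omega>. fh (e 1 \<omega>)) = 0"
    unfolding fh_def using fh_int fh_mean by (simp add: prob_space)
  let ?r = "\<lambda>t. sqrt (real (fst t)) * avg (fst t) (\<lambda>i. fh (e i (snd t)))"
  let ?h = "\<lambda>t. sqrt (real (fst t)) * avg (fst t) (hh t)"
  have ps: "((\<lambda>t. sqrt (1 / mean_sq t)) \<longlongrightarrow> sqrt p) (in_prob M)" by (intro tendsto_intros p_lim)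
  have di: "((\<lambda>t. 1 / (D t / mean_sq t)) \<longlongrightarrow> 1 / (\<kappa> * q)) (in_prob M)"
    using kappa q_pos by (intro tendsto_intros D_lim) simp
  show "bdd_in_prob M (\<lambda>t. (\<kappa> * N t + (?r t - c * avg (fst t) (zz t) * ?h t) * sqrt (1 / mean_sq t)) * (1 / (D t / mean_sq t)))"
    by (intro bdd_in_prob_add bdd_in_prob_mult bdd_in_prob_diff bdd_in_prob_const N_bdd scaled_h_bdd
        bdd_in_prob_scaled_avg[OF e_iid fh_meas fh2 fh0] bdd_in_prob_tendsto[OF ps] bdd_in_prob_tendsto[OF di]
        bdd_in_prob_tendsto[OF zbar_lim])
  show "\<forall>\<^sub>F t in in_prob M. G t = (\<kappa> * N t + (?r t - c * avg (fst t) (zz t) * ?h t) * sqrt (1 / mean_sq t)) * (1 / (D t / mean_sq t))"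
    using mean_sq_pos eventually_fst_ge_in_prob[of 1]
  proof eventually_elim
    case (elim t)
    let ?n = "fst t"
    define s where "s = sqrt (real ?n)"
    define a where "a = avg ?n (\<lambda>i. \<xi> i (snd t) * h (e i (snd t)))"
    define b where "b = avg ?n (\<lambda>i. f (e i (snd t)) * h (e i (snd t)))"
    define d where "d = avg ?n (hh t)"
    define z where "z = avg ?n (zz t)"
    define R where "R = rQ t"
    have R: "R > 0" "mean_sq t = R * R" "sqrt (1 / mean_sq t) = 1 / R"
      using elim(1) by (simp_all add: rQ_def R_def real_sqrt_divide)
    have r: "avg ?n (\<lambda>i. fh (e i (snd t))) = b - \<rho>"
      using elim(2) by (simp add: fh_def avg_diff avg_const b_def)
    have u: "ubar t = \<kappa> * a + b - c * z * d - \<rho>"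
      unfolding ubar_def S_eq[OF c01] zh_avg by (simp add: a_def b_def z_def d_def)
    have N: "N t = s * a / R" by (simp add: N_def s_def a_def R_def)
    have "(\<kappa> * N t + (s * (b - \<rho>) - c * z * (s * d)) * (1 / R)) * (1 / (D t / (R * R)))
        = (s * ubar t / R) * (1 / (D t / (R * R)))"
      unfolding N u by (simp add: field_simps)
    also have "\<dots> = s * (ubar t / D t) * R" using R(1) by simp
    finally have eq: "(\<kappa> * N t + (s * (b - \<rho>) - c * z * (s * d)) * (1 / R)) * (1 / (D t / (R * R))) = s * (ubar t / D t) * R" .
    show ?case unfolding G_def r s_def[symmetric] d_def[symmetric] z_def[symmetric] R_def[symmetric] R(3)
      unfolding R(2) by (rule eq[symmetric])
  qed
qed

lemma B_rQ_lim: "((\<lambda>t. ubar t / D t * rQ t) \<longlongrightarrow> 0) (in_prob M)"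
proof (rule Lim_transform_eventually)
  from bdd_in_prob_times_null(1)[OF G_bdd inverse_sqrt_tendsto_in_prob]
  show "((\<lambda>t. G t * (1 / sqrt (real (fst t)))) \<longlongrightarrow> 0) (in_prob M)" .
  show "\<forall>\<^sub>F t in in_prob M. G t * (1 / sqrt (real (fst t))) = ubar t / D t * rQ t"
    using eventually_fst_ge_in_prob[of 1] by eventually_elim (simp add: G_def)
qed

lemma B_lim: "((\<lambda>t. ubar t / D t) \<longlongrightarrow> 0) (in_prob M)"
proof (rule Lim_transform_eventually)
  have "((\<lambda>t. ubar t / D t * rQ t * sqrt (1 / mean_sq t)) \<longlongrightarrow> 0 * sqrt p) (in_prob M)"
    by (intro tendsto_mult B_rQ_lim tendsto_real_sqrt p_lim)
  then show "((\<lambda>t. ubar t / D t * rQ t * sqrt (1 / mean_sq t)) \<longlongrightarrow> 0) (in_prob M)" by simp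
  show "\<forall>\<^sub>F t in in_prob M. ubar t / D t * rQ t * sqrt (1 / mean_sq t) = ubar t / D t"
    using mean_sq_pos by eventually_elim (simp add: rQ_def real_sqrt_divide)
qed

text \<open>If \<open>p = 0\<close>, the mean of the fourth powers is at most \<open>n * mean_sq\<^sup>2\<close> and \<open>K * rQ\<close> tends to zero.  Otherwise
  the mean of the fourth powers is of smaller order than \<open>n\<close>, and the other factors converge.\<close>

lemma K_fourth_lim:
  "((\<lambda>t. (K t)\<^sup>2 * (1 / mean_sq t) * (avg (fst t) (\<lambda>i. ((\<xi> i (snd t))\<^sup>2)\<^sup>2) / real (fst t))) \<longlongrightarrow> 0) (in_prob M)"
proof (cases "p = 0")
  case True
  show ?thesis
  proof (rule Lim_null_comparison)
    have "((\<lambda>t. (K t * rQ t)\<^sup>2) \<longlongrightarrow> (m * sqrt p / (\<kappa> * q))\<^sup>2) (in_prob M)" by (intro tendsto_intros K_rQ_lim)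
    then show "((\<lambda>t. (K t * rQ t)\<^sup>2) \<longlongrightarrow> 0) (in_prob M)" using True by simp
    show "\<forall>\<^sub>F t in in_prob M. norm ((K t)\<^sup>2 * (1 / mean_sq t) * (avg (fst t) (\<lambda>i. ((\<xi> i (snd t))\<^sup>2)\<^sup>2) / real (fst t))) \<le> (K t * rQ t)\<^sup>2"
      using mean_sq_pos
    proof eventually_elim
      case (elim t)
      let ?a = "avg (fst t) (\<lambda>i. ((\<xi> i (snd t))\<^sup>2)\<^sup>2) / real (fst t)"
      have "0 \<le> ?a" by (intro divide_nonneg_nonneg avg_nonneg) auto
      then have "0 \<le> (K t)\<^sup>2 * (1 / mean_sq t) * ?a" using elim by (intro mult_nonneg_nonneg) auto
      then have "norm ((K t)\<^sup>2 * (1 / mean_sq t) * ?a) = (K t)\<^sup>2 * (1 / mean_sq t) * ?a"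
        unfolding real_norm_def by (rule abs_of_nonneg)
      also have "\<dots> \<le> (K t)\<^sup>2 * (1 / mean_sq t) * (mean_sq t)\<^sup>2"
        using elim avg_squares_le[of "\<lambda>i. (\<xi> i (snd t))\<^sup>2" "fst t"]
        by (intro mult_left_mono) (simp_all add: mean_sq_def)
      also have "\<dots> = (K t * rQ t)\<^sup>2"
        using elim by (simp add: rQ_def power_mult_distrib power2_eq_square[of "mean_sq t"])
      finally show ?case .
    qed
  qed
next
  case False
  have "((\<lambda>t. (K t)\<^sup>2 * (1 / mean_sq t) * (avg (fst t) (\<lambda>i. ((\<xi> i (snd t))\<^sup>2)\<^sup>2) / real (fst t))) \<longlongrightarrow> k\<^sup>2 * p * 0) (in_prob M)"
    by (intro tendsto_mult tendsto_power K_lim p_lim fourth_power_mean_negligible[OF p_int[OF False]])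
  then show ?thesis by simp
qed

lemma xi_fourth_null:
  "((\<lambda>t. avg (fst t) (\<lambda>i. (ubar t / D t * K t * \<kappa> * (\<xi> i (snd t))\<^sup>2)\<^sup>2)) \<longlongrightarrow> 0) (in_prob M)"
proof (rule tendsto_avg_scaled_null, rule Lim_transform_eventually)
  let ?L = "\<lambda>t. (K t)\<^sup>2 * (1 / mean_sq t) * (avg (fst t) (\<lambda>i. ((\<xi> i (snd t))\<^sup>2)\<^sup>2) / real (fst t))"
  have "((\<lambda>t. \<kappa>\<^sup>2 * (G t * (G t * ?L t))) \<longlongrightarrow> \<kappa>\<^sup>2 * 0) (in_prob M)"
    by (intro tendsto_mult_left bdd_in_prob_times_null(1)[OF G_bdd] K_fourth_lim)
  then show "((\<lambda>t. \<kappa>\<^sup>2 * (G t * (G t * ?L t))) \<longlongrightarrow> 0) (in_prob M)" by simp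
  show "\<forall>\<^sub>F t in in_prob M. \<kappa>\<^sup>2 * (G t * (G t * ?L t)) =
      (ubar t / D t * K t * \<kappa>)\<^sup>2 * avg (fst t) (\<lambda>i. ((\<xi> i (snd t))\<^sup>2)\<^sup>2)"
    using mean_sq_pos eventually_fst_ge_in_prob[of 1]
  proof eventually_elim
    case (elim t)
    define b where "b = ubar t / D t"
    define a where "a = avg (fst t) (\<lambda>i. ((\<xi> i (snd t))\<^sup>2)\<^sup>2)"
    have "G t * G t = real (fst t) * b\<^sup>2 * mean_sq t"
    proof -
      have "sqrt (real (fst t)) * sqrt (real (fst t)) = real (fst t)" "rQ t * rQ t = mean_sq t"
        using elim(1) by (simp_all add: rQ_def)
      moreover have "G t * G t = (sqrt (real (fst t)) * sqrt (real (fst t))) * (b * b) * (rQ t * rQ t)"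
        by (simp add: G_def b_def[symmetric] ac_simps)
      ultimately show ?thesis by (simp only: power2_eq_square)
    qed
    then have "\<kappa>\<^sup>2 * (G t * (G t * ?L t)) = \<kappa>\<^sup>2 * (real (fst t) * b\<^sup>2 * mean_sq t) * ?L t"
      by (simp only: mult.assoc[symmetric])
    also have "\<dots> = (b * K t * \<kappa>)\<^sup>2 * a"
      unfolding a_def[symmetric] using elim by (simp add: power_mult_distrib)
    finally show ?case by (simp only: a_def b_def)
  qed
qed

text \<open>The difference of \<open>W\<close> and \<open>V\<close> is \<open>ubar / D\<close> times a quadratic polynomial in \<open>\<xi>\<close> and the errors.  The critical
  monomial is \<open>\<xi>\<^sup>2\<close>, whose mean square is controlled by \<open>K_fourth_lim\<close>; the other ones are covered by
  \<open>ubar / D * rQ\<close> tending to zero.\<close>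

lemma W_close: "((\<lambda>t. avg (fst t) (\<lambda>i. (W t i - w i (snd t))\<^sup>2)) \<longlongrightarrow> 0) (in_prob M)"
proof -
  let ?z = "\<lambda>t. avg (fst t) (zz t)" and ?x = "\<lambda>t. avg (fst t) (xx t)" and ?B = "\<lambda>t. ubar t / D t"
  define gf where "gf v = \<kappa> * g v + f v" for v
  define fg where "fg v = f v * g v" for v
  have gf_meas: "gf \<in> borel_measurable borel" and fg_meas: "fg \<in> borel_measurable borel"
    unfolding gf_def fg_def by measurable
  have gf2: "integrable M (\<lambda>\<omega>. (gf (e 1 \<omega>))\<^sup>2)"
    unfolding gf_def by (intro square_integrable_add square_integrable_cmult g_sq f_sq) measurable
  have fg2: "integrable M (\<lambda>\<omega>. (fg (e 1 \<omega>))\<^sup>2)" unfolding fg_def by (rule fg_sq)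
  have decomp: "W t i - w i (snd t) = (V t i - w i (snd t))
      + ?B t * (- 1 - K t * c * ?z t - K t * c * ?x t * \<kappa>) * \<xi> i (snd t)
      + ?B t * (- 1 - K t * c * ?z t) * g (e i (snd t))
      + ?B t * (- K t * c * ?x t) * f (e i (snd t))
      + ?B t * K t * \<kappa> * (\<xi> i (snd t))\<^sup>2
      + ?B t * K t * (\<xi> i (snd t) * gf (e i (snd t)))
      + ?B t * K t * fg (e i (snd t))
      + ?B t * (K t * (c * ?z t * ?x t - \<tau>))" for t i
  proof -
    have "cross c (fst t) (zz t) (xx t) i = zz t i * xx t i - c * ?z t * xx t i - c * ?x t * zz t i + c * ?z t * ?x t"
      using c01 by (auto simp: cross_def algebra_simps)
    note cross = this
    define B where "B = ?B t"
    show ?thesis unfolding W_def cross B_def[symmetric]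
      by (simp add: zz_def xx_def gf_def fg_def power2_eq_square algebra_simps)
  qed
  have "((\<lambda>t. ?B t * rQ t * (- 1 - K t * c * ?z t - K t * c * ?x t * \<kappa>)) \<longlongrightarrow>
      0 * (- 1 - k * c * (\<kappa> * m) - k * c * m * \<kappa>)) (in_prob M)"
    by (intro tendsto_mult tendsto_diff tendsto_const B_rQ_lim K_lim zbar_lim xbar_lim)
  then have 1: "((\<lambda>t. ?B t * (- 1 - K t * c * ?z t - K t * c * ?x t * \<kappa>) * rQ t) \<longlongrightarrow> 0) (in_prob M)"
    by (simp only: mult_zero_left mult.assoc mult.commute[of "rQ _"])
  have "((\<lambda>t. ?B t * (- 1 - K t * c * ?z t)) \<longlongrightarrow> 0 * (- 1 - k * c * (\<kappa> * m))) (in_prob M)"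
    by (intro tendsto_mult tendsto_diff tendsto_const B_lim K_lim zbar_lim)
  then have 2: "((\<lambda>t. ?B t * (- 1 - K t * c * ?z t)) \<longlongrightarrow> 0) (in_prob M)" by simp
  have "((\<lambda>t. ?B t * (- K t * c * ?x t)) \<longlongrightarrow> 0 * (- k * c * m)) (in_prob M)"
    by (intro tendsto_mult tendsto_minus tendsto_const B_lim K_lim xbar_lim)
  then have 3: "((\<lambda>t. ?B t * (- K t * c * ?x t)) \<longlongrightarrow> 0) (in_prob M)" by simp
  have "((\<lambda>t. ?B t * rQ t * K t) \<longlongrightarrow> 0 * k) (in_prob M)"
    by (intro tendsto_mult B_rQ_lim K_lim)
  then have 5: "((\<lambda>t. ?B t * K t * rQ t) \<longlongrightarrow> 0) (in_prob M)"
    by (simp only: mult_zero_left mult.assoc mult.commute[of "rQ _"])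
  have "((\<lambda>t. ?B t * K t) \<longlongrightarrow> 0 * k) (in_prob M)" by (intro tendsto_mult B_lim K_lim)
  then have 6: "((\<lambda>t. ?B t * K t) \<longlongrightarrow> 0) (in_prob M)" by simp
  have "((\<lambda>t. ?B t * (K t * (c * ?z t * ?x t - \<tau>))) \<longlongrightarrow> 0 * (k * (c * (\<kappa> * m) * m - \<tau>))) (in_prob M)"
    by (intro tendsto_mult tendsto_diff tendsto_const B_lim K_lim zbar_lim xbar_lim)
  then have 7: "((\<lambda>t. ?B t * (K t * (c * ?z t * ?x t - \<tau>))) \<longlongrightarrow> 0) (in_prob M)" by simp
  show ?thesis unfolding decomp
    by (intro tendsto_avg_sum_null V_close xi_sq_null[OF 1] e_sq_null[OF g_meas g_sq 2] e_sq_null[OF f_meas f_sq 3]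
        xi_fourth_null xi_h_sq_null[OF gf_meas gf2 5] e_sq_null[OF fg_meas fg2 6] tendsto_avg_scalar_null[OF 7])
qed

end

context structural_sample
begin

lemma product_expectation:
  fixes a :: "real \<Rightarrow> real" and b :: "real \<times> real \<Rightarrow> real"
  assumes a: "a \<in> borel_measurable borel" "integrable M (\<lambda>\<omega>. a (\<xi> 1 \<omega>))"
    and b: "b \<in> borel_measurable borel" "integrable M (\<lambda>\<omega>. b (e 1 \<omega>))"
  shows "integrable M (\<lambda>\<omega>. a (\<xi> 1 \<omega>) * b (e 1 \<omega>))"
    and "expectation (\<lambda>\<omega>. a (\<xi> 1 \<omega>) * b (e 1 \<omega>)) = expectation (\<lambda>\<omega>. a (\<xi> 1 \<omega>)) * expectation (\<lambda>\<omega>. b (e 1 \<omega>))"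
proof -
  have am: "(\<lambda>f. a (f 1)) \<in> borel_measurable (\<Pi>\<^sub>M i\<in>{1::nat..}. borel)"
    by (rule measurable_compose[OF coordinate_measurable a(1)]) simp
  have bm: "(\<lambda>f. b (f 1)) \<in> borel_measurable (\<Pi>\<^sub>M i\<in>{1::nat..}. borel)"
    by (rule measurable_compose[OF coordinate_measurable b(1)]) simp
  note ce = cross_expectation[OF am bm]
  have eqs: "xi_seq \<omega> 1 = \<xi> 1 \<omega>" "e_seq \<omega> 1 = e 1 \<omega>" for \<omega> by simp_all
  show "integrable M (\<lambda>\<omega>. a (\<xi> 1 \<omega>) * b (e 1 \<omega>))"
    using ce(1) a(2) b(2) unfolding eqs .
  show "expectation (\<lambda>\<omega>. a (\<xi> 1 \<omega>) * b (e 1 \<omega>)) = expectation (\<lambda>\<omega>. a (\<xi> 1 \<omega>)) * expectation (\<lambda>\<omega>. b (e 1 \<omega>))"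
    using ce(2) a(2) b(2) unfolding eqs .
qed

end

context slope_equation
begin

lemma w_iid: "iid_on M borel {1..} w"
proof -
  have "(\<lambda>z. h (snd z) - k * (\<kappa> * (fst z * h (snd z)) + hr (snd z))) \<in> borel_measurable (borel \<Otimes>\<^sub>M borel)"
    by measurable
  from iid_on_compose[OF joint_iid this] show ?thesis
    unfolding w_def[abs_def] fst_conv snd_conv .
qed

lemma w_split: "w i \<omega> = (h (e i \<omega>) - k * hr (e i \<omega>)) + \<xi> i \<omega> * (- (k * \<kappa>) * h (e i \<omega>))"
  by (simp add: w_def algebra_simps)

lemma w_mean: "expectation (w 1) = 0"
proof -
  have hr_int: "integrable M (\<lambda>\<omega>. hr (e 1 \<omega>))"
    by (rule square_integrable_imp_integrable[OF _ hr_sq]) measurable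
  note xh = product_expectation[of "\<lambda>x. x" h, OF _ xi_int h_meas h_int]
  have xh': "integrable M (\<lambda>\<omega>. \<xi> 1 \<omega> * h (e 1 \<omega>))" "expectation (\<lambda>\<omega>. \<xi> 1 \<omega> * h (e 1 \<omega>)) = 0"
    using xh h_mean by auto
  have "expectation (w 1) = expectation (\<lambda>\<omega>. h (e 1 \<omega>)) - k * (\<kappa> * expectation (\<lambda>\<omega>. \<xi> 1 \<omega> * h (e 1 \<omega>)) + expectation (\<lambda>\<omega>. hr (e 1 \<omega>)))"
    unfolding w_def[abs_def] using h_int hr_int xh'(1) by simp
  then show ?thesis using h_mean hr_mean xh'(2) by simp
qed

text \<open>Write \<open>w = a + \<xi> * b\<close> with \<open>a\<close>, \<open>b\<close> depending on the errors only.  By independence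
  \<open>E w\<^sup>2 = E (a + m b)\<^sup>2 + Var \<xi> * E b\<^sup>2\<close>, and \<open>b\<close> is a non-zero multiple of the residual error unless
  \<open>k = 0\<close>, in which case \<open>w\<close> is the residual error itself.  For \<open>k \<noteq> 0\<close> also \<open>p \<noteq> 0\<close>, so that \<open>Var \<xi>\<close> is
  finite.\<close>

lemma w_second_moment:
  shows "integrable M (\<lambda>\<omega>. (w 1 \<omega>)\<^sup>2)" and "0 < expectation (\<lambda>\<omega>. (w 1 \<omega>)\<^sup>2)"
proof -
  have "integrable M (\<lambda>\<omega>. (w 1 \<omega>)\<^sup>2) \<and> 0 < expectation (\<lambda>\<omega>. (w 1 \<omega>)\<^sup>2)"
  proof (cases "k = 0")
    case True
    then have "w 1 \<omega> = h (e 1 \<omega>)" for \<omega> by (simp add: w_def)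
    then show ?thesis using h_sq h_pos by simp
  next
    case False
    have "p \<noteq> 0"
    proof
      assume "p = 0"
      then have "k = 0" unfolding k_def by simp
      with False show False ..
    qed
    note xi2 = p_int[OF this]
    define a where "a v = h v - k * hr v" for v
    define b where "b v = - (k * \<kappa>) * h v" for v
    have [measurable]: "a \<in> borel_measurable borel" "b \<in> borel_measurable borel"
      unfolding a_def b_def by measurable
    have "integrable M (\<lambda>\<omega>. (h (e 1 \<omega>) + (- k) * hr (e 1 \<omega>))\<^sup>2)"
      by (intro square_integrable_add square_integrable_cmult h_sq hr_sq) measurable
    then have a2: "integrable M (\<lambda>\<omega>. (a (e 1 \<omega>))\<^sup>2)" by (simp add: a_def)
    have b2: "integrable M (\<lambda>\<omega>. (b (e 1 \<omega>))\<^sup>2)"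
      unfolding b_def by (rule square_integrable_cmult[OF h_sq])
    have ab: "integrable M (\<lambda>\<omega>. a (e 1 \<omega>) * b (e 1 \<omega>))"
      by (rule integrable_product_of_squares[OF _ _ a2 b2]) measurable
    have Eb2: "expectation (\<lambda>\<omega>. (b (e 1 \<omega>))\<^sup>2) = (k * \<kappa>)\<^sup>2 * expectation (\<lambda>\<omega>. (h (e 1 \<omega>))\<^sup>2)"
      unfolding b_def by (simp add: power_mult_distrib)
    then have b2_pos: "0 < expectation (\<lambda>\<omega>. (b (e 1 \<omega>))\<^sup>2)" using False kappa h_pos by simp
    note 1 = product_expectation[of "\<lambda>x. x" "\<lambda>v. a v * b v", OF _ xi_int _ ab]
    note 2 = product_expectation[of "\<lambda>x. x\<^sup>2" "\<lambda>v. (b v)\<^sup>2", OF _ xi2 _ b2]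
    have 1: "integrable M (\<lambda>\<omega>. \<xi> 1 \<omega> * (a (e 1 \<omega>) * b (e 1 \<omega>)))"
      "expectation (\<lambda>\<omega>. \<xi> 1 \<omega> * (a (e 1 \<omega>) * b (e 1 \<omega>))) = m * expectation (\<lambda>\<omega>. a (e 1 \<omega>) * b (e 1 \<omega>))"
      by (rule 1; measurable)+
    have 2: "integrable M (\<lambda>\<omega>. (\<xi> 1 \<omega>)\<^sup>2 * (b (e 1 \<omega>))\<^sup>2)"
      "expectation (\<lambda>\<omega>. (\<xi> 1 \<omega>)\<^sup>2 * (b (e 1 \<omega>))\<^sup>2) = expectation (\<lambda>\<omega>. (\<xi> 1 \<omega>)\<^sup>2) * expectation (\<lambda>\<omega>. (b (e 1 \<omega>))\<^sup>2)"
      by (rule 2; measurable)+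
    have eq: "(w 1 \<omega>)\<^sup>2 = (a (e 1 \<omega>))\<^sup>2 + 2 * (\<xi> 1 \<omega> * (a (e 1 \<omega>) * b (e 1 \<omega>))) + (\<xi> 1 \<omega>)\<^sup>2 * (b (e 1 \<omega>))\<^sup>2" for \<omega>
      unfolding w_split a_def[symmetric] b_def[symmetric] by (simp add: power2_eq_square algebra_simps)
    have int: "integrable M (\<lambda>\<omega>. (w 1 \<omega>)\<^sup>2)" unfolding eq using a2 1(1) 2(1) by simp
    have sq: "expectation (\<lambda>\<omega>. (a (e 1 \<omega>) + m * b (e 1 \<omega>))\<^sup>2) =
        expectation (\<lambda>\<omega>. (a (e 1 \<omega>))\<^sup>2) + 2 * (m * expectation (\<lambda>\<omega>. a (e 1 \<omega>) * b (e 1 \<omega>))) + m\<^sup>2 * expectation (\<lambda>\<omega>. (b (e 1 \<omega>))\<^sup>2)"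
    proof -
      have "(a v + m * b v)\<^sup>2 = (a v)\<^sup>2 + 2 * (m * (a v * b v)) + m\<^sup>2 * (b v)\<^sup>2" for v
        by (simp add: power2_eq_square algebra_simps)
      then show ?thesis using a2 ab b2 by simp
    qed
    have "expectation (\<lambda>\<omega>. (w 1 \<omega>)\<^sup>2) = expectation (\<lambda>\<omega>. (a (e 1 \<omega>))\<^sup>2) + 2 * (m * expectation (\<lambda>\<omega>. a (e 1 \<omega>) * b (e 1 \<omega>)))
        + expectation (\<lambda>\<omega>. (\<xi> 1 \<omega>)\<^sup>2) * expectation (\<lambda>\<omega>. (b (e 1 \<omega>))\<^sup>2)"
      unfolding eq 1(2)[symmetric] 2(2)[symmetric] using a2 1(1) 2(1) by simp
    also have "\<dots> = expectation (\<lambda>\<omega>. (a (e 1 \<omega>) + m * b (e 1 \<omega>))\<^sup>2)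
        + (expectation (\<lambda>\<omega>. (\<xi> 1 \<omega>)\<^sup>2) - m\<^sup>2) * expectation (\<lambda>\<omega>. (b (e 1 \<omega>))\<^sup>2)"
      unfolding sq by (simp add: algebra_simps)
    also have "\<dots> > 0"
    proof (rule add_nonneg_pos)
      show "0 \<le> expectation (\<lambda>\<omega>. (a (e 1 \<omega>) + m * b (e 1 \<omega>))\<^sup>2)"
        by (rule Bochner_Integration.integral_nonneg) simp
      show "0 < (expectation (\<lambda>\<omega>. (\<xi> 1 \<omega>)\<^sup>2) - m\<^sup>2) * expectation (\<lambda>\<omega>. (b (e 1 \<omega>))\<^sup>2)"
        using xi_second_moment_gt[OF xi2] b2_pos by simp
    qed
    finally show ?thesis using int by simp
  qed
  then show "integrable M (\<lambda>\<omega>. (w 1 \<omega>)\<^sup>2)" "0 < expectation (\<lambda>\<omega>. (w 1 \<omega>)\<^sup>2)" by simp_all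
qed

lemma studentized_weak_conv:
  assumes R: "((\<lambda>t. avg (fst t) (\<lambda>i. (R (fst t) (snd t) i - w i (snd t))\<^sup>2)) \<longlongrightarrow> 0) (in_prob M)"
    and T: "\<forall>\<^sub>F t in in_prob M. T (fst t) (snd t) = sqrt (real (fst t)) * (avg (fst t) (hh t) - K t * ubar t)"
    and meas: "\<And>n. (\<lambda>\<omega>. T n \<omega> * sample_variance n (R n \<omega>) powr (- 1 / 2)) \<in> borel_measurable M"
  shows "weak_conv_m (\<lambda>n. distr M borel (\<lambda>\<omega>. T n \<omega> * sample_variance n (R n \<omega>) powr (- 1 / 2)))
    std_normal_distribution"
proof (rule studentized_mean_weak_conv[OF w_iid w_mean w_second_moment R _ meas])
  show "((\<lambda>t. T (fst t) (snd t) - sqrt (real (fst t)) * avg (fst t) (\<lambda>i. w i (snd t))) \<longlongrightarrow> 0) (in_prob M)"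
    by (rule Lim_transform_eventually[OF numerator_lim], rule eventually_mono[OF T]) simp
qed

end

section \<open>The intercept estimators\<close>

lemma avg_measurable:
  assumes [measurable]: "\<And>i. 1 \<le> i \<Longrightarrow> X i \<in> borel_measurable M"
  shows "(\<lambda>\<omega>. avg n (\<lambda>i. X i \<omega>)) \<in> borel_measurable M"
  unfolding avg_def by measurable

lemma cross_measurable:
  assumes [measurable]: "\<And>i. 1 \<le> i \<Longrightarrow> X i \<in> borel_measurable M" "\<And>i. 1 \<le> i \<Longrightarrow> Y i \<in> borel_measurable M"
    and i: "1 \<le> i"
  shows "(\<lambda>\<omega>. cross c n (\<lambda>i. X i \<omega>) (\<lambda>i. Y i \<omega>) i) \<in> borel_measurable M"
proof -
  have [measurable]: "(\<lambda>\<omega>. avg n (\<lambda>i. X i \<omega>)) \<in> borel_measurable M" "(\<lambda>\<omega>. avg n (\<lambda>i. Y i \<omega>)) \<in> borel_measurable M"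
    "X i \<in> borel_measurable M" "Y i \<in> borel_measurable M"
    using i by (auto intro: avg_measurable assms)
  show ?thesis unfolding cross_def by measurable
qed

lemma S_measurable:
  assumes "\<And>i. 1 \<le> i \<Longrightarrow> X i \<in> borel_measurable M" "\<And>i. 1 \<le> i \<Longrightarrow> Y i \<in> borel_measurable M"
  shows "(\<lambda>\<omega>. S c n (\<lambda>i. X i \<omega>) (\<lambda>i. Y i \<omega>)) \<in> borel_measurable M"
  unfolding S_def by (intro avg_measurable cross_measurable assms)

lemma estimator_measurable:
  assumes X: "\<And>i. 1 \<le> i \<Longrightarrow> X i \<in> borel_measurable M" and Y: "\<And>i. 1 \<le> i \<Longrightarrow> Y i \<in> borel_measurable M"
  shows "(\<lambda>\<omega>. beta_hat j c lam th mu n (\<lambda>i. X i \<omega>) (\<lambda>i. Y i \<omega>)) \<in> borel_measurable M"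
    and "(\<lambda>\<omega>. alpha_hat j c lam th mu n (\<lambda>i. X i \<omega>) (\<lambda>i. Y i \<omega>)) \<in> borel_measurable M"
    and "b \<in> borel_measurable M \<Longrightarrow>
      (\<lambda>\<omega>. sample_variance n (v_term j c lam th mu a (b \<omega>) n (\<lambda>i. X i \<omega>) (\<lambda>i. Y i \<omega>))) \<in> borel_measurable M"
proof -
  note [measurable] = S_measurable[OF X X] S_measurable[OF X Y] S_measurable[OF Y Y] avg_measurable[OF X] avg_measurable[OF Y]
  show beta [measurable]: "(\<lambda>\<omega>. beta_hat j c lam th mu n (\<lambda>i. X i \<omega>) (\<lambda>i. Y i \<omega>)) \<in> borel_measurable M"
    unfolding beta_hat_def by measurable
  show "(\<lambda>\<omega>. alpha_hat j c lam th mu n (\<lambda>i. X i \<omega>) (\<lambda>i. Y i \<omega>)) \<in> borel_measurable M"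
    unfolding alpha_hat_def by measurable
  assume b [measurable]: "b \<in> borel_measurable M"
  have U [measurable]: "(\<lambda>\<omega>. U j c th mu n (\<lambda>i. X i \<omega>) (\<lambda>i. Y i \<omega>)) \<in> borel_measurable M"
    unfolding U_def by measurable
  have v: "(\<lambda>\<omega>. v_term j c lam th mu a (b \<omega>) n (\<lambda>i. X i \<omega>) (\<lambda>i. Y i \<omega>) i) \<in> borel_measurable M" if "1 \<le> i" for i
  proof -
    note [measurable] = cross_measurable[OF X X that] cross_measurable[OF X Y that] cross_measurable[OF Y Y that]
      X[OF that] Y[OF that]
    show ?thesis unfolding v_term_def u_term_def by measurable
  qed
  note v' [measurable] = avg_measurable[of "\<lambda>i \<omega>. v_term j c lam th mu a (b \<omega>) n (\<lambda>i. X i \<omega>) (\<lambda>i. Y i \<omega>) i", OF v]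
  note v [measurable]
  show "(\<lambda>\<omega>. sample_variance n (v_term j c lam th mu a (b \<omega>) n (\<lambda>i. X i \<omega>) (\<lambda>i. Y i \<omega>))) \<in> borel_measurable M"
    unfolding sample_variance_def
    by (intro borel_measurable_divide borel_measurable_sum borel_measurable_power borel_measurable_diff borel_measurable_const v v') auto
qed

lemma cross_commute: "cross c n u v = cross c n v u"
  by (simp add: cross_def fun_eq_iff mult.commute)

text \<open>Shifts of the sample are removed by centring if \<open>c = 1\<close>.\<close>

lemma cross_cong:
  assumes "\<And>i. 1 \<le> i \<Longrightarrow> u i = u' i + a" "\<And>i. 1 \<le> i \<Longrightarrow> v i = v' i + b"
    and "1 \<le> n" "1 \<le> i" and "c = 1 \<or> (c = 0 \<and> a = 0 \<and> b = 0)"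
  shows "cross c n u v i = cross c n u' v' i"
proof -
  have "avg n u = avg n (\<lambda>i. u' i + a)" "avg n v = avg n (\<lambda>i. v' i + b)"
    by (intro avg_cong assms; assumption)+
  then have "avg n u = avg n u' + a" "avg n v = avg n v' + b"
    using assms(3) by (simp_all add: avg_add avg_const)
  then show ?thesis using assms by (auto simp: cross_def)
qed

lemma cross_linear_right:
  "cross c n u (\<lambda>i. v i - b * x i) i = cross c n u v i - b * cross c n u x i"
  by (simp add: cross_def avg_diff avg_cmult algebra_simps)

text \<open>This reduces both estimators to the common form of \<open>slope_equation\<close>.  The slope \<open>b\<close> enters \<open>v_term\<close>
  linearly, so the expansion around \<open>\<beta>\<close> serves for the true and for the estimated slope.\<close>

lemma estimator_expansion:
  fixes X Y x y z hs :: "nat \<Rightarrow> real"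
  assumes X: "\<And>i. 1 \<le> i \<Longrightarrow> X i = x i" and Y: "\<And>i. 1 \<le> i \<Longrightarrow> Y i = y i + \<alpha>"
    and n: "1 \<le> n" and c: "c = 1 \<or> (c = 0 \<and> \<alpha> = 0)" and j: "j \<in> {1, 2}"
    and z: "z = (if j = 1 then y else x)" and hs: "hs = (\<lambda>i. y i - \<beta> * x i)"
    and \<rho>: "\<rho> = (if j = 1 then lam * \<theta> - \<beta> * \<mu> else \<mu> - \<beta> * \<theta>)"
    and \<tau>: "\<tau> = (if j = 1 then \<mu> else \<theta>)"
  shows "1 \<le> i \<Longrightarrow> v_term j c lam \<theta> \<mu> \<alpha> b n X Y i =
      hs i - avg n x / (S c n z x - \<tau>) * (cross c n z hs i - \<rho>)
      - (b - \<beta>) * (x i - avg n x / (S c n z x - \<tau>) * (cross c n z x i - \<tau>))"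
    and "(j = 1 \<longrightarrow> S c n z x - \<tau> \<noteq> 0 \<and> S c n y y - lam * \<theta> > 0) \<Longrightarrow> (j = 2 \<longrightarrow> S c n z x - \<tau> > 0) \<Longrightarrow>
      beta_hat j c lam \<theta> \<mu> n X Y - \<beta> = (S c n z hs - \<rho>) / (S c n z x - \<tau>)"
    and "alpha_hat j c lam \<theta> \<mu> n X Y - \<alpha> = avg n hs - avg n x * (beta_hat j c lam \<theta> \<mu> n X Y - \<beta>)"
proof -
  have X0: "\<And>i. 1 \<le> i \<Longrightarrow> X i = x i + 0" using X by simp
  have cr: "cross c n X X i = cross c n x x i" "cross c n X Y i = cross c n y x i" "cross c n Y Y i = cross c n y y i"
    if "1 \<le> i" for i
    using cross_cong[OF X0 X0 n that] cross_cong[OF X0 Y n that] cross_cong[OF Y Y n that] c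
    by (auto simp: cross_commute[of c n x y])
  have Sr: "S c n X X = S c n x x" "S c n X Y = S c n y x" "S c n Y Y = S c n y y"
    unfolding S_def by (intro avg_cong cr; assumption)+
  have avgX: "avg n X = avg n x" by (intro avg_cong X)
  have "avg n Y = avg n (\<lambda>i. y i + \<alpha>)" by (intro avg_cong Y)
  then have avgY: "avg n Y = avg n y + \<alpha>" using n by (simp add: avg_add avg_const)
  have avgh: "avg n hs = avg n y - \<beta> * avg n x" by (simp add: hs avg_diff avg_cmult)
  have crh: "cross c n u hs i = cross c n u y i - \<beta> * cross c n u x i" for u i
    unfolding hs by (rule cross_linear_right)
  have Sh: "S c n u hs = S c n u y - \<beta> * S c n u x" for u
    unfolding S_def avg_cmult[symmetric] avg_diff[symmetric] by (intro avg_cong crh)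
  have U: "U j c \<theta> \<mu> n X Y = S c n z x - \<tau>"
    by (simp add: U_def Sr z \<tau>)
  show "alpha_hat j c lam \<theta> \<mu> n X Y - \<alpha> = avg n hs - avg n x * (beta_hat j c lam \<theta> \<mu> n X Y - \<beta>)"
    by (simp add: alpha_hat_def avgX avgY avgh algebra_simps)
  show "v_term j c lam \<theta> \<mu> \<alpha> b n X Y i =
      hs i - avg n x / (S c n z x - \<tau>) * (cross c n z hs i - \<rho>)
      - (b - \<beta>) * (x i - avg n x / (S c n z x - \<tau>) * (cross c n z x i - \<tau>))" if i: "1 \<le> i"
  proof -
    define k where "k = avg n x / (S c n z x - \<tau>)"
    have u: "u_term j c lam \<theta> \<mu> b n X Y i = (cross c n z hs i - \<rho>) - (b - \<beta>) * (cross c n z x i - \<tau>)"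
      unfolding u_term_def cr[OF i] crh z \<rho> \<tau> by (simp add: cross_commute[of c n x y] algebra_simps)
    show ?thesis
      unfolding v_term_def u U avgX k_def[symmetric] X[OF i] Y[OF i] by (simp add: hs algebra_simps)
  qed
  assume 1: "j = 1 \<longrightarrow> S c n z x - \<tau> \<noteq> 0 \<and> S c n y y - lam * \<theta> > 0" and 2: "j = 2 \<longrightarrow> S c n z x - \<tau> > 0"
  have Sxy: "S c n x y = S c n y x" unfolding S_def cross_commute[of c n x y] ..
  show "beta_hat j c lam \<theta> \<mu> n X Y - \<beta> = (S c n z hs - \<rho>) / (S c n z x - \<tau>)"
  proof (cases "j = 1")
    case True
    then have d: "S c n y x - \<mu> \<noteq> 0" "S c n y y - lam * \<theta> > 0" using 1 by (simp_all add: z \<tau>)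
    then show ?thesis using True
      by (simp add: beta_hat_def Sr z \<tau> \<rho> Sh diff_divide_distrib[symmetric] divide_diff_eq_iff algebra_simps)
  next
    case False
    then have "j = 2" using j by simp
    then have d: "S c n x x - \<theta> > 0" using 2 by (simp add: z \<tau>)
    then show ?thesis using False
      by (simp add: beta_hat_def Sr z \<tau> \<rho> Sh Sxy divide_diff_eq_iff algebra_simps)
  qed
qed

theorem theorem3:
  fixes M :: "'a measure"
    and \<delta> \<epsilon> \<xi> x y :: "nat \<Rightarrow> 'a \<Rightarrow> real"
    and \<alpha> \<beta> lam \<theta> \<mu> c :: real
    and j :: nat
  assumes "prob_space M"
    and model_y: "\<And>i \<omega>. i \<ge> 1 \<Longrightarrow> \<omega> \<in> space M \<Longrightarrow> y i \<omega> = \<beta> * \<xi> i \<omega> + \<alpha> + \<delta> i \<omega>"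
    and model_x: "\<And>i \<omega>. i \<ge> 1 \<Longrightarrow> \<omega> \<in> space M \<Longrightarrow> x i \<omega> = \<xi> i \<omega> + \<epsilon> i \<omega>"
    and A_iid: "iid_on M (borel :: (real \<times> real) measure) {1..} (\<lambda>i \<omega>. (\<delta> i \<omega>, \<epsilon> i \<omega>))"
    and A_mean: "\<And>i. i \<ge> 1 \<Longrightarrow> (LINT \<omega>|M. \<delta> i \<omega>) = 0"
                "\<And>i. i \<ge> 1 \<Longrightarrow> (LINT \<omega>|M. \<epsilon> i \<omega>) = 0"
    and A_moments: "\<And>i. i \<ge> 1 \<Longrightarrow> integrable M (\<lambda>\<omega>. \<delta> i \<omega> ^ 4)"
                   "\<And>i. i \<ge> 1 \<Longrightarrow> integrable M (\<lambda>\<omega>. \<epsilon> i \<omega> ^ 4)"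
    and A_cov: "\<And>i. i \<ge> 1 \<Longrightarrow>
                  covariance_matrix M (\<delta> i) (\<epsilon> i) = vector [vector [lam * \<theta>, \<mu>], vector [\<mu>, \<theta>]]"
    and A_pos_def: "positive_definite (vector [vector [lam * \<theta>, \<mu>], vector [\<mu>, \<theta>]] :: real^2^2)"
    and B_iid: "iid_on M (borel :: real measure) {1..} \<xi>"
    and B_DAN: "DAN M \<xi>"
    and C: "independent_elements M
              (\<Pi>\<^sub>M i\<in>{1..}. (borel :: real measure)) (\<lambda>\<omega>. \<lambda>i\<in>{1::nat..}. \<xi> i \<omega>)
              (\<Pi>\<^sub>M i\<in>{1..}. (borel :: (real \<times> real) measure)) (\<lambda>\<omega>. \<lambda>i\<in>{1::nat..}. (\<delta> i \<omega>, \<epsilon> i \<omega>))"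
    and c_switch: "c = 1 \<or> (c = 0 \<and> \<alpha> = 0)"
    and "j \<in> {1, 2}"
    and slope: "j = 1 \<Longrightarrow> \<beta> \<noteq> 0"
  shows "weak_conv_m
           (\<lambda>n. distr M borel (\<lambda>\<omega>.
              let X = (\<lambda>i. x i \<omega>); Y = (\<lambda>i. y i \<omega>) in
              sqrt (real n) * (alpha_hat j c lam \<theta> \<mu> n X Y - \<alpha>)
                * sample_variance n (v_term j c lam \<theta> \<mu> \<alpha> \<beta> n X Y) powr (- 1 / 2)))
           std_normal_distribution
         \<and>
         weak_conv_m
           (\<lambda>n. distr M borel (\<lambda>\<omega>.
              let X = (\<lambda>i. x i \<omega>); Y = (\<lambda>i. y i \<omega>) in
              sqrt (real n) * (alpha_hat j c lam \<theta> \<mu> n X Y - \<alpha>)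
                * sample_variance n (v_tilde j c lam \<theta> \<mu> \<alpha> n X Y) powr (- 1 / 2)))
           std_normal_distribution"
proof -
  interpret prob_space M by fact
  define e where "e i \<omega> = (\<delta> i \<omega>, \<epsilon> i \<omega>)" for i \<omega>
  have e_iid: "iid_on M borel {1..} e" using A_iid unfolding e_def[abs_def] .
  interpret ss: structural_sample M \<xi> e
  proof (rule structural_sample.intro, fact, rule structural_sample_axioms.intro)
    show "iid_on M borel {1..} \<xi>" by (rule B_iid)
    show "iid_on M borel {1..} e" by (rule e_iid)
    show "independent_elements M (\<Pi>\<^sub>M i\<in>{1..}. borel) (\<lambda>\<omega>. \<lambda>i\<in>{1..}. \<xi> i \<omega>)
        (\<Pi>\<^sub>M i\<in>{1..}. borel) (\<lambda>\<omega>. \<lambda>i\<in>{1..}. e i \<omega>)"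
      using C unfolding e_def[abs_def] .
    show "integrable M (\<xi> 1)" by (rule DAN_integrable[OF B_iid B_DAN])
    show "\<not> (AE \<omega> in M. \<xi> 1 \<omega> = a)" for a by (rule DAN_nondegenerate[OF B_iid B_DAN])
  qed
  have fst_meas: "(fst :: real \<times> real \<Rightarrow> real) \<in> borel_measurable borel"
    and snd_meas: "(snd :: real \<times> real \<Rightarrow> real) \<in> borel_measurable borel"
    by (intro borel_measurable_continuous_onI continuous_intros)+
  have err_rv: "\<delta> i \<in> borel_measurable M" "\<epsilon> i \<in> borel_measurable M" if "1 \<le> i" for i
    using measurable_compose[OF ss.e_rv[OF that] fst_meas] measurable_compose[OF ss.e_rv[OF that] snd_meas]
    by (simp_all add: e_def)
  have [measurable]: "\<delta> 1 \<in> borel_measurable M" "\<epsilon> 1 \<in> borel_measurable M"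
    "\<delta> (Suc 0) \<in> borel_measurable M" "\<epsilon> (Suc 0) \<in> borel_measurable M"
    by (rule err_rv; simp)+
  have d4: "integrable M (\<lambda>\<omega>. ((\<delta> 1 \<omega>)\<^sup>2)\<^sup>2)" and e4: "integrable M (\<lambda>\<omega>. ((\<epsilon> 1 \<omega>)\<^sup>2)\<^sup>2)"
    using A_moments[of 1] by simp_all
  have de4: "integrable M (\<lambda>\<omega>. (\<delta> 1 \<omega> * \<epsilon> 1 \<omega>)\<^sup>2)"
    unfolding power_mult_distrib by (rule integrable_product_of_squares[OF _ _ d4 e4]) measurable
  have d2: "integrable M (\<lambda>\<omega>. (\<delta> 1 \<omega>)\<^sup>2)" and e2: "integrable M (\<lambda>\<omega>. (\<epsilon> 1 \<omega>)\<^sup>2)"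
    by (rule square_integrable_imp_integrable[OF _ d4] square_integrable_imp_integrable[OF _ e4]; measurable)+
  have de2: "integrable M (\<lambda>\<omega>. \<delta> 1 \<omega> * \<epsilon> 1 \<omega>)"
    by (rule integrable_product_of_squares[OF _ _ d2 e2]) measurable
  have d1: "integrable M (\<delta> 1)" and e1: "integrable M (\<epsilon> 1)"
    by (rule square_integrable_imp_integrable[OF _ d2] square_integrable_imp_integrable[OF _ e2]; measurable)+
  have means: "expectation (\<delta> 1) = 0" "expectation (\<epsilon> 1) = 0" using A_mean[of 1] by simp_all
  have cov: "covariance_matrix M (\<delta> 1) (\<epsilon> 1) = vector [vector [lam * \<theta>, \<mu>], vector [\<mu>, \<theta>]]"
    by (rule A_cov) simp
  have Edd: "expectation (\<lambda>\<omega>. (\<delta> 1 \<omega>)\<^sup>2) = lam * \<theta>"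
    using arg_cong[OF cov, of "\<lambda>A. A $ 1 $ 1"] means
    by (simp add: covariance_matrix_def covariance_def power2_eq_square)
  have Ede: "expectation (\<lambda>\<omega>. \<delta> 1 \<omega> * \<epsilon> 1 \<omega>) = \<mu>"
    using arg_cong[OF cov, of "\<lambda>A. A $ 1 $ 2"] means
    by (simp add: covariance_matrix_def covariance_def)
  have Eee: "expectation (\<lambda>\<omega>. (\<epsilon> 1 \<omega>)\<^sup>2) = \<theta>"
    using arg_cong[OF cov, of "\<lambda>A. A $ 2 $ 2"] means
    by (simp add: covariance_matrix_def covariance_def power2_eq_square)
  \<comment> \<open>the variance of \<open>\<delta> - \<beta> \<epsilon>\<close>: the quadratic form of \<open>\<Gamma>\<close> at \<open>(1, - \<beta>)\<close>\<close>
  have quad: "0 < lam * \<theta> - 2 * \<beta> * \<mu> + \<beta>\<^sup>2 * \<theta>"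
  proof -
    let ?z = "vector [1, - \<beta>] :: real^2"
    let ?A = "vector [vector [lam * \<theta>, \<mu>], vector [\<mu>, \<theta>]] :: real^2^2"
    have "?z $ 1 = 1" by simp
    then have "?z \<noteq> 0" by (metis zero_index zero_neq_one)
    then have "0 < ?z \<bullet> (?A *v ?z)" using A_pos_def unfolding positive_definite_def by blast
    also have "?z \<bullet> (?A *v ?z) = lam * \<theta> - 2 * \<beta> * \<mu> + \<beta>\<^sup>2 * \<theta>"
      by (simp add: inner_vec_def matrix_vector_mult_def sum_2 power2_eq_square algebra_simps)
    finally show ?thesis .
  qed
  obtain p where p: "0 \<le> p" "(expectation (\<xi> 1))\<^sup>2 * p < 1"
    "((\<lambda>t. 1 / ss.mean_sq t) \<longlongrightarrow> p) (in_prob M)" "\<forall>\<^sub>F t in in_prob M. 0 < ss.mean_sq t"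
    "p \<noteq> 0 \<Longrightarrow> integrable M (\<lambda>\<omega>. (\<xi> 1 \<omega>)\<^sup>2)"
    using ss.inverse_mean_sq_limit by metis
  have c01: "c = 0 \<or> c = 1" using c_switch by auto
  \<comment> \<open>the instrument \<open>z\<close> is \<open>y - \<alpha> = \<beta> \<xi> + \<delta>\<close> for \<open>j = 1\<close> and \<open>x = \<xi> + \<epsilon>\<close> for \<open>j = 2\<close>\<close>
  define f where "f = (if j = 1 then fst else snd :: real \<times> real \<Rightarrow> real)"
  define h where "h v = fst v - \<beta> * snd v" for v :: "real \<times> real"
  define \<kappa> where "\<kappa> = (if j = 1 then \<beta> else 1)"
  define \<rho> where "\<rho> = (if j = 1 then lam * \<theta> - \<beta> * \<mu> else \<mu> - \<beta> * \<theta>)"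
  define \<tau> where "\<tau> = (if j = 1 then \<mu> else \<theta>)"
  have h_e: "h (e i \<omega>) = \<delta> i \<omega> + (- \<beta>) * \<epsilon> i \<omega>" for i \<omega> by (simp add: h_def e_def)
  have h_sq_eq: "(h (e 1 \<omega>))\<^sup>2 = (\<delta> 1 \<omega>)\<^sup>2 - 2 * \<beta> * (\<delta> 1 \<omega> * \<epsilon> 1 \<omega>) + \<beta>\<^sup>2 * (\<epsilon> 1 \<omega>)\<^sup>2" for \<omega>
    by (simp add: h_e power2_eq_square algebra_simps)
  have fh_eq: "f (e 1 \<omega>) * h (e 1 \<omega>) = (if j = 1 then (\<delta> 1 \<omega>)\<^sup>2 + (- \<beta>) * (\<delta> 1 \<omega> * \<epsilon> 1 \<omega>)
      else \<delta> 1 \<omega> * \<epsilon> 1 \<omega> + (- \<beta>) * (\<epsilon> 1 \<omega>)\<^sup>2)" for \<omega>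
    unfolding h_e by (simp add: f_def e_def power2_eq_square algebra_simps)
  have fg_eq: "f (e 1 \<omega>) * snd (e 1 \<omega>) = (if j = 1 then \<delta> 1 \<omega> * \<epsilon> 1 \<omega> else (\<epsilon> 1 \<omega>)\<^sup>2)" for \<omega>
    by (simp add: f_def e_def power2_eq_square)
  interpret sl: slope_equation M \<xi> e f snd h \<kappa> c p \<rho> \<tau>
  proof (rule slope_equation.intro, rule ss.structural_sample_axioms, rule slope_equation_axioms.intro)
    show "f \<in> borel_measurable borel" using fst_meas snd_meas by (simp add: f_def)
    show "(snd :: real \<times> real \<Rightarrow> real) \<in> borel_measurable borel" by (rule snd_meas)
    show "h \<in> borel_measurable borel" unfolding h_def
      by (intro borel_measurable_diff borel_measurable_times borel_measurable_const fst_meas snd_meas)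
    show "integrable M (\<lambda>\<omega>. (f (e 1 \<omega>))\<^sup>2)" using d2 e2 by (simp add: f_def e_def)
    show "expectation (\<lambda>\<omega>. f (e 1 \<omega>)) = 0" using means by (simp add: f_def e_def)
    show "integrable M (\<lambda>\<omega>. (snd (e 1 \<omega>))\<^sup>2)" using e2 by (simp add: e_def)
    show "expectation (\<lambda>\<omega>. snd (e 1 \<omega>)) = 0" using means by (simp add: e_def)
    show "integrable M (\<lambda>\<omega>. (h (e 1 \<omega>))\<^sup>2)" unfolding h_sq_eq using d2 de2 e2 by simp
    show "expectation (\<lambda>\<omega>. h (e 1 \<omega>)) = 0" unfolding h_e using d1 e1 means by simp
    show "0 < expectation (\<lambda>\<omega>. (h (e 1 \<omega>))\<^sup>2)"
      unfolding h_sq_eq using d2 de2 e2 Edd Ede Eee quad by simp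
    show "integrable M (\<lambda>\<omega>. (f (e 1 \<omega>) * h (e 1 \<omega>))\<^sup>2)"
    proof (cases "j = 1")
      case True
      have "integrable M (\<lambda>\<omega>. ((\<delta> 1 \<omega>)\<^sup>2 + (- \<beta>) * (\<delta> 1 \<omega> * \<epsilon> 1 \<omega>))\<^sup>2)"
        by (intro square_integrable_add square_integrable_cmult d4 de4) measurable
      then show ?thesis unfolding fh_eq using True by simp
    next
      case False
      have "integrable M (\<lambda>\<omega>. (\<delta> 1 \<omega> * \<epsilon> 1 \<omega> + (- \<beta>) * (\<epsilon> 1 \<omega>)\<^sup>2)\<^sup>2)"
        by (intro square_integrable_add square_integrable_cmult e4 de4) measurable
      then show ?thesis unfolding fh_eq using False by simp
    qed
    show "integrable M (\<lambda>\<omega>. (f (e 1 \<omega>) * snd (e 1 \<omega>))\<^sup>2)"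
      unfolding fg_eq using de4 e4 by (cases "j = 1") simp_all
    show "expectation (\<lambda>\<omega>. f (e 1 \<omega>) * h (e 1 \<omega>)) = \<rho>"
      unfolding fh_eq \<rho>_def using d2 de2 e2 Edd Ede Eee by (cases "j = 1") simp_all
    show "expectation (\<lambda>\<omega>. f (e 1 \<omega>) * snd (e 1 \<omega>)) = \<tau>"
      unfolding fg_eq \<tau>_def using Ede Eee by (cases "j = 1") simp_all
    show "\<kappa> \<noteq> 0" using slope by (simp add: \<kappa>_def)
    show "c = 0 \<or> c = 1" by (rule c01)
    show "0 \<le> p" "(expectation (\<xi> 1))\<^sup>2 * p < 1" "((\<lambda>t. 1 / ss.mean_sq t) \<longlongrightarrow> p) (in_prob M)"
      "\<forall>\<^sub>F t in in_prob M. 0 < ss.mean_sq t" "p \<noteq> 0 \<Longrightarrow> integrable M (\<lambda>\<omega>. (\<xi> 1 \<omega>)\<^sup>2)"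
      by (rule p; assumption)+
  qed
  define yy where "yy t i = \<beta> * \<xi> i (snd t) + fst (e i (snd t))" for t :: "nat \<times> 'a" and i
  \<comment> \<open>the conditions under which the slope estimator is given by its formula\<close>
  have good: "\<forall>\<^sub>F t in in_prob M. (j = 1 \<longrightarrow> sl.D t \<noteq> 0 \<and> S c (fst t) (yy t) (yy t) - lam * \<theta> > 0) \<and> (j = 2 \<longrightarrow> sl.D t > 0)"
  proof (cases "j = 1")
    case True
    have "((\<lambda>t. (S c (fst t) (yy t) (yy t) - lam * \<theta>) / ss.mean_sq t) \<longlongrightarrow> \<beta> * \<beta> * (1 - c * (expectation (\<xi> 1))\<^sup>2 * p)) (in_prob M)"
      unfolding yy_def[abs_def]
      by (rule ss.cross_moment_limit[OF p(3,4) c01 fst_meas _ _ fst_meas])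
         (use d2 means Edd in \<open>simp_all add: e_def power2_eq_square\<close>)
    moreover have "0 < \<beta> * \<beta> * (1 - c * (expectation (\<xi> 1))\<^sup>2 * p)"
      using slope[OF True] sl.q_pos unfolding sl.q_def by (metis mult_pos_pos not_real_square_gt_zero)
    ultimately have "\<forall>\<^sub>F t in in_prob M. 0 < (S c (fst t) (yy t) (yy t) - lam * \<theta>) / ss.mean_sq t"
      by (rule order_tendstoD(1))
    moreover have "\<kappa> * sl.q \<noteq> 0" using sl.kappa sl.q_pos by simp
    then have "\<forall>\<^sub>F t in in_prob M. sl.D t / ss.mean_sq t \<noteq> 0"
      by (rule tendsto_imp_eventually_ne[OF sl.D_lim])
    ultimately show ?thesis using p(4)
      by eventually_elim (use True in \<open>simp add: zero_less_divide_iff\<close>)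
  next
    case False
    then have "0 < \<kappa> * sl.q" using sl.q_pos by (simp add: \<kappa>_def)
    then have "\<forall>\<^sub>F t in in_prob M. 0 < sl.D t / ss.mean_sq t"
      by (rule order_tendstoD(1)[OF sl.D_lim])
    then show ?thesis using p(4)
      by eventually_elim (use False in \<open>simp add: zero_less_divide_iff\<close>)
  qed
  let ?X = "\<lambda>t i. x i (snd t)" and ?Y = "\<lambda>t i. y i (snd t)"
  let ?b = "\<lambda>t. beta_hat j c lam \<theta> \<mu> (fst t) (?X t) (?Y t)"
  have expansion:
    "1 \<le> i \<Longrightarrow> v_term j c lam \<theta> \<mu> \<alpha> b (fst t) (?X t) (?Y t) i =
      sl.V t i - (b - \<beta>) * (sl.xx t i - sl.K t * (cross c (fst t) (sl.zz t) (sl.xx t) i - \<tau>))"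
    "(j = 1 \<longrightarrow> sl.D t \<noteq> 0 \<and> S c (fst t) (yy t) (yy t) - lam * \<theta> > 0) \<Longrightarrow> (j = 2 \<longrightarrow> sl.D t > 0) \<Longrightarrow>
      ?b t - \<beta> = sl.ubar t / sl.D t"
    "alpha_hat j c lam \<theta> \<mu> (fst t) (?X t) (?Y t) - \<alpha> = avg (fst t) (sl.hh t) - avg (fst t) (sl.xx t) * (?b t - \<beta>)"
    if t: "1 \<le> fst t" "snd t \<in> space M" for t i b
  proof -
    have X: "?X t i = sl.xx t i" if "1 \<le> i" for i
      using model_x[OF that t(2)] by (simp add: sl.xx_def e_def)
    have Y: "?Y t i = yy t i + \<alpha>" if "1 \<le> i" for i
      using model_y[OF that t(2)] by (simp add: yy_def e_def)
    have z: "sl.zz t = (if j = 1 then yy t else sl.xx t)"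
      unfolding fun_eq_iff sl.zz_def by (simp add: yy_def sl.xx_def \<kappa>_def f_def)
    have hs: "sl.hh t = (\<lambda>i. yy t i - \<beta> * sl.xx t i)"
      by (simp add: fun_eq_iff sl.hh_def h_def yy_def sl.xx_def algebra_simps)
    note ex = estimator_expansion[OF X Y t(1) c_switch \<open>j \<in> {1, 2}\<close> z hs \<rho>_def \<tau>_def]
    show "v_term j c lam \<theta> \<mu> \<alpha> b (fst t) (?X t) (?Y t) i =
      sl.V t i - (b - \<beta>) * (sl.xx t i - sl.K t * (cross c (fst t) (sl.zz t) (sl.xx t) i - \<tau>))" if "1 \<le> i"
      unfolding sl.V_def sl.K_def sl.D_def by (rule ex(1)) (use that in simp_all)
    show "?b t - \<beta> = sl.ubar t / sl.D t"
      if "j = 1 \<longrightarrow> sl.D t \<noteq> 0 \<and> S c (fst t) (yy t) (yy t) - lam * \<theta> > 0" "j = 2 \<longrightarrow> sl.D t > 0"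
      using that unfolding sl.ubar_def sl.D_def by (intro ex(2)) simp_all
    show "alpha_hat j c lam \<theta> \<mu> (fst t) (?X t) (?Y t) - \<alpha> = avg (fst t) (sl.hh t) - avg (fst t) (sl.xx t) * (?b t - \<beta>)"
      by (rule ex(3)) simp_all
  qed
  have T: "\<forall>\<^sub>F t in in_prob M. sqrt (real (fst t)) * (alpha_hat j c lam \<theta> \<mu> (fst t) (?X t) (?Y t) - \<alpha>) =
      sqrt (real (fst t)) * (avg (fst t) (sl.hh t) - sl.K t * sl.ubar t)"
    using good eventually_fst_ge_in_prob[of 1] eventually_space_in_prob
  proof eventually_elim
    case (elim t)
    then show ?case using expansion(2,3)[of t] by (simp add: sl.K_def)
  qed
  have V: "((\<lambda>t. avg (fst t) (\<lambda>i. (v_term j c lam \<theta> \<mu> \<alpha> \<beta> (fst t) (?X t) (?Y t) i - sl.w i (snd t))\<^sup>2)) \<longlongrightarrow> 0) (in_prob M)"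
  proof (rule Lim_transform_eventually[OF sl.V_close])
    show "\<forall>\<^sub>F t in in_prob M. avg (fst t) (\<lambda>i. (sl.V t i - sl.w i (snd t))\<^sup>2) =
        avg (fst t) (\<lambda>i. (v_term j c lam \<theta> \<mu> \<alpha> \<beta> (fst t) (?X t) (?Y t) i - sl.w i (snd t))\<^sup>2)"
      using eventually_fst_ge_in_prob[of 1] eventually_space_in_prob
    proof eventually_elim
      case (elim t)
      then show ?case by (intro avg_cong) (simp add: expansion(1))
    qed
  qed
  have W: "((\<lambda>t. avg (fst t) (\<lambda>i. (v_tilde j c lam \<theta> \<mu> \<alpha> (fst t) (?X t) (?Y t) i - sl.w i (snd t))\<^sup>2)) \<longlongrightarrow> 0) (in_prob M)"
  proof (rule Lim_transform_eventually[OF sl.W_close])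
    show "\<forall>\<^sub>F t in in_prob M. avg (fst t) (\<lambda>i. (sl.W t i - sl.w i (snd t))\<^sup>2) =
        avg (fst t) (\<lambda>i. (v_tilde j c lam \<theta> \<mu> \<alpha> (fst t) (?X t) (?Y t) i - sl.w i (snd t))\<^sup>2)"
      using good eventually_fst_ge_in_prob[of 1] eventually_space_in_prob
    proof eventually_elim
      case (elim t)
      have "?b t - \<beta> = sl.ubar t / sl.D t" using elim by (intro expansion(2)) auto
      then show ?case using elim by (intro avg_cong) (simp add: expansion(1) v_tilde_def sl.W_def)
    qed
  qed
  have X_rv: "x i \<in> borel_measurable M" and Y_rv: "y i \<in> borel_measurable M" if "1 \<le> i" for i
  proof -
    note [measurable] = err_rv[OF that] ss.xi_rv[OF that]
    have "(\<lambda>\<omega>. \<xi> i \<omega> + \<epsilon> i \<omega>) \<in> borel_measurable M" "(\<lambda>\<omega>. \<beta> * \<xi> i \<omega> + \<alpha> + \<delta> i \<omega>) \<in> borel_measurable M"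
      by measurable
    then show "x i \<in> borel_measurable M" "y i \<in> borel_measurable M"
      using model_x[OF that] model_y[OF that] by (simp_all cong: measurable_cong)
  qed
  note est = estimator_measurable[OF X_rv Y_rv]
  have meas: "(\<lambda>\<omega>. sqrt (real n) * (alpha_hat j c lam \<theta> \<mu> n (\<lambda>i. x i \<omega>) (\<lambda>i. y i \<omega>) - \<alpha>) *
      sample_variance n (v_term j c lam \<theta> \<mu> \<alpha> (b \<omega>) n (\<lambda>i. x i \<omega>) (\<lambda>i. y i \<omega>)) powr (- 1 / 2)) \<in> borel_measurable M"
    if "b \<in> borel_measurable M" for n b
    by (intro borel_measurable_times borel_measurable_diff borel_measurable_const powr_real_measurable est that; assumption)
  show ?thesis
    unfolding Let_def
  proof (intro conjI)
    show "weak_conv_m (\<lambda>n. distr M borel (\<lambda>\<omega>. sqrt (real n) * (alpha_hat j c lam \<theta> \<mu> n (\<lambda>i. x i \<omega>) (\<lambda>i. y i \<omega>) - \<alpha>) *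
        sample_variance n (v_term j c lam \<theta> \<mu> \<alpha> \<beta> n (\<lambda>i. x i \<omega>) (\<lambda>i. y i \<omega>)) powr (- 1 / 2))) std_normal_distribution"
      by (rule sl.studentized_weak_conv[OF V T meas]) simp
    show "weak_conv_m (\<lambda>n. distr M borel (\<lambda>\<omega>. sqrt (real n) * (alpha_hat j c lam \<theta> \<mu> n (\<lambda>i. x i \<omega>) (\<lambda>i. y i \<omega>) - \<alpha>) *
        sample_variance n (v_tilde j c lam \<theta> \<mu> \<alpha> n (\<lambda>i. x i \<omega>) (\<lambda>i. y i \<omega>)) powr (- 1 / 2))) std_normal_distribution"
    proof (rule sl.studentized_weak_conv[OF W T])
      show "(\<lambda>\<omega>. sqrt (real n) * (alpha_hat j c lam \<theta> \<mu> n (\<lambda>i. x i \<omega>) (\<lambda>i. y i \<omega>) - \<alpha>) *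
        sample_variance n (v_tilde j c lam \<theta> \<mu> \<alpha> n (\<lambda>i. x i \<omega>) (\<lambda>i. y i \<omega>)) powr (- 1 / 2)) \<in> borel_measurable M" for n
        unfolding v_tilde_def by (rule meas[OF est(1)])
    qed
  qed
qed

end
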